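(* Let $\mathbf{T}$ be a tiling of $\mathbb{R}^n$ that has finite local complexity, is aperiodic and repetitive, and whose tiles are convex polytopes meeting full-face to full-face. Let $f_1,f_2$ be positive strongly pattern equivariant (PE) mass distributions with respect to $\mathbf{T}$, and let $[f_1],[f_2]\in\check H^n(\Omega_{\mathbf{T}},\mathbb{R})$ be the associated classes. Then: (1) There exists a bounded transport from $f_1$ to $f_2$ if and only if $[f_1]-[f_2]$ is well-balanced. (2) There exists a weakly PE transport from $f_1$ to $f_2$ if and only if $[f_1]-[f_2]$ is asymptotically negligible. (3) There exists a strongly PE transport from $f_1$ to $f_2$ if and only if $[f_1]=[f_2]$.
   Context: Tilings. A tile is a topological ball in $\mathbb{R}^n$, equal to the closure of its interior, equipped with a label; a tiling is a set of tiles with union $\mathbb{R}^n$ that intersect only on their boundaries. A patch is a finite set of tiles of a tiling. Tiles, patches and tilings are translated by translating all points, keeping labels. For compact $K$, $[K]_{\mathbf{T}}$ is the patch of tiles of $\mathbf{T}$ that intersect $K$; $B_R(x)$ is the closed ball of radius $R$ about $x$. Finite local complexity (FLC): for every compact $K$ the set $\{[K-x]_{\mathbf{T}} : x\in\mathbb{R}^n\}$ is finite up to translation. Repetitive: for every patch $P$ of $\mathbf{T}$ there is $R$ such that every ball of radius $R$ in $\mathbf{T}$ contains a translate of $P$. Aperiodic: $\mathbf{T}-x=\mathbf{T}$ implies $x=0$. The continuous hull $\Omega_{\mathbf{T}}$ is the completion of $\{\mathbf{T}-x : x\in\mathbb{R}^n\}$ in the metric in which two tilings are $\epsilon$-close if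 they agree on the ball of radius $1/\epsilon$ about the origin after translations by vectors of length less than $\epsilon$. Pattern equivariance. A continuous $f:\mathbb{R}^n\to\mathbb{R}$ is strongly PE if there is $R$ such that $[B_R(0)]_{\mathbf{T}-x}=[B_R(0)]_{\mathbf{T}-y}$ implies $f(x)=f(y)$; weakly PE means a uniform limit of strongly PE functions (of arbitrary radii). The tiling decomposes $\mathbb{R}^n$ into $k$-cells (vertices, edges, faces, ..., with translation-consistent orientations); a $k$-cochain assigns a real number to each $k$-cell. It is strongly PE if there is $R$ such that its values agree on any $k$-cell $c$ containing a point $x$ and the corresponding cell $c-x+y$ whenever $[B_R(0)]_{\mathbf{T}-x}=[B_R(0)]_{\mathbf{T}-y}$; weakly PE means a uniform limit of strongly PE cochains. $\delta$ is the cellular coboundary. The cohomology of the complex of strongly PE real cochains is canonically isomorphic to the real Čech cohomology of $\Omega_{\mathbf{T}}$, and $\check H^k(\Omega_{\mathbf{T}},\mathbb{R})$ denotes either. Classes. A strongly PE mass distribution is a strongly PE function (as density); its class $[f_i]$ is the class of the strongly PE $n$-cochain $\alpha_i$ with $\alpha_i(t)=\int_t f_i\,d^nx$ for each tile $t$. A strongly PE $n$-cochain $\alpha$ is well-balanced if there are constants $c_1,c_2$ with $\left|\int_P\alpha\right|\le c_1+c_2|\partial P|$ for every patch $P$, where $\int_P\alpha$ is the value of $\alpha$ on the chain $P$ and $|\partial P|$ is the $(n-1)$-dimensional Lebesgue measure of the boundary of $P$. A strongly PE $n$-cochain $\alpha$ is weakly exact if $\alpha=\delta\beta$ for some weakly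 PE $(n-1)$-cochain $\beta$. Both properties depend only on the cohomology class; a class is called well-balanced if it is represented by a well-balanced cochain, and asymptotically negligible if it is represented by a weakly exact cochain. Transport. A bounded transport from $f_1$ to $f_2$ is a non-negative $b\in L^1_{loc}(\mathbb{R}^n\times\mathbb{R}^n)$ such that $\int b(x,y)\,dy=f_1(x)$, $\int b(x,y)\,dx=f_2(y)$, and, for some constant $r$, $b(x,y)=0$ when $|x-y|>r$. A function $g$ on $\mathbb{R}^n\times\mathbb{R}^n$ is strongly PE if its value at $(x,y)$ is determined exactly by the pattern of $\mathbf{T}$ in a ball of some fixed radius $R'$ around $x$, i.e. $[B_{R'}(0)]_{\mathbf{T}-x}=[B_{R'}(0)]_{\mathbf{T}-x'}$ implies $g(x,x+v)=g(x',x'+v)$ for all $v\in\mathbb{R}^n$; it is weakly PE if it is a uniform limit of strongly PE functions. A bounded transport $b$ is a strongly PE transport if $b$ is strongly PE in this sense. It is a weakly PE transport if, for all compact $A,B\subset\mathbb{R}^n$, the function $b_{A,B}(x,y)=\iint_{(x+A)\times(y+B)}b(x',y')\,d^nx'\,d^ny'$ is weakly PE. *)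

theory Defs
  imports "HOL-Analysis.Analysis" "HOL-Algebra.Coset"
begin

section \<open>Tilings\<close>

type_synonym ('a, 'l) tile = "'a set \<times> 'l"

definition tile :: "('a::euclidean_space, 'l) tile \<Rightarrow> bool" where
  "tile t \<longleftrightarrow> fst t homeomorphic cball (0::'a) 1 \<and> fst t = closure (interior (fst t))"

definition tiling :: "('a::euclidean_space, 'l) tile set \<Rightarrow> bool" where
  "tiling T \<longleftrightarrow>
     (\<forall>t\<in>T. tile t) \<and>
     (\<Union>t\<in>T. fst t) = UNIV \<and>
     (\<forall>s\<in>T. \<forall>t\<in>T. s \<noteq> t \<longrightarrow> fst s \<inter> fst t \<subseteq> frontier (fst s) \<inter> frontier (fst t))"

definition polytopal :: "('a::euclidean_space, 'l) tile set \<Rightarrow> bool" where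
  "polytopal T \<longleftrightarrow> (\<forall>t\<in>T. polytope (fst t))"

text \<open>The empty set counts as a face, so disjoint tiles are covered.\<close>

definition full_face_to_full_face :: "('a::euclidean_space, 'l) tile set \<Rightarrow> bool" where
  "full_face_to_full_face T \<longleftrightarrow>
     (\<forall>s\<in>T. \<forall>t\<in>T. (fst s \<inter> fst t) face_of fst s \<and> (fst s \<inter> fst t) face_of fst t)"

definition translate :: "'a::euclidean_space \<Rightarrow> ('a, 'l) tile set \<Rightarrow> ('a, 'l) tile set" where
  "translate v P = (\<lambda>(S, l). ((+) v ` S, l)) ` P"

definition patch :: "('a, 'l) tile set \<Rightarrow> ('a, 'l) tile set \<Rightarrow> bool" where
  "patch T P \<longleftrightarrow> finite P \<and> P \<subseteq> T"

definition tiles_meeting :: "('a, 'l) tile set \<Rightarrow> 'a set \<Rightarrow> ('a, 'l) tile set" where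
  "tiles_meeting T K = {t \<in> T. fst t \<inter> K \<noteq> {}}"

definition finite_local_complexity :: "('a::euclidean_space, 'l) tile set \<Rightarrow> bool" where
  "finite_local_complexity T \<longleftrightarrow>
     (\<forall>K. compact K \<longrightarrow>
       (\<exists>\<P>. finite \<P> \<and> (\<forall>x. \<exists>P\<in>\<P>. \<exists>v. tiles_meeting T ((+) (- x) ` K) = translate v P)))"

definition repetitive :: "('a::euclidean_space, 'l) tile set \<Rightarrow> bool" where
  "repetitive T \<longleftrightarrow>
     (\<forall>P. patch T P \<longrightarrow>
       (\<exists>R. \<forall>x. \<exists>v. translate v P \<subseteq> T \<and> (\<Union>t\<in>translate v P. fst t) \<subseteq> cball x R))"

definition aperiodic :: "('a::euclidean_space, 'l) tile set \<Rightarrow> bool" where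
  "aperiodic T \<longleftrightarrow> (\<forall>x. translate (- x) T = T \<longrightarrow> x = 0)"


section \<open>Pattern equivariant functions\<close>

definition same_pattern :: "('a::euclidean_space, 'l) tile set \<Rightarrow> real \<Rightarrow> 'a \<Rightarrow> 'a \<Rightarrow> bool" where
  "same_pattern T R x y \<longleftrightarrow>
     tiles_meeting (translate (- x) T) (cball 0 R) = tiles_meeting (translate (- y) T) (cball 0 R)"

definition strongly_PE :: "('a::euclidean_space, 'l) tile set \<Rightarrow> ('a \<Rightarrow> real) \<Rightarrow> bool" where
  "strongly_PE T f \<longleftrightarrow>
     continuous_on UNIV f \<and> (\<exists>R>0. \<forall>x y. same_pattern T R x y \<longrightarrow> f x = f y)"

definition strongly_PE2 :: "('a::euclidean_space, 'l) tile set \<Rightarrow> ('a \<times> 'a \<Rightarrow> real) \<Rightarrow> bool" where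
  "strongly_PE2 T g \<longleftrightarrow>
     (\<exists>R>0. \<forall>x x'. same_pattern T R x x' \<longrightarrow> (\<forall>v. g (x, x + v) = g (x', x' + v)))"

definition weakly_PE2 :: "('a::euclidean_space, 'l) tile set \<Rightarrow> ('a \<times> 'a \<Rightarrow> real) \<Rightarrow> bool" where
  "weakly_PE2 T g \<longleftrightarrow>
     (\<exists>h. (\<forall>j. strongly_PE2 T (h j)) \<and> uniform_limit UNIV h g sequentially)"


section \<open>Pattern equivariant cochains\<close>

text \<open>
  Cells are sets of points: within a tiling a tile is determined by its underlying set, so labels
  need not be kept.  A cochain is a function on all sets which is 0 outside the cells.
\<close>

definition cells :: "('a::euclidean_space, 'l) tile set \<Rightarrow> nat \<Rightarrow> 'a set set" where
  "cells T k = {c. (\<exists>t\<in>T. c face_of fst t) \<and> aff_dim c = int k}"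

definition cochain :: "('a::euclidean_space, 'l) tile set \<Rightarrow> nat \<Rightarrow> ('a set \<Rightarrow> real) \<Rightarrow> bool" where
  "cochain T k \<alpha> \<longleftrightarrow> (\<forall>c. c \<notin> cells T k \<longrightarrow> \<alpha> c = 0)"

definition strongly_PE_cochain ::
    "('a::euclidean_space, 'l) tile set \<Rightarrow> nat \<Rightarrow> ('a set \<Rightarrow> real) \<Rightarrow> bool" where
  "strongly_PE_cochain T k \<alpha> \<longleftrightarrow>
     cochain T k \<alpha> \<and>
     (\<exists>R>0. \<forall>c\<in>cells T k. \<forall>x\<in>c. \<forall>y.
        same_pattern T R x y \<longrightarrow> \<alpha> c = \<alpha> ((+) (y - x) ` c))"

definition weakly_PE_cochain ::
    "('a::euclidean_space, 'l) tile set \<Rightarrow> nat \<Rightarrow> ('a set \<Rightarrow> real) \<Rightarrow> bool" where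
  "weakly_PE_cochain T k \<alpha> \<longleftrightarrow>
     cochain T k \<alpha> \<and>
     (\<exists>\<beta>. (\<forall>j. strongly_PE_cochain T k (\<beta> j)) \<and> uniform_limit (cells T k) \<beta> \<alpha> sequentially)"

text \<open>
  Top-dimensional cells carry the standard orientation of the space; a cell of codimension 1 is
  oriented by the choice of one of its two unit normals (for dimension 1, the cell is a point and
  the normal is 1 or -1).  The incidence number of a tile and one of its facets is 1 if the chosen
  normal points out of the tile and -1 otherwise.
\<close>

definition facet_orientation ::
    "('a::euclidean_space, 'l) tile set \<Rightarrow> ('a set \<Rightarrow> 'a) \<Rightarrow> bool" where
  "facet_orientation T \<nu> \<longleftrightarrow>
     (\<forall>c\<in>cells T (DIM('a) - 1).
        norm (\<nu> c) = 1 \<and>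
        (\<forall>p\<in>c. \<forall>q\<in>c. \<nu> c \<bullet> (p - q) = 0) \<and>
        (\<forall>v. (+) v ` c \<in> cells T (DIM('a) - 1) \<longrightarrow> \<nu> ((+) v ` c) = \<nu> c))"

definition incidence :: "('a::euclidean_space set \<Rightarrow> 'a) \<Rightarrow> 'a set \<Rightarrow> 'a set \<Rightarrow> real" where
  "incidence \<nu> c d = (if \<forall>p\<in>c. \<forall>q\<in>d. \<nu> d \<bullet> p \<le> \<nu> d \<bullet> q then 1 else - 1)"

definition coboundary ::
    "('a::euclidean_space, 'l) tile set \<Rightarrow> ('a set \<Rightarrow> 'a) \<Rightarrow> ('a set \<Rightarrow> real) \<Rightarrow> 'a set \<Rightarrow> real" where
  "coboundary T \<nu> \<beta> c =
     (if c \<in> cells T (DIM('a)) then \<Sum>d\<in>{d. d facet_of c}. incidence \<nu> c d * \<beta> d else 0)"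


section \<open>Cohomology in top degree\<close>

definition PE_cochain_group ::
    "('a::euclidean_space, 'l) tile set \<Rightarrow> nat \<Rightarrow> ('a set \<Rightarrow> real) monoid" where
  "PE_cochain_group T k =
     \<lparr>carrier = {\<alpha>. strongly_PE_cochain T k \<alpha>}, mult = (\<lambda>\<alpha> \<beta> c. \<alpha> c + \<beta> c), one = (\<lambda>c. 0)\<rparr>"

definition PE_coboundaries ::
    "('a::euclidean_space, 'l) tile set \<Rightarrow> ('a set \<Rightarrow> 'a) \<Rightarrow> ('a set \<Rightarrow> real) set" where
  "PE_coboundaries T \<nu> = coboundary T \<nu> ` carrier (PE_cochain_group T (DIM('a) - 1))"

text \<open>Every cochain of top degree is a cocycle.\<close>

definition top_cohomology ::
    "('a::euclidean_space, 'l) tile set \<Rightarrow> ('a set \<Rightarrow> 'a) \<Rightarrow> ('a set \<Rightarrow> real) set monoid" where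
  "top_cohomology T \<nu> = PE_cochain_group T (DIM('a)) Mod PE_coboundaries T \<nu>"

definition mass_cochain ::
    "('a::euclidean_space, 'l) tile set \<Rightarrow> ('a \<Rightarrow> real) \<Rightarrow> 'a set \<Rightarrow> real" where
  "mass_cochain T f c = (if c \<in> cells T (DIM('a)) then (LINT x:c|lebesgue. f x) else 0)"

definition mass_class ::
    "('a::euclidean_space, 'l) tile set \<Rightarrow> ('a set \<Rightarrow> 'a) \<Rightarrow> ('a \<Rightarrow> real) \<Rightarrow> ('a set \<Rightarrow> real) set" where
  "mass_class T \<nu> f = PE_coboundaries T \<nu> #>\<^bsub>PE_cochain_group T (DIM('a))\<^esub> mass_cochain T f"

definition class_diff ::
    "('a::euclidean_space, 'l) tile set \<Rightarrow> ('a set \<Rightarrow> 'a) \<Rightarrow>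
     ('a set \<Rightarrow> real) set \<Rightarrow> ('a set \<Rightarrow> real) set \<Rightarrow> ('a set \<Rightarrow> real) set" where
  "class_diff T \<nu> A B = A \<otimes>\<^bsub>top_cohomology T \<nu>\<^esub> (inv\<^bsub>top_cohomology T \<nu>\<^esub> B)"


section \<open>Well-balanced and asymptotically negligible classes\<close>

text \<open>
  The Lebesgue measure, within a hyperplane \<open>H\<close>, of the part of \<open>E\<close> that lies in \<open>H\<close>: the volume
  of the right prism of height 1 over this set.
\<close>

definition hyperplane_area :: "'a::euclidean_space set \<Rightarrow> 'a set \<Rightarrow> real" where
  "hyperplane_area H E =
     measure lebesgue {x + u |x u. x \<in> E \<inter> H \<and> norm u \<le> 1/2 \<and> (\<forall>p\<in>H. u \<bullet> (p - x) = 0)}"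

text \<open>
  For sets contained in finitely many hyperplanes, such as boundaries of finite unions of polytopes.
  Distinct hyperplanes meet in sets of area 0, so nothing is counted twice, and only finitely many
  summands are nonzero.
\<close>

definition polyhedral_area :: "'a::euclidean_space set \<Rightarrow> real" where
  "polyhedral_area E =
     (\<Sum>\<^sub>\<infinity>H\<in>{H. affine H \<and> aff_dim H = int (DIM('a)) - 1}. hyperplane_area H E)"

definition patch_boundary_area :: "('a::euclidean_space, 'l) tile set \<Rightarrow> real" where
  "patch_boundary_area P = polyhedral_area (frontier (\<Union>t\<in>P. fst t))"

definition well_balanced ::
    "('a::euclidean_space, 'l) tile set \<Rightarrow> ('a set \<Rightarrow> real) \<Rightarrow> bool" where
  "well_balanced T \<alpha> \<longleftrightarrow>
     strongly_PE_cochain T (DIM('a)) \<alpha> \<and>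
     (\<exists>c1 c2. \<forall>P. patch T P \<longrightarrow> \<bar>\<Sum>t\<in>P. \<alpha> (fst t)\<bar> \<le> c1 + c2 * patch_boundary_area P)"

definition weakly_exact ::
    "('a::euclidean_space, 'l) tile set \<Rightarrow> ('a set \<Rightarrow> 'a) \<Rightarrow> ('a set \<Rightarrow> real) \<Rightarrow> bool" where
  "weakly_exact T \<nu> \<alpha> \<longleftrightarrow>
     strongly_PE_cochain T (DIM('a)) \<alpha> \<and>
     (\<exists>\<beta>. weakly_PE_cochain T (DIM('a) - 1) \<beta> \<and> \<alpha> = coboundary T \<nu> \<beta>)"

definition well_balanced_class ::
    "('a::euclidean_space, 'l) tile set \<Rightarrow> ('a set \<Rightarrow> real) set \<Rightarrow> bool" where
  "well_balanced_class T A \<longleftrightarrow> (\<exists>\<alpha>\<in>A. well_balanced T \<alpha>)"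

definition asymptotically_negligible_class ::
    "('a::euclidean_space, 'l) tile set \<Rightarrow> ('a set \<Rightarrow> 'a) \<Rightarrow> ('a set \<Rightarrow> real) set \<Rightarrow> bool" where
  "asymptotically_negligible_class T \<nu> A \<longleftrightarrow> (\<exists>\<alpha>\<in>A. weakly_exact T \<nu> \<alpha>)"


section \<open>Transport\<close>

text \<open>
  An element of \<open>L\<^sup>1\<^sub>l\<^sub>o\<^sub>c\<close> is given by a representative, so the marginal conditions are required
  almost everywhere.
\<close>

definition bounded_transport ::
    "('a::euclidean_space \<Rightarrow> real) \<Rightarrow> ('a \<Rightarrow> real) \<Rightarrow> ('a \<times> 'a \<Rightarrow> real) \<Rightarrow> bool" where
  "bounded_transport f1 f2 b \<longleftrightarrow>
     (\<forall>z. 0 \<le> b z) \<and>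
     (\<forall>K. compact K \<longrightarrow> set_integrable lebesgue K b) \<and>
     (AE x in lebesgue. has_bochner_integral lebesgue (\<lambda>y. b (x, y)) (f1 x)) \<and>
     (AE y in lebesgue. has_bochner_integral lebesgue (\<lambda>x. b (x, y)) (f2 y)) \<and>
     (\<exists>r. \<forall>x y. dist x y > r \<longrightarrow> b (x, y) = 0)"

definition strongly_PE_transport ::
    "('a::euclidean_space, 'l) tile set \<Rightarrow>
     ('a \<Rightarrow> real) \<Rightarrow> ('a \<Rightarrow> real) \<Rightarrow> ('a \<times> 'a \<Rightarrow> real) \<Rightarrow> bool" where
  "strongly_PE_transport T f1 f2 b \<longleftrightarrow> bounded_transport f1 f2 b \<and> strongly_PE2 T b"

definition weakly_PE_transport ::
    "('a::euclidean_space, 'l) tile set \<Rightarrow>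
     ('a \<Rightarrow> real) \<Rightarrow> ('a \<Rightarrow> real) \<Rightarrow> ('a \<times> 'a \<Rightarrow> real) \<Rightarrow> bool" where
  "weakly_PE_transport T f1 f2 b \<longleftrightarrow>
     bounded_transport f1 f2 b \<and>
     (\<forall>A B. compact A \<and> compact B \<longrightarrow>
        weakly_PE2 T (\<lambda>(x, y). LINT z:((+) x ` A) \<times> ((+) y ` B)|lebesgue. b z))"

end

theory Submission
  imports Defs
begin

text \<open>
  A bounded transport moves mass over a bounded distance only, so what matters are the amounts moved between
  tiles.  These are data on the dual graph of the tiling, whose vertices are the tiles and whose edges are the
  facets.  Let \<open>a\<close> and \<open>b\<close> be the masses of the tiles under the two densities.  A cochain \<open>\<beta>\<close> of codimension one is a
  flow on the dual graph, its coboundary is the divergence, and \<open>\<beta>\<close> balances the masses if \<open>\<delta>\<beta> = a - b\<close>.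
  The core of the proof is that a bounded, weakly equivariant or strongly equivariant transport exists if and only
  if the masses are balanced by a flow that is bounded, weakly equivariant or strongly equivariant
  (\<open>bounded_transport_iff_flow\<close>, \<open>weakly_PE_transport_iff_flow\<close>, \<open>strongly_PE_transport_iff_flow\<close>).

  From transports to flows: integrating a transport over products of tiles gives a coupling of \<open>a\<close> and \<open>b\<close>
  (\<open>coupling_of_transport\<close>).  Any two nearby tiles are joined by a path in the dual graph that stays nearby
  (\<open>tiles_connected\<close>), hence by a flow of one unit.  The superposition of these flows, weighted by the coupling,
  balances the masses (\<open>coboundary_flow_of\<close>).  If the joining flows are chosen by looking at the local pattern only,
  then equivariance is inherited (\<open>PE_cells_flow_of\<close>), and since everything is linear and locally finite, so are
  uniform limits (\<open>flow_of_close\<close>).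

  From flows to transports: a balancing flow can be much larger than the mass of a tile, so it cannot be carried out
  at once.  It is carried out in \<open>N\<close> small steps.  After \<open>k\<close> steps the masses are \<open>(1 - k/N) a + (k/N) b\<close>, which stays
  away from 0, so for large \<open>N\<close> no tile is asked for more mass than it contains.  What leaves a tile is a
  proportional sample of the mass that has arrived there (\<open>upwind\<close>), and keeping track of the origin of the mass
  yields a coupling of \<open>a\<close> and \<open>b\<close> (\<open>advect_coupling\<close>).  It depends on the flow in a local and Lipschitz way
  (\<open>PE_kernel_advect\<close>, \<open>advect_lipschitz\<close>).  Spreading the mass within pairs of tiles proportionally to the given
  densities turns the coupling into a transport (\<open>bounded_transport_density\<close>, \<open>weakly_PE_transport_density\<close>).

  It remains to compare flows with classes.  For strong and weak equivariance this is the definition of the quotient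
  group.  For well-balanced classes, the integral of \<open>\<delta>\<beta>\<close> over a patch is the flow through its boundary, hence
  at most \<open>sup |\<beta>|\<close> times the number of boundary facets.  Conversely, such an estimate for all patches yields a bounded
  flow by a max-flow min-cut argument: on a finite patch the squared defect is minimised over all flows of bounded
  capacity, and the coarea inequality shows that the minimum is 0; compactness then gives a flow on the whole tiling
  (\<open>max_flow_min_cut\<close>).  The number of boundary facets is comparable with the boundary area
  (\<open>boundary_area_bounds\<close>).

  Finite local complexity provides uniform bounds: there are finitely many tiles up to translation, and finitely many
  sample points represent all local patterns (\<open>finite_pattern_types\<close>), so equivariant quantities are bounded.
\<close>

section \<open>Tilings of finite local complexity\<close>

text \<open>
  A constant instead of the image itself, because the simplifier rewrites images under translations by
  differences into a different normal form.
\<close>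

definition shift :: "'a::euclidean_space \<Rightarrow> 'a set \<Rightarrow> 'a set" where
  "shift w S = (+) w ` S"

lemma mem_shift [simp]: "x \<in> shift w S \<longleftrightarrow> x - w \<in> S"
  by (force simp: shift_def image_iff)

lemma shift_shift [simp]: "shift v (shift w S) = shift (v + w) S"
  by (auto simp: algebra_simps)

lemma shift_0 [simp]: "shift 0 S = S"
  by auto

lemma shift_eq_iff [simp]: "shift w S = shift w U \<longleftrightarrow> S = U"
  by (metis shift_shift shift_0 add.left_inverse)

lemma bounded_shift: "bounded S \<Longrightarrow> bounded (shift w S)"
  unfolding shift_def by (rule bounded_translation)

lemma measure_shift: "measure lebesgue (shift w S) = measure lebesgue S"
  unfolding shift_def by (rule measure_translation)

text \<open>
  Pulling both patterns back to the origin turns agreement of patterns into a statement about which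
  translates of a set are tiles.  All later arguments compare \<open>x\<close> with \<open>x + w\<close>: the vector \<open>w\<close> then
  carries the tiles near \<open>x\<close> to tiles.
\<close>

lemma same_pattern_iff:
  fixes T :: "('a::euclidean_space, 'l) tile set"
  shows "same_pattern T R x y \<longleftrightarrow>
     (\<forall>S l. S \<inter> cball 0 R \<noteq> {} \<longrightarrow> ((shift x S, l) \<in> T \<longleftrightarrow> (shift y S, l) \<in> T))"
proof -
  have mem: "(S, l) \<in> translate (- v) T \<longleftrightarrow> (shift v S, l) \<in> T" for S l v
  proof
    assume "(S, l) \<in> translate (- v) T"
    then obtain U where "(U, l) \<in> T" "S = shift (- v) U"
      by (auto simp: translate_def shift_def)
    then show "(shift v S, l) \<in> T" by simp
  next
    assume "(shift v S, l) \<in> T"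
    then have "(shift (- v) (shift v S), l) \<in> translate (- v) T"
      unfolding translate_def shift_def[of "- v"] by (rule rev_image_eqI) auto
    then show "(S, l) \<in> translate (- v) T" by simp
  qed
  show ?thesis
    unfolding same_pattern_def tiles_meeting_def set_eq_iff
    by (auto simp: mem split_paired_all)
qed

lemma same_pattern_sym: "same_pattern T R x y \<Longrightarrow> same_pattern T R y x"
  by (auto simp: same_pattern_iff)

lemma same_pattern_back: "same_pattern T R x (x + w) \<Longrightarrow> same_pattern T R (x + w) (x + w + - w)"
  using same_pattern_sym by fastforce

text \<open>
  A smaller ball inside the ball of agreement inherits the agreement; this is how the radius of a
  pattern equivariant quantity pays for evaluating it at a nearby point.
\<close>

lemma same_pattern_shift:
  fixes T :: "('a::euclidean_space, 'l) tile set"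
  assumes "same_pattern T R x (x + w)" "dist x z + R' \<le> R"
  shows "same_pattern T R' z (z + w)"
  unfolding same_pattern_iff
proof (intro allI impI)
  fix S :: "'a set" and l :: 'l
  assume S: "S \<inter> cball 0 R' \<noteq> {}"
  then obtain p where p: "p \<in> S" "norm p \<le> R'" by auto
  have "shift (z - x) S \<inter> cball 0 R \<noteq> {}"
  proof -
    have "norm (z - x + p) \<le> R"
      using assms(2) p(2) norm_triangle_ineq[of "z - x" p] by (simp add: dist_norm norm_minus_commute)
    then have "z - x + p \<in> shift (z - x) S \<inter> cball 0 R" using p(1) by simp
    then show ?thesis by blast
  qed
  then have "(shift x (shift (z - x) S), l) \<in> T \<longleftrightarrow> (shift (x + w) (shift (z - x) S), l) \<in> T"
    using assms(1) unfolding same_pattern_iff by blast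
  then show "(shift z S, l) \<in> T \<longleftrightarrow> (shift (z + w) S, l) \<in> T"
    by (simp add: algebra_simps)
qed

lemma same_pattern_mono: "same_pattern T R x (x + w) \<Longrightarrow> R' \<le> R \<Longrightarrow> same_pattern T R' x (x + w)"
  by (rule same_pattern_shift) auto

lemma same_pattern_mem:
  assumes "same_pattern T R x (x + w)" "S \<inter> cball x R \<noteq> {}"
  shows "(S, l) \<in> T \<longleftrightarrow> (shift w S, l) \<in> T"
proof -
  have "shift (- x) S \<inter> cball 0 R \<noteq> {}"
  proof -
    obtain p where "p \<in> S" "dist x p \<le> R" using assms(2) by auto
    then have "p - x \<in> shift (- x) S \<inter> cball 0 R" by (simp add: dist_norm norm_minus_commute)
    then show ?thesis by blast
  qed
  then have "(shift x (shift (- x) S), l) \<in> T \<longleftrightarrow> (shift (x + w) (shift (- x) S), l) \<in> T"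
    using assms(1) unfolding same_pattern_iff by blast
  then show ?thesis by (simp add: add.commute)
qed

text \<open>
  A reference point that moves along with the set; any translation equivariant choice would do.  The
  lower corner of the bounding box needs no measure theory.
\<close>

definition ref :: "'a::euclidean_space set \<Rightarrow> 'a" where
  "ref S = (\<Sum>b\<in>Basis. (INF x\<in>S. x \<bullet> b) *\<^sub>R b)"

lemma ref_shift:
  fixes S :: "'a::euclidean_space set"
  assumes "bounded S" "S \<noteq> {}"
  shows "ref (shift w S) = w + ref S"
proof (rule euclidean_eqI)
  fix b :: 'a assume b: "b \<in> Basis"
  have bd: "bdd_below ((\<lambda>x. x \<bullet> b) ` S)"
    using assms(1) by (intro bounded_imp_bdd_below bounded_linear_image bounded_linear_inner_left)
  have "(INF x\<in>S. (w + x) \<bullet> b) = w \<bullet> b + (INF x\<in>S. x \<bullet> b)"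
  proof (rule cInf_eq_non_empty)
    fix y assume "y \<in> (\<lambda>x. (w + x) \<bullet> b) ` S"
    then show "w \<bullet> b + (INF x\<in>S. x \<bullet> b) \<le> y"
      using bd by (auto simp: inner_add_left intro: cINF_lower)
  next
    fix y assume y: "\<And>z. z \<in> (\<lambda>x. (w + x) \<bullet> b) ` S \<Longrightarrow> y \<le> z"
    have "y - w \<bullet> b \<le> (INF x\<in>S. x \<bullet> b)"
      using assms(2) y by (intro cINF_greatest) (force simp: inner_add_left)+
    then show "y \<le> w \<bullet> b + (INF x\<in>S. x \<bullet> b)" by simp
  qed (use assms in auto)
  then show "ref (shift w S) \<bullet> b = (w + ref S) \<bullet> b"
    using b by (simp add: ref_def inner_add_left image_image shift_def)
qed

locale flc_tiling =
  fixes T :: "('a::euclidean_space, 'l) tile set" and \<nu> :: "'a set \<Rightarrow> 'a"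
  assumes tiling: "tiling T"
    and polytopal: "polytopal T"
    and face_to_face: "full_face_to_full_face T"
    and flc: "finite_local_complexity T"
    and orientation: "facet_orientation T \<nu>"
begin

text \<open>
  Tiles without their labels: the vertices of the dual graph, whose edges will be the facets.
\<close>

definition V :: "'a set set" where "V = fst ` T"

lemma tile_in_V: "t \<in> T \<Longrightarrow> fst t \<in> V"
  by (simp add: V_def)

lemma V_obtain:
  assumes "s \<in> V"
  obtains t where "t \<in> T" "s = fst t"
  using assms unfolding V_def by blast

lemma tile_geometry:
  assumes "s \<in> V"
  shows tile_polytope: "polytope s" and tile_compact: "compact s" and tile_convex: "convex s"
    and tile_closed: "closed s" and tile_bounded: "bounded s"
    and tile_closure_interior: "closure (interior s) = s"
    and tile_interior: "interior s \<noteq> {}" and tile_nonempty: "s \<noteq> {}"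
proof -
  obtain t where t: "t \<in> T" "s = fst t" using assms by (rule V_obtain)
  show p: "polytope s" using polytopal t unfolding polytopal_def by auto
  then show "compact s" "convex s" "closed s" "bounded s"
    by (auto intro: polytope_imp_compact polytope_imp_convex polytope_imp_closed polytope_imp_bounded)
  have "tile t" using tiling t(1) by (simp add: tiling_def)
  then have "fst t homeomorphic cball (0::'a) 1 \<and> fst t = closure (interior (fst t))"
    unfolding tile_def .
  note tt = conjunct1[OF this] conjunct2[OF this]
  show c: "closure (interior s) = s" using tt(2)[symmetric] unfolding t(2) .
  have "cball (0::'a) 1 \<noteq> {}" by simp
  then show "s \<noteq> {}" using tt(1) t(2) homeomorphic_empty(2) by metis
  then show "interior s \<noteq> {}" using c closure_empty by metis
qed

text \<open>
  Two tiles with the same points would meet in their interior.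
\<close>

lemma fst_inj_on: "inj_on fst T"
proof (rule inj_onI)
  fix s t assume st: "s \<in> T" "t \<in> T" "fst s = fst t"
  show "s = t"
  proof (rule ccontr)
    assume "s \<noteq> t"
    then have "fst s \<inter> fst t \<subseteq> frontier (fst s) \<inter> frontier (fst t)"
      using tiling st(1,2) unfolding tiling_def by blast
    then have "fst s \<subseteq> frontier (fst s)" using st(3) by simp
    moreover have "interior (fst s) \<noteq> {}" using tile_interior st tile_in_V by blast
    ultimately show False
      using interior_subset unfolding frontier_def by blast
  qed
qed

lemma tiles_disjoint:
  assumes "s \<in> V" "u \<in> V" "s \<noteq> u"
  shows "interior s \<inter> u = {}"
proof -
  obtain a b where ab: "a \<in> T" "b \<in> T" "s = fst a" "u = fst b"
    using assms(1,2) V_obtain by metis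
  moreover have "a \<noteq> b" using assms(3) ab by auto
  ultimately have "fst a \<inter> fst b \<subseteq> frontier (fst a) \<inter> frontier (fst b)"
    using tiling unfolding tiling_def by simp
  then have "s \<inter> u \<subseteq> frontier s" using ab by simp
  moreover have "interior s \<subseteq> s" by (rule interior_subset)
  ultimately show ?thesis unfolding frontier_def by blast
qed

lemma tiles_cover: "\<exists>s\<in>V. x \<in> s"
proof -
  have "x \<in> (\<Union>t\<in>T. fst t)" using tiling unfolding tiling_def by simp
  then show ?thesis unfolding V_def by blast
qed

lemma tile_inter_face:
  assumes "s \<in> V" "u \<in> V"
  shows "(s \<inter> u) face_of s" "(s \<inter> u) face_of u"
proof -
  obtain a b where ab: "a \<in> T" "b \<in> T" "s = fst a" "u = fst b"
    using assms V_obtain by metis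
  then show "(s \<inter> u) face_of s" "(s \<inter> u) face_of u"
    using face_to_face unfolding full_face_to_full_face_def by simp_all
qed

lemma tile_shift_iff:
  assumes "same_pattern T R x (x + w)" "S \<inter> cball x R \<noteq> {}"
  shows "shift w S \<in> V \<longleftrightarrow> S \<in> V"
  using same_pattern_mem[OF assms] by (auto simp: V_def image_iff Bex_def)

lemma tile_shift:
  assumes "same_pattern T R x (x + w)" "S \<inter> cball x R \<noteq> {}" "S \<in> V"
  shows "shift w S \<in> V"
  using tile_shift_iff assms by blast

definition norm_tile :: "'a set \<Rightarrow> 'a set" where
  "norm_tile s = shift (- ref s) s"

lemma tile_eq_shift_norm: "s = shift (ref s) (norm_tile s)"
  by (simp add: norm_tile_def)

lemma tile_ref_shift: "s \<in> V \<Longrightarrow> ref (shift w s) = w + ref s"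
  using ref_shift tile_bounded tile_nonempty by blast

lemma norm_tile_shift: "s \<in> V \<Longrightarrow> norm_tile (shift w s) = norm_tile s"
  by (simp add: norm_tile_def tile_ref_shift)

lemma tiles_meeting_interior:
  assumes "t \<in> T" "x \<in> interior (fst t)"
  shows "tiles_meeting T {x} = {t}"
proof -
  have "u = t" if "u \<in> T" "x \<in> fst u" for u
  proof (rule ccontr)
    assume "u \<noteq> t"
    then have "fst u \<noteq> fst t" using fst_inj_on that assms by (auto dest: inj_onD)
    then show False using tiles_disjoint[of "fst t" "fst u"] assms that tile_in_V by blast
  qed
  then show ?thesis
    using assms interior_subset[of "fst t"] unfolding tiles_meeting_def by blast
qed

text \<open>
  At an interior point of a tile the pattern of a single point consists of this tile only, so finite
  local complexity for one-point sets already says that there are finitely many tiles up to translation.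
  This gives uniform bounds for the size of tiles, and from them local finiteness.
\<close>

lemma finite_norm_tiles: "finite (norm_tile ` V)"
proof -
  obtain \<P> where fin: "finite \<P>"
    and P: "\<And>x. \<exists>P\<in>\<P>. \<exists>v. tiles_meeting T ((+) (- x) ` {0}) = translate v P"
    using flc unfolding finite_local_complexity_def by (metis compact_sing)
  have "norm_tile ` V \<subseteq> (\<lambda>P. norm_tile (fst (the_elem P))) ` \<P>"
  proof (rule image_subsetI)
    fix S assume "S \<in> V"
    then obtain l where t: "(S, l) \<in> T" by (force elim: V_obtain)
    then obtain x where x: "x \<in> interior S" using tile_interior[OF \<open>S \<in> V\<close>] by blast
    obtain P v where Pv: "P \<in> \<P>" "tiles_meeting T {x} = translate v P"
      using P[of "- x"] by auto
    then have "translate v P = {(S, l)}"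
      using tiles_meeting_interior[of "(S, l)" x] t x by auto
    then have sing: "(\<lambda>(S, l). (shift v S, l)) ` P = {(S, l)}"
      unfolding translate_def shift_def .
    have "inj_on (\<lambda>(S, l). (shift v S, l)) P"
      by (auto simp: inj_on_def)
    then have "card P = 1" using sing card_image by fastforce
    then obtain p where "P = {p}" by (auto simp: card_1_singleton_iff)
    moreover obtain S' l' where "p = (S', l')" by fastforce
    ultimately have P_eq: "P = {(S', l')}" and "S = shift v S'" using sing by auto
    then have "S' = shift (- v) S" and "norm_tile S' = norm_tile S"
      using norm_tile_shift[of S "- v"] \<open>S \<in> V\<close> by auto
    then have "norm_tile S = norm_tile (fst (the_elem P))"
      by (simp add: P_eq)
    then show "norm_tile S \<in> (\<lambda>P. norm_tile (fst (the_elem P))) ` \<P>"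
      using Pv(1) by auto
  qed
  then show ?thesis using fin finite_surj by blast
qed

lemma diameter_exists:
  "\<exists>D>0. \<forall>s\<in>V. \<forall>x\<in>s. (\<forall>y\<in>s. dist x y \<le> D) \<and> dist x (ref s) \<le> D"
proof -
  have "bounded (\<Union>(norm_tile ` V))"
    using finite_norm_tiles tile_bounded
    by (intro bounded_Union) (auto simp: norm_tile_def intro: bounded_shift)
  then obtain B where B: "B > 0" "\<And>x. x \<in> \<Union>(norm_tile ` V) \<Longrightarrow> norm x \<le> B"
    by (auto simp: bounded_pos)
  have n: "dist x (ref s) \<le> B" if "s \<in> V" "x \<in> s" for s x
  proof -
    have "x - ref s \<in> norm_tile s" using that by (simp add: norm_tile_def)
    then show ?thesis using B(2)[of "x - ref s"] that by (auto simp: dist_norm)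
  qed
  have "dist x y \<le> 2 * B" if "s \<in> V" "x \<in> s" "y \<in> s" for s x y
    using n[of s x] n[of s y] that dist_triangle2[of x y "ref s"] by linarith
  then show ?thesis using B n by (intro exI[of _ "2 * B"]) fastforce
qed

text \<open>
  Chosen once and for all, so that radii in later constructions are closed expressions.
\<close>

definition D :: real where
  "D = (SOME D. D > 0 \<and> (\<forall>s\<in>V. \<forall>x\<in>s. (\<forall>y\<in>s. dist x y \<le> D) \<and> dist x (ref s) \<le> D))"

lemma D_pos: "D > 0"
  and D_dist: "s \<in> V \<Longrightarrow> x \<in> s \<Longrightarrow> y \<in> s \<Longrightarrow> dist x y \<le> D"
  and D_ref: "s \<in> V \<Longrightarrow> x \<in> s \<Longrightarrow> dist x (ref s) \<le> D"
  using someI_ex[OF diameter_exists[unfolded Bex_def]] someI_ex[OF diameter_exists]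
  unfolding D_def by blast+

lemma tile_measure_pos: "s \<in> V \<Longrightarrow> measure lebesgue s > 0"
  by (metis negligible_iff_measure0 lmeasurable_compact tile_compact tile_interior 
      interior_subset negligible_subset open_not_negligible open_interior zero_less_measure_iff)

lemma tile_measure_lower: "\<exists>m>0. \<forall>s\<in>V. m \<le> measure lebesgue s"
proof -
  have eq: "measure lebesgue (norm_tile s) = measure lebesgue s" for s
    by (simp add: norm_tile_def measure_shift)
  let ?M = "insert 1 (measure lebesgue ` norm_tile ` V)"
  have "finite ?M" using finite_norm_tiles by auto
  moreover have "x > 0" if "x \<in> ?M" for x using that tile_measure_pos eq by force
  moreover have "measure lebesgue s \<in> ?M" if "s \<in> V" for s
    unfolding eq[of s, symmetric] using that by blast
  ultimately have "Min ?M > 0" "\<forall>s\<in>V. Min ?M \<le> measure lebesgue s"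
    by (simp_all add: Min_gr_iff del: Min_insert)
  then show ?thesis by blast
qed

definition near :: "real \<Rightarrow> 'a \<Rightarrow> 'a set set" where
  "near r x = {s \<in> V. s \<inter> cball x r \<noteq> {}}"

text \<open>
  Volume packing: tiles near \<open>x\<close> overlap in null sets, have volume at least \<open>m\<close>, and lie in a ball.
\<close>

lemma card_near_subset:
  "\<exists>Q. \<forall>x F. finite F \<and> F \<subseteq> near r x \<longrightarrow> card F \<le> (Q::nat)"
proof -
  obtain m where m: "m > 0" "\<And>s. s \<in> V \<Longrightarrow> m \<le> measure lebesgue s"
    using tile_measure_lower by blast
  define B where "B = measure lebesgue (cball (0::'a) (r + D))"
  have "card F \<le> nat \<lceil>B / m\<rceil>" if F: "finite F" "F \<subseteq> near r x" for x F
  proof -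
    have meas: "s \<in> lmeasurable" if "s \<in> F" for s
      using that F tile_compact lmeasurable_compact by (auto simp: near_def)
    have neg: "negligible (s \<inter> u)" if "s \<in> F" "u \<in> F" "s \<noteq> u" for s u
    proof -
      have "s \<in> V" "u \<in> V" using that F by (auto simp: near_def)
      then have "s \<inter> u \<subseteq> frontier s"
        using tiles_disjoint[of s u] that closure_subset[of s] by (auto simp: frontier_def)
      then show ?thesis
        using negligible_convex_frontier tile_convex \<open>s \<in> V\<close> negligible_subset by metis
    qed
    have "m * card F \<le> (\<Sum>s\<in>F. measure lebesgue s)"
      using sum_bounded_below[of F m "measure lebesgue"] m(2) F by (auto simp: near_def mult.commute subset_iff)
    also have "\<dots> = measure lebesgue (\<Union>F)"
      using measure_negligible_finite_Union[of F] F meas neg 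
      by (auto simp: pairwise_def)
    also have "\<dots> \<le> measure lebesgue (cball x (r + D))"
    proof (rule measure_mono_fmeasurable)
      show "\<Union>F \<subseteq> cball x (r + D)"
      proof clarify
        fix s y assume s: "s \<in> F" "y \<in> s"
        then have "s \<in> near r x" using F by auto
        then obtain z where z: "z \<in> s" "dist x z \<le> r" "s \<in> V" by (auto simp: near_def)
        then show "y \<in> cball x (r + D)"
          using D_dist[of s z y] s dist_triangle[of x y z] by (auto simp: dist_commute)
      qed
    qed (use F meas in \<open>auto intro!: fmeasurableD fmeasurable.finite_Union\<close>)
    also have "\<dots> = B"
      using measure_translation[of x "cball 0 (r + D)"] by (simp add: B_def cball_translation[symmetric])
    finally have "card F \<le> B / m" using m by (simp add: field_simps)
    then show ?thesis by linarith
  qed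
  then show ?thesis by blast
qed

definition Q :: "real \<Rightarrow> nat" where
  "Q r = (SOME Q. \<forall>x F. finite F \<and> F \<subseteq> near r x \<longrightarrow> card F \<le> Q)"

lemma finite_near [simp]: "finite (near r x)"
  using card_near_subset[of r] by (metis finite_if_finite_subsets_card_bdd)

lemma card_near: "card (near r x) \<le> Q r"
proof -
  have "\<forall>x F. finite F \<and> F \<subseteq> near r x \<longrightarrow> card F \<le> Q r"
    unfolding Q_def by (rule someI_ex[OF card_near_subset])
  then show ?thesis using finite_near by blast
qed

lemma near_shift:
  assumes "same_pattern T R x (x + w)" "dist x z + r \<le> R"
  shows "near r (z + w) = shift w ` near r z"
proof -
  have sub: "shift w ` near r z \<subseteq> near r (z + w)"
    if "same_pattern T R x (x + w)" "dist x z + r \<le> R" for x w z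
  proof (rule image_subsetI)
    fix s assume s: "s \<in> near r z"
    then obtain p where p: "p \<in> s" "dist z p \<le> r" "s \<in> V" by (auto simp: near_def)
    have "dist x p \<le> R" using that(2) p dist_triangle[of x p z] by linarith
    then have "s \<inter> cball x R \<noteq> {}" using p(1) by auto
    then have "shift w s \<in> V" using tile_shift[OF that(1)] p by blast
    moreover have "dist (z + w) (w + p) \<le> r" using p by (simp add: dist_norm algebra_simps)
    moreover have "w + p \<in> shift w s" using p(1) by simp
    ultimately show "shift w s \<in> near r (z + w)" unfolding near_def by fastforce
  qed
  have "shift (- w) ` near r (z + w) \<subseteq> near r (z + w + - w)"
    using assms by (intro sub[of "x + w"] same_pattern_back) (auto simp: dist_norm)
  then have "shift w ` shift (- w) ` near r (z + w) \<subseteq> shift w ` near r z" by auto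
  then have "near r (z + w) \<subseteq> shift w ` near r z" by (simp add: image_image)
  then show ?thesis using sub[OF assms] by blast
qed

text \<open>
  Finite local complexity compares patterns up to translation, whereas equivariance asks for agreement
  of patterns centred at given points.  If a translation by \<open>w\<close> carries the pattern of a ball about \<open>x0\<close>
  to that of the ball about \<open>x\<close>, then \<open>x0 + w\<close> is within \<open>D\<close> of \<open>x\<close>, since the translated ball is covered by
  tiles that meet the other ball.  So finitely many sample points represent all points up to an error \<open>D\<close>.
  Equivariant quantities are bounded for this reason.
\<close>

lemma finite_pattern_types:
  assumes "R \<ge> 0"
  shows "\<exists>X. finite X \<and> (\<forall>x. \<exists>x0\<in>X. \<exists>w. same_pattern T R x0 (x0 + w) \<and> dist (x0 + w) x \<le> D)"
proof -
  obtain \<P> where fin: "finite \<P>"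
    and P: "\<And>x. \<exists>P\<in>\<P>. \<exists>v. tiles_meeting T ((+) (- x) ` cball 0 (R + D)) = translate v P"
    using flc unfolding finite_local_complexity_def by (metis compact_cball)
  have P': "\<exists>P\<in>\<P>. \<exists>v. tiles_meeting T (cball x (R + D)) = translate v P" for x
    using P[of "- x"] cball_translation[of x 0] by simp
  define has where "has P x = (\<exists>v. tiles_meeting T (cball x (R + D)) = translate v P)" for P x
  define X where "X = (\<lambda>P. SOME x. has P x) ` \<P>"
  have "\<exists>x0\<in>X. \<exists>w. same_pattern T R x0 (x0 + w) \<and> dist (x0 + w) x \<le> D" for x
  proof -
    obtain P v where Pv: "P \<in> \<P>" "tiles_meeting T (cball x (R + D)) = translate v P" using P' by blast
    define x0 where "x0 = (SOME x. has P x)"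
    have "has P x0" unfolding x0_def by (rule someI[of _ x]) (use Pv in \<open>auto simp: has_def\<close>)
    then obtain v0 where v0: "tiles_meeting T (cball x0 (R + D)) = translate v0 P" by (auto simp: has_def)
    define w where "w = v - v0"
    have tr: "translate v P = translate w (translate v0 P)"
      by (auto simp: translate_def w_def image_image split_beta add.assoc)
    have fwd: "(shift w S, l) \<in> tiles_meeting T (cball x (R + D))"
      if "(S, l) \<in> tiles_meeting T (cball x0 (R + D))" for S l
      unfolding Pv(2) tr v0[symmetric] using that unfolding translate_def shift_def by (force intro: rev_image_eqI)
    have bwd: "(shift (- w) S, l) \<in> tiles_meeting T (cball x0 (R + D))"
      if Sl: "(S, l) \<in> tiles_meeting T (cball x (R + D))" for S l
    proof -
      obtain U where "(U, l) \<in> tiles_meeting T (cball x0 (R + D))" "S = shift w U"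
        using Sl unfolding Pv(2) tr v0[symmetric] by (auto simp: translate_def shift_def)
      then show ?thesis by simp
    qed
    have "dist (x0 + w) x \<le> D"
    proof (cases "x0 + w = x")
      case True then show ?thesis using D_pos by simp
    next
      case False
      define e where "e = (x0 + w - x) /\<^sub>R norm (x0 + w - x)"
      have ne: "norm e = 1" using False by (simp add: e_def)
      \<comment> \<open>the point of the first ball lying farthest in the direction of the displacement\<close>
      define p where "p = x0 + (R + D) *\<^sub>R e"
      obtain t where t: "t \<in> T" "p \<in> fst t" using tiles_cover[of p] V_obtain by metis
      obtain S l where Sl: "t = (S, l)" by fastforce
      have "p \<in> cball x0 (R + D)" using ne D_pos assms by (simp add: p_def dist_norm)
      then have "(S, l) \<in> tiles_meeting T (cball x0 (R + D))"
        using t Sl unfolding tiles_meeting_def by auto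
      then have "(shift w S, l) \<in> tiles_meeting T (cball x (R + D))" by (rule fwd)
      then obtain q where q: "q \<in> shift w S" "dist x q \<le> R + D" "shift w S \<in> V"
        unfolding tiles_meeting_def using tile_in_V[of "(shift w S, l)"] by auto
      have "w + p \<in> shift w S" using t Sl by auto
      then have "dist q (w + p) \<le> D" using D_dist q by blast
      then have "dist x (w + p) \<le> R + 2 * D" using q(2) dist_triangle[of x "w + p" q] by linarith
      moreover have "w + p - x = (norm (x0 + w - x) + (R + D)) *\<^sub>R e"
        using False by (simp add: p_def e_def algebra_simps)
      then have "dist x (w + p) = norm (x0 + w - x) + (R + D)"
        using ne assms D_pos by (simp add: dist_norm norm_minus_commute[of x])
      ultimately show ?thesis by (simp add: dist_norm)
    qed
    moreover have "same_pattern T R x0 (x0 + w)"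
      unfolding same_pattern_iff
    proof (intro allI impI iffI)
      fix S :: "'a set" and l assume S: "S \<inter> cball 0 R \<noteq> {}"
      then obtain p where p: "p \<in> S" "norm p \<le> R" by auto
      {
        assume a: "(shift x0 S, l) \<in> T"
        have "x0 + p \<in> cball x0 (R + D)" using p D_pos by (simp add: dist_norm)
        moreover have "x0 + p \<in> shift x0 S" using p by simp
        ultimately have "shift x0 S \<inter> cball x0 (R + D) \<noteq> {}" by blast
        then have "(shift x0 S, l) \<in> tiles_meeting T (cball x0 (R + D))"
          using a by (simp add: tiles_meeting_def)
        from fwd[OF this] show "(shift (x0 + w) S, l) \<in> T" by (simp add: tiles_meeting_def add.commute)
      next
        assume a: "(shift (x0 + w) S, l) \<in> T"
        have "dist x (x0 + w + p) \<le> dist (x0 + w) x + norm p"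
          using dist_triangle[of x "x0 + w + p" "x0 + w"] by (simp add: dist_norm norm_minus_commute)
        then have "x0 + w + p \<in> cball x (R + D)" using p \<open>dist (x0 + w) x \<le> D\<close> by simp
        moreover have "x0 + w + p \<in> shift (x0 + w) S" using p by simp
        ultimately have "shift (x0 + w) S \<inter> cball x (R + D) \<noteq> {}" by blast
        then have "(shift (x0 + w) S, l) \<in> tiles_meeting T (cball x (R + D))"
          using a by (simp add: tiles_meeting_def)
        from bwd[OF this] show "(shift x0 S, l) \<in> T" by (simp add: tiles_meeting_def add.commute)
      }
    qed
    moreover have "x0 \<in> X" using Pv(1) by (simp add: X_def x0_def)
    ultimately show ?thesis by blast
  qed
  then show ?thesis using fin unfolding X_def by blast
qed

end

section \<open>The dual graph of a tiling\<close>

context flc_tiling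
begin

lemma tile_aff_dim: "s \<in> V \<Longrightarrow> aff_dim s = int (DIM('a))"
  using aff_dim_nonempty_interior tile_interior by blast

text \<open>
  A proper face of a polytope has smaller dimension.
\<close>

lemma cells_top: "cells T (DIM('a)) = V"
proof (intro equalityI subsetI)
  fix c assume "c \<in> cells T (DIM('a))"
  then obtain t where t: "t \<in> T" "c face_of fst t" "aff_dim c = int (DIM('a))"
    by (auto simp: cells_def)
  have v: "fst t \<in> V" using t(1) by (rule tile_in_V)
  have "c = fst t"
    using face_of_aff_dim_lt[OF tile_convex[OF v] t(2)] t(3) tile_aff_dim[OF v] by auto
  then show "c \<in> V" using v by simp
next
  fix c assume c: "c \<in> V"
  then obtain t where "t \<in> T" "c = fst t" by (rule V_obtain)
  then show "c \<in> cells T (DIM('a))"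
    using tile_aff_dim[OF c] tile_convex[OF c] face_of_refl by (auto simp: cells_def)
qed

text \<open>
  Cells of codimension one: the edges of the dual graph.
\<close>

definition E :: "'a set set" where "E = cells T (DIM('a) - 1)"

lemma int_dim_minus: "int (DIM('a) - 1) = int (DIM('a)) - 1"
  using DIM_positive[where 'a='a] by linarith

lemma facet_in_E:
  assumes "s \<in> V" "d facet_of s"
  shows "d \<in> E"
proof -
  obtain t where "t \<in> T" "s = fst t" using assms(1) by (rule V_obtain)
  then show ?thesis
    using assms tile_aff_dim[OF assms(1)] int_dim_minus by (auto simp: E_def cells_def facet_of_def)
qed

lemma E_facet:
  assumes "d \<in> E"
  obtains s where "s \<in> V" "d facet_of s"
proof -
  obtain t where t: "t \<in> T" "d face_of fst t" "aff_dim d = int (DIM('a) - 1)"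
    using assms by (auto simp: E_def cells_def)
  have v: "fst t \<in> V" using t(1) by (rule tile_in_V)
  have "d \<noteq> {}" using t(3) aff_dim_empty[of d] by auto
  then have "d facet_of fst t"
    using t tile_aff_dim[OF v] int_dim_minus by (auto simp: facet_of_def)
  with v show ?thesis using that by blast
qed

lemma facet_dim: "d \<in> E \<Longrightarrow> aff_dim d = int (DIM('a)) - 1"
  by (simp add: E_def cells_def int_dim_minus)

lemma facet_nonempty: "d \<in> E \<Longrightarrow> d \<noteq> {}"
  by (meson E_facet facet_of_def)

lemma facet_convex: "d \<in> E \<Longrightarrow> convex d"
  by (meson E_facet facet_of_imp_face_of face_of_imp_convex tile_convex)

lemma facet_compact: "d \<in> E \<Longrightarrow> compact d"
  by (meson E_facet facet_of_imp_face_of face_of_imp_compact tile_convex tile_compact)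

lemma facet_subset: "d facet_of s \<Longrightarrow> d \<subseteq> s"
  by (simp add: facet_of_imp_subset)

lemma finite_facets: "s \<in> V \<Longrightarrow> finite {d. d facet_of s}"
  using finite_polytope_facets tile_polytope by blast

lemma orientation_facet:
  assumes "d \<in> E"
  shows "norm (\<nu> d) = 1 \<and> (\<forall>p\<in>d. \<forall>q\<in>d. \<nu> d \<bullet> (p - q) = 0) \<and>
    (\<forall>v. shift v d \<in> E \<longrightarrow> \<nu> (shift v d) = \<nu> d)"
  by (rule bspec[OF orientation[unfolded facet_orientation_def, folded E_def shift_def] assms])

lemma normal_unit: "d \<in> E \<Longrightarrow> norm (\<nu> d) = 1"
  using orientation_facet by (rule conjunct1)

lemma normal_const:
  assumes "d \<in> E" "p \<in> d" "q \<in> d"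
  shows "\<nu> d \<bullet> p = \<nu> d \<bullet> q"
proof -
  have "\<forall>p\<in>d. \<forall>q\<in>d. \<nu> d \<bullet> (p - q) = 0"
    using orientation_facet[OF assms(1)] by (elim conjE)
  then have "\<nu> d \<bullet> (p - q) = 0" using assms(2,3) by blast
  then show ?thesis by (simp add: inner_diff_right)
qed

lemma normal_shift:
  assumes "d \<in> E" "shift w d \<in> E"
  shows "\<nu> (shift w d) = \<nu> d"
proof -
  have "\<forall>v. shift v d \<in> E \<longrightarrow> \<nu> (shift v d) = \<nu> d"
    using orientation_facet[OF assms(1)] by (elim conjE)
  then have "shift w d \<in> E \<longrightarrow> \<nu> (shift w d) = \<nu> d" by (rule spec)
  then show ?thesis using assms(2) by (rule mp)
qed

text \<open>
  The hyperplane on the right contains the facet and has the same dimension as it.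
\<close>

lemma facet_affine_hull:
  assumes "d \<in> E" "p \<in> d"
  shows "affine hull d = {x. \<nu> d \<bullet> x = \<nu> d \<bullet> p}"
proof (rule affine_dim_equal)
  have n0: "\<nu> d \<noteq> 0" using normal_unit[OF assms(1)] by auto
  show "affine hull d \<subseteq> {x. \<nu> d \<bullet> x = \<nu> d \<bullet> p}"
    using normal_const[OF assms(1) _ assms(2)] by (intro hull_minimal) (blast, rule affine_hyperplane)
  show "aff_dim (affine hull d) = aff_dim {x. \<nu> d \<bullet> x = \<nu> d \<bullet> p}"
    using n0 facet_dim[OF assms(1)] by (simp add: aff_dim_hyperplane)
qed (use facet_nonempty[OF assms(1)] in \<open>auto simp: affine_hyperplane\<close>)

text \<open>
  A facet of a polytope is cut out by a supporting hyperplane; its normal must be parallel to the chosen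
  unit normal, since both are orthogonal to the same hyperplane.  The incidence number is the sign that
  turns the chosen normal into the outer one.
\<close>

lemma facet_side:
  assumes s: "s \<in> V" and d: "d facet_of s" and p: "p \<in> d"
  shows "incidence \<nu> s d = 1 \<or> incidence \<nu> s d = - 1"
    and "x \<in> s \<Longrightarrow> incidence \<nu> s d * (\<nu> d \<bullet> x) \<le> incidence \<nu> s d * (\<nu> d \<bullet> p)"
    and "d = {x \<in> s. \<nu> d \<bullet> x = \<nu> d \<bullet> p}"
proof -
  have dE: "d \<in> E" using facet_in_E s d by blast
  obtain a b where ab: "a \<noteq> 0" "s \<subseteq> {x. a \<bullet> x \<le> b}" "d = s \<inter> {x. a \<bullet> x = b}"
    using facet_of_polyhedron[OF polytope_imp_polyhedron[OF tile_polytope[OF s]] d] by metis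
  define k where "k = a \<bullet> \<nu> d"
  define v where "v = a - k *\<^sub>R \<nu> d"
  have nn: "\<nu> d \<bullet> \<nu> d = 1" using normal_unit[OF dE] by (simp add: norm_eq_1)
  have vn: "\<nu> d \<bullet> v = 0" using nn by (simp add: v_def k_def inner_diff_right inner_commute)
  have "affine hull d \<subseteq> {x. a \<bullet> x = b}"
    using ab(3) by (intro hull_minimal) (auto simp: affine_hyperplane)
  moreover have "p + v \<in> affine hull d"
    unfolding facet_affine_hull[OF dE p] using vn by (simp add: inner_add_right)
  ultimately have "a \<bullet> (p + v) = b" "a \<bullet> p = b" using p ab(3) by auto
  then have "a \<bullet> v = 0" by (simp add: inner_add_right)
  moreover have "v \<bullet> v = a \<bullet> v - k * (\<nu> d \<bullet> v)"
    by (simp add: v_def inner_diff_left)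
  ultimately have "v \<bullet> v = 0" using vn by simp
  then have a_eq: "a = k *\<^sub>R \<nu> d" by (simp add: v_def)
  then have k0: "k \<noteq> 0" using ab(1) by auto
  have b_eq: "b = k * (\<nu> d \<bullet> p)" using \<open>a \<bullet> p = b\<close> a_eq by simp
  show d_eq: "d = {x \<in> s. \<nu> d \<bullet> x = \<nu> d \<bullet> p}"
    using ab(3) k0 a_eq b_eq by auto
  show i: "incidence \<nu> s d = 1 \<or> incidence \<nu> s d = - 1" by (simp add: incidence_def)
  have side: "k * (\<nu> d \<bullet> x) \<le> k * (\<nu> d \<bullet> p)" if "x \<in> s" for x
    using ab(2) that a_eq b_eq by auto
  show "incidence \<nu> s d * (\<nu> d \<bullet> x) \<le> incidence \<nu> s d * (\<nu> d \<bullet> p)" if x: "x \<in> s" for x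
  proof (cases "k > 0")
    case True
    then have "\<forall>x\<in>s. \<nu> d \<bullet> x \<le> \<nu> d \<bullet> p" using side by auto
    then have "incidence \<nu> s d = 1"
      using normal_const[OF dE p] by (auto simp: incidence_def)
    then show ?thesis using True side[OF x] by simp
  next
    case False
    then have "k < 0" using k0 by simp
    then have *: "\<forall>x\<in>s. \<nu> d \<bullet> x \<ge> \<nu> d \<bullet> p" using side by auto
    show ?thesis
    proof (cases "incidence \<nu> s d = 1")
      case True
      then have "\<forall>x\<in>s. \<forall>q\<in>d. \<nu> d \<bullet> x \<le> \<nu> d \<bullet> q" by (simp add: incidence_def split: if_splits)
      then show ?thesis using x p True by auto
    next
      case False
      then show ?thesis using i * x by auto
    qed
  qed
qed

text \<open>
  Join \<open>p\<close>'s neighbours in the facet to a point \<open>q\<close> of the tile off the facet.  The sideways part \<open>\<tau>\<close> of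
  \<open>q - p\<close> is compensated by starting at a slightly displaced point of the facet, which is possible because
  \<open>p\<close> is in the relative interior.
\<close>

lemma facet_inward:
  assumes s: "s \<in> V" and d: "d facet_of s" and p: "p \<in> rel_interior d"
  shows "\<exists>e>0. \<forall>t. 0 < t \<and> t \<le> e \<longrightarrow> p - (t * incidence \<nu> s d) *\<^sub>R \<nu> d \<in> s"
proof -
  let ?i = "incidence \<nu> s d"
  have dE: "d \<in> E" using facet_in_E s d by blast
  have pd: "p \<in> d" using p rel_interior_subset by blast
  note side = facet_side[OF s d pd]
  have ii: "?i * ?i = 1" using side(1) by auto
  have nn: "\<nu> d \<bullet> \<nu> d = 1" using normal_unit[OF dE] by (simp add: norm_eq_1)
  have "d \<noteq> s" using d by (auto simp: facet_of_irrefl)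
  then obtain q where q: "q \<in> s" "q \<notin> d" using facet_subset[OF d] by blast
  define h where "h = ?i * (\<nu> d \<bullet> p) - ?i * (\<nu> d \<bullet> q)"
  have "\<nu> d \<bullet> q \<noteq> \<nu> d \<bullet> p" using q side(3) by auto
  then have "h \<noteq> 0" using side(1) by (auto simp: h_def)
  moreover have "h \<ge> 0" using side(2)[OF q(1)] by (simp add: h_def)
  ultimately have h: "h > 0" by simp
  define \<tau> where "\<tau> = q - p + (h * ?i) *\<^sub>R \<nu> d"
  have "\<nu> d \<bullet> \<tau> = \<nu> d \<bullet> q - \<nu> d \<bullet> p + h * ?i"
    by (simp add: \<tau>_def inner_add_right inner_diff_right nn)
  also have "h * ?i = (?i * ?i) * (\<nu> d \<bullet> p - \<nu> d \<bullet> q)" by (simp add: h_def algebra_simps)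
  finally have \<tau>: "\<nu> d \<bullet> \<tau> = 0" using ii by simp
  obtain e where e: "e > 0" "cball p e \<inter> affine hull d \<subseteq> d"
    using p by (auto simp: mem_rel_interior_cball)
  \<comment> \<open>so small that the displacement by \<open>l / (1 - l)\<close> times \<open>\<tau>\<close> has length at most \<open>e\<close>\<close>
  define l0 where "l0 = min (1/2) (e / (2 * (norm \<tau> + 1)))"
  have l0: "l0 > 0" using e by (auto simp: l0_def intro!: divide_pos_pos add_nonneg_pos)
  have "p - (t * ?i) *\<^sub>R \<nu> d \<in> s" if t: "0 < t" "t \<le> l0 * h" for t
  proof -
    define l where "l = t / h"
    have l: "0 < l" "l \<le> l0" using t h by (auto simp: l_def field_simps)
    then have l2: "l \<le> 1/2" by (simp add: l0_def)
    define r where "r = p - (l / (1 - l)) *\<^sub>R \<tau>"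
    have "norm ((l / (1 - l)) *\<^sub>R \<tau>) \<le> e"
    proof -
      have "l / (1 - l) \<le> 2 * l" using l l2 by (simp add: field_simps)
      then have "norm ((l / (1 - l)) *\<^sub>R \<tau>) \<le> 2 * l * norm \<tau>"
        using mult_right_mono[of "l / (1 - l)" "2 * l" "norm \<tau>"] l l2 by simp
      also have "\<dots> \<le> 2 * (e / (2 * (norm \<tau> + 1))) * norm \<tau>"
        using l(2) by (intro mult_right_mono mult_left_mono) (auto simp: l0_def)
      also have "\<dots> = e * (norm \<tau> / (norm \<tau> + 1))"
        using norm_ge_zero[of \<tau>] by (simp add: divide_simps add_nonneg_eq_0_iff)
      also have "\<dots> \<le> e * 1"
        using e(1) by (intro mult_left_mono) (auto simp: divide_le_eq_1 add_nonneg_pos)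
      finally show ?thesis by simp
    qed
    then have "r \<in> cball p e" by (simp add: r_def dist_norm)
    moreover have "r \<in> affine hull d"
      unfolding facet_affine_hull[OF dE pd] by (simp add: r_def inner_diff_right \<tau>)
    ultimately have "r \<in> s" using e(2) facet_subset[OF d] by blast
    then have "l *\<^sub>R q + (1 - l) *\<^sub>R r \<in> s"
      using q(1) l l2 tile_convex[OF s] by (auto simp: convex_alt add.commute)
    moreover have "l *\<^sub>R q + (1 - l) *\<^sub>R r = p - (t * ?i) *\<^sub>R \<nu> d"
    proof -
      have "(1 - l) *\<^sub>R r = (1 - l) *\<^sub>R p - l *\<^sub>R \<tau>"
        using l2 by (simp add: r_def scaleR_diff_right)
      moreover have "t = l * h" using h by (simp add: l_def)
      ultimately show ?thesis by (simp add: \<tau>_def algebra_simps)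
    qed
    ultimately show ?thesis by simp
  qed
  then show ?thesis using l0 h by (intro exI[of _ "l0 * h"]) auto
qed

text \<open>
  The intersection of two tiles is a proper face that contains \<open>d\<close>, so it has the dimension of \<open>d\<close> and
  coincides with it.
\<close>

lemma shared_facet:
  assumes s: "s \<in> V" and u: "u \<in> V" "s \<noteq> u" and d: "d facet_of s" "d \<subseteq> u"
  shows "s \<inter> u = d" "d facet_of u"
proof -
  let ?F = "s \<inter> u"
  have F: "?F face_of s" "?F face_of u" using tile_inter_face s u by auto
  have "?F \<noteq> s"
    using tiles_disjoint[OF s u] tile_interior[OF s] interior_subset[of s] by blast
  then have lt: "aff_dim ?F < aff_dim s" using face_of_aff_dim_lt F(1) tile_convex s by blast
  have dF: "d \<subseteq> ?F" using d facet_subset by blast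
  then have "d face_of ?F"
    using d(1) face_of_subset[of d s ?F] by (auto simp: facet_of_def)
  moreover have "convex ?F" using tile_convex s u by (simp add: convex_Int)
  moreover have "aff_dim ?F \<le> aff_dim d" using lt d(1) by (simp add: facet_of_def)
  ultimately show eq: "?F = d" using face_of_aff_dim_lt by force
  have "d \<noteq> {}" "aff_dim d = aff_dim u - 1"
    using d(1) tile_aff_dim s u by (auto simp: facet_of_def)
  then show "d facet_of u" using F(2) eq by (auto simp: facet_of_def)
qed

lemma star_radius: "\<exists>e>0. \<forall>s\<in>V. s \<inter> ball p e \<noteq> {} \<longrightarrow> p \<in> s"
proof -
  define N where "N = {s \<in> near 1 p. p \<notin> s}"
  have "finite N" by (simp add: N_def)
  then have "closed (\<Union>N)" using tile_closed by (intro closed_Union) (auto simp: N_def near_def)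
  moreover have "p \<notin> \<Union>N" by (auto simp: N_def)
  ultimately obtain e where e: "e > 0" "ball p e \<subseteq> - \<Union>N"
    by (metis Compl_iff open_Compl open_contains_ball)
  have "p \<in> s" if s: "s \<in> V" "s \<inter> ball p (min e 1) \<noteq> {}" for s
  proof (rule ccontr)
    assume "p \<notin> s"
    moreover have "s \<in> near 1 p" using s by (force simp: near_def)
    ultimately have "s \<in> N" by (simp add: N_def)
    then show False using e(2) s(2) by auto
  qed
  then show ?thesis using e(1) by (intro exI[of _ "min e 1"]) auto
qed

text \<open>
  Cross the facet at a relative interior point and take the tile found on the other side.
\<close>

lemma other_tile:
  assumes s: "s \<in> V" and d: "d facet_of s"
  shows "\<exists>u\<in>V. u \<noteq> s \<and> d facet_of u"
proof -
  have dE: "d \<in> E" using facet_in_E s d by blast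
  obtain p where p: "p \<in> rel_interior d"
    using facet_nonempty[OF dE] facet_convex[OF dE] rel_interior_eq_empty by blast
  have pd: "p \<in> d" using p rel_interior_subset by blast
  obtain e where e: "e > 0" "\<And>u. u \<in> V \<Longrightarrow> u \<inter> ball p e \<noteq> {} \<Longrightarrow> p \<in> u"
    using star_radius by metis
  note side = facet_side[OF s d pd]
  define y where "y = p + (e/2 * incidence \<nu> s d) *\<^sub>R \<nu> d"
  have nn: "\<nu> d \<bullet> \<nu> d = 1" using normal_unit[OF dE] by (simp add: norm_eq_1)
  have "incidence \<nu> s d * (\<nu> d \<bullet> y) > incidence \<nu> s d * (\<nu> d \<bullet> p)"
    using side(1) e(1) by (auto simp: y_def inner_add_right nn)
  then have ys: "y \<notin> s" using side(2) by force
  have yb: "y \<in> ball p e"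
    using e(1) side(1) normal_unit[OF dE] by (auto simp: y_def dist_norm)
  obtain u where u: "u \<in> V" "y \<in> u" using tiles_cover by blast
  have us: "u \<noteq> s" using ys u by auto
  have "p \<in> u" using e(2)[of u] u yb by blast
  then have "(s \<inter> u) \<inter> rel_interior d \<noteq> {}" using p pd facet_subset[OF d] by blast
  then have "d \<subseteq> s \<inter> u"
    using subset_of_face_of[OF tile_inter_face(1)[OF s u(1)] facet_subset[OF d]] by blast
  then show ?thesis using shared_facet[OF s u(1) us[symmetric] d] u us by blast
qed

text \<open>
  Two tiles on the same side of a common facet would share the points just inside of it.
\<close>

lemma same_side_unique:
  assumes s: "s \<in> V" "d facet_of s" and u: "u \<in> V" "d facet_of u"
    and i: "incidence \<nu> s d = incidence \<nu> u d"
  shows "s = u"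
proof (rule ccontr)
  assume ne: "s \<noteq> u"
  have dE: "d \<in> E" using facet_in_E s by blast
  obtain p where p: "p \<in> rel_interior d"
    using facet_nonempty[OF dE] facet_convex[OF dE] rel_interior_eq_empty by blast
  have pd: "p \<in> d" using p rel_interior_subset by blast
  obtain e where e: "e > 0" "\<And>t. 0 < t \<and> t \<le> e \<Longrightarrow> p - (t * incidence \<nu> s d) *\<^sub>R \<nu> d \<in> s"
    using facet_inward[OF s p] by auto
  obtain e' where e': "e' > 0" "\<And>t. 0 < t \<and> t \<le> e' \<Longrightarrow> p - (t * incidence \<nu> u d) *\<^sub>R \<nu> d \<in> u"
    using facet_inward[OF u p] by auto
  let ?t = "min e e'"
  let ?y = "p - (?t * incidence \<nu> s d) *\<^sub>R \<nu> d"
  have "?y \<in> s" "?y \<in> u" using e(2)[of ?t] e'(2)[of ?t] e(1) e'(1) i by auto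
  then have "?y \<in> d" using shared_facet(1)[OF s(1) u(1) ne s(2) facet_subset[OF u(2)]] by blast
  then have "\<nu> d \<bullet> ?y = \<nu> d \<bullet> p" using normal_const[OF dE _ pd] by blast
  then have "?t * incidence \<nu> s d * (\<nu> d \<bullet> \<nu> d) = 0" by (simp add: inner_diff_right)
  moreover have "\<nu> d \<bullet> \<nu> d = 1" using normal_unit[OF dE] by (simp add: norm_eq_1)
  ultimately show False using e(1) e'(1) facet_side(1)[OF s pd] by auto
qed

text \<open>
  The normal of a facet points out of the first tile and into the second, so a positive value of a cochain
  is a flow from the first tile to the second.
\<close>

definition pos :: "'a set \<Rightarrow> 'a set" where
  "pos d = (THE s. s \<in> V \<and> d facet_of s \<and> incidence \<nu> s d = 1)"

definition neg :: "'a set \<Rightarrow> 'a set" where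
  "neg d = (THE s. s \<in> V \<and> d facet_of s \<and> incidence \<nu> s d = - 1)"

lemma pos_eqI: "s \<in> V \<Longrightarrow> d facet_of s \<Longrightarrow> incidence \<nu> s d = 1 \<Longrightarrow> pos d = s"
  unfolding pos_def by (rule the_equality) (use same_side_unique in \<open>metis+\<close>)

lemma neg_eqI: "s \<in> V \<Longrightarrow> d facet_of s \<Longrightarrow> incidence \<nu> s d = - 1 \<Longrightarrow> neg d = s"
  unfolding neg_def by (rule the_equality) (use same_side_unique in \<open>metis+\<close>)

lemma incidence_cases: "incidence \<nu> s d = 1 \<or> incidence \<nu> s d = - 1"
  by (simp add: incidence_def)

lemma pos_neg:
  assumes "d \<in> E"
  shows pos_V: "pos d \<in> V" and pos_facet: "d facet_of pos d" and pos_inc: "incidence \<nu> (pos d) d = 1"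
    and neg_V: "neg d \<in> V" and neg_facet: "d facet_of neg d" and neg_inc: "incidence \<nu> (neg d) d = - 1"
proof -
  obtain s where s: "s \<in> V" "d facet_of s" using assms by (rule E_facet)
  obtain u where u: "u \<in> V" "u \<noteq> s" "d facet_of u" using other_tile[OF s] by blast
  have "incidence \<nu> s d \<noteq> incidence \<nu> u d" using same_side_unique s u by metis
  then obtain s' u' where *: "s' \<in> V" "d facet_of s'" "incidence \<nu> s' d = 1"
    "u' \<in> V" "d facet_of u'" "incidence \<nu> u' d = - 1"
    using s u incidence_cases by metis
  then have "pos d = s'" "neg d = u'" using pos_eqI neg_eqI by auto
  with * show "pos d \<in> V" "d facet_of pos d" "incidence \<nu> (pos d) d = 1"
    "neg d \<in> V" "d facet_of neg d" "incidence \<nu> (neg d) d = - 1" by auto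
qed

lemma facet_of_iff: "d \<in> E \<Longrightarrow> s \<in> V \<Longrightarrow> d facet_of s \<longleftrightarrow> s = pos d \<or> s = neg d"
  using pos_neg pos_eqI neg_eqI incidence_cases by metis

lemma pos_neq_neg: "d \<in> E \<Longrightarrow> pos d \<noteq> neg d"
  using pos_neg(3,6) by fastforce

lemma coboundary_tile:
  "s \<in> V \<Longrightarrow> coboundary T \<nu> \<beta> s = (\<Sum>d | d facet_of s. incidence \<nu> s d * \<beta> d)"
  by (simp add: coboundary_def cells_top)

lemma coboundary_nontile: "s \<notin> V \<Longrightarrow> coboundary T \<nu> \<beta> s = 0"
  by (simp add: coboundary_def cells_top)

text \<open>
  The coboundary is the divergence on the dual graph, and its adjoint is the gradient
  \<open>g (pos d) - g (neg d)\<close>.  Extending \<open>g\<close> by 0 outside \<open>P\<close> takes care of the boundary of \<open>P\<close>; \<open>g = 1\<close> gives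
  Stokes' theorem.
\<close>

lemma summation_by_parts:
  assumes P: "finite P" "P \<subseteq> V" and F: "finite F" "F \<subseteq> E"
    and PF: "\<And>s d. s \<in> P \<Longrightarrow> d facet_of s \<Longrightarrow> d \<notin> F \<Longrightarrow> \<beta> d = 0"
  shows "(\<Sum>s\<in>P. g s * coboundary T \<nu> \<beta> s) =
    (\<Sum>d\<in>F. \<beta> d * ((if pos d \<in> P then g (pos d) else 0) - (if neg d \<in> P then g (neg d) else 0)))"
proof -
  have "coboundary T \<nu> \<beta> s = (\<Sum>d\<in>F. if d facet_of s then incidence \<nu> s d * \<beta> d else 0)"
    if s: "s \<in> P" for s
  proof -
    have "coboundary T \<nu> \<beta> s = (\<Sum>d\<in>F \<inter> {d. d facet_of s}. incidence \<nu> s d * \<beta> d)"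
      unfolding coboundary_tile[OF subsetD[OF P(2) s]]
      using PF[OF s] finite_facets[OF subsetD[OF P(2) s]] by (intro sum.mono_neutral_right) auto
    then show ?thesis using F(1) by (simp add: sum.inter_restrict)
  qed
  then have "(\<Sum>s\<in>P. g s * coboundary T \<nu> \<beta> s) =
      (\<Sum>s\<in>P. \<Sum>d\<in>F. g s * (if d facet_of s then incidence \<nu> s d * \<beta> d else 0))"
    by (simp add: sum_distrib_left)
  also have "\<dots> = (\<Sum>d\<in>F. \<Sum>s\<in>P. g s * (if d facet_of s then incidence \<nu> s d * \<beta> d else 0))"
    by (rule sum.swap)
  also have "\<dots> = (\<Sum>d\<in>F. (\<Sum>s\<in>P. if s = pos d then g s * \<beta> d else 0) -
      (\<Sum>s\<in>P. if s = neg d then g s * \<beta> d else 0))"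
  proof (rule sum.cong[OF refl])
    fix d assume "d \<in> F"
    then have d: "d \<in> E" using F by blast
    show "(\<Sum>s\<in>P. g s * (if d facet_of s then incidence \<nu> s d * \<beta> d else 0)) =
        (\<Sum>s\<in>P. if s = pos d then g s * \<beta> d else 0) - (\<Sum>s\<in>P. if s = neg d then g s * \<beta> d else 0)"
      unfolding sum_subtractf[symmetric]
      using P(2) facet_of_iff[OF d] pos_neg[OF d] pos_neq_neg[OF d]
      by (intro sum.cong refl) auto
  qed
  also have "\<dots> = (\<Sum>d\<in>F. \<beta> d * ((if pos d \<in> P then g (pos d) else 0) - (if neg d \<in> P then g (neg d) else 0)))"
    using P(1) by (intro sum.cong refl) (simp add: sum.delta algebra_simps)
  finally show ?thesis .
qed

definition bdry :: "'a set set \<Rightarrow> 'a set set" where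
  "bdry P = {d \<in> E. (pos d \<in> P) \<noteq> (neg d \<in> P)}"

lemma bdry_subset: "P \<subseteq> V \<Longrightarrow> bdry P \<subseteq> (\<Union>s\<in>P. {d. d facet_of s})"
  using pos_neg by (fastforce simp: bdry_def)

lemma finite_bdry: "finite P \<Longrightarrow> P \<subseteq> V \<Longrightarrow> finite (bdry P)"
  by (rule finite_subset[OF bdry_subset]) (use finite_facets in auto)

lemma sum_coboundary:
  assumes P: "finite P" "P \<subseteq> V"
  shows "(\<Sum>s\<in>P. coboundary T \<nu> \<beta> s) = (\<Sum>d\<in>bdry P. (if pos d \<in> P then \<beta> d else - \<beta> d))"
proof -
  define F where "F = (\<Union>s\<in>P. {d. d facet_of s})"
  have F: "finite F" "F \<subseteq> E" using P finite_facets facet_in_E by (auto simp: F_def)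
  have "(\<Sum>s\<in>P. 1 * coboundary T \<nu> \<beta> s) =
    (\<Sum>d\<in>F. \<beta> d * ((if pos d \<in> P then 1 else 0) - (if neg d \<in> P then 1 else 0)))"
    using F by (intro summation_by_parts P) (auto simp: F_def)
  also have "\<dots> = (\<Sum>d\<in>bdry P. \<beta> d * ((if pos d \<in> P then 1 else 0) - (if neg d \<in> P then 1 else 0)))"
    using F bdry_subset[OF P(2)] by (intro sum.mono_neutral_right) (auto simp: F_def bdry_def)
  also have "\<dots> = (\<Sum>d\<in>bdry P. (if pos d \<in> P then \<beta> d else - \<beta> d))"
    by (intro sum.cong) (auto simp: bdry_def)
  finally show ?thesis by simp
qed

definition adj :: "'a set \<Rightarrow> ('a set \<times> 'a set) set" where
  "adj W = {(s, u). s \<in> V \<and> u \<in> V \<and> s \<noteq> u \<and> (s \<inter> u) facet_of s \<and> (s \<inter> u) \<inter> W \<noteq> {}}"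

text \<open>
  Walk along a segment: it stays in the ball, and if it avoids the faces of codimension two or more, then it
  passes from tile to tile through facets.  Such a segment exists, because the points \<open>y\<close> for which the segment
  from \<open>x\<close> to \<open>y\<close> meets a given such face lie in a proper affine subspace through \<open>x\<close>, a null set.
\<close>

lemma tiles_connected:
  assumes s: "s \<in> V" "s \<inter> ball p r \<noteq> {}" and u: "u \<in> V" "u \<inter> ball p r \<noteq> {}"
  shows "(s, u) \<in> (adj (ball p r))\<^sup>*"
proof (rule ccontr)
  assume nr: "(s, u) \<notin> (adj (ball p r))\<^sup>*"
  let ?W = "ball p r"
  define N where "N = {t \<in> V. t \<inter> ?W \<noteq> {}}"
  have finN: "finite N"
    by (rule finite_subset[OF _ finite_near[of r p]]) (auto simp: N_def near_def)
  define A where "A = {t \<in> N. (s, t) \<in> (adj ?W)\<^sup>*}"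
  define B where "B = N - A"
  have "finite A" "finite B" using finN by (auto simp: A_def B_def)
  moreover have "A \<subseteq> V" "B \<subseteq> V" by (auto simp: A_def B_def N_def)
  ultimately have cl: "closed (\<Union>A)" "closed (\<Union>B)"
    using tile_closed by (simp_all add: closed_Union subset_iff)
  have meets: "interior t \<inter> ?W \<noteq> {}" if "t \<in> N" for t
  proof -
    have "closure (interior t) \<inter> ?W \<noteq> {}" using that tile_closure_interior by (auto simp: N_def)
    then show ?thesis using open_Int_closure_eq_empty[of ?W "interior t"] by (simp add: Int_commute)
  qed
  have sN: "s \<in> N" "u \<in> N" using s u by (auto simp: N_def)
  then have sA: "s \<in> A" and uB: "u \<in> B" using nr by (auto simp: A_def B_def)
  obtain x where x: "x \<in> interior s" "x \<in> ?W" using meets sN by blast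
  \<comment> \<open>a segment from \<open>x\<close> whose end point avoids the hulls below crosses from tile to tile in facets only\<close>
  define \<F> where "\<F> = {F. F \<noteq> {} \<and> aff_dim F < int (DIM('a)) - 1 \<and> (\<exists>t\<in>N. \<exists>t'\<in>N. F = t \<inter> t')}"
  have "\<F> \<subseteq> (\<lambda>(t, t'). t \<inter> t') ` (N \<times> N)" by (auto simp: \<F>_def)
  then have fin\<F>: "finite \<F>" using finN finite_subset by blast
  define Z where "Z = (\<Union>F\<in>\<F>. affine hull (insert x F))"
  have "negligible (affine hull (insert x F))" if F: "F \<in> \<F>" for F
  proof -
    have "aff_dim (affine hull (insert x F)) < int (DIM('a))"
      using F aff_dim_insert[of x F] by (simp add: \<F>_def split: if_splits)
    then have "interior (affine hull (insert x F)) = {}"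
      by (metis aff_dim_nonempty_interior less_irrefl)
    then show ?thesis
      using negligible_convex_interior[of "affine hull (insert x F)"] affine_imp_convex affine_affine_hull by blast
  qed
  then have "negligible Z" unfolding Z_def using fin\<F> by (intro negligible_Union) auto
  moreover have "open (interior u \<inter> ?W)" "interior u \<inter> ?W \<noteq> {}" using meets sN by auto
  ultimately have "\<not> interior u \<inter> ?W \<subseteq> Z" using negligible_subset open_not_negligible by blast
  then obtain y where y: "y \<in> interior u" "y \<in> ?W" "y \<notin> Z" by blast
  let ?S = "closed_segment x y"
  have SW: "?S \<subseteq> ?W" using x y closed_segment_subset convex_ball by blast
  have "?S \<subseteq> \<Union>A \<union> \<Union>B"
  proof
    fix z assume "z \<in> ?S"
    moreover obtain t where "t \<in> V" "z \<in> t" using tiles_cover by blast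
    ultimately have "t \<in> N" using SW by (auto simp: N_def)
    then show "z \<in> \<Union>A \<union> \<Union>B" using \<open>z \<in> t\<close> by (auto simp: B_def)
  qed
  moreover have "\<Union>A \<inter> ?S \<noteq> {}" "\<Union>B \<inter> ?S \<noteq> {}"
    using sA uB x(1) y(1) interior_subset[of s] interior_subset[of u] by blast+
  ultimately have "\<Union>A \<inter> \<Union>B \<inter> ?S \<noteq> {}"
    using connected_closedD[OF connected_segment(1)[of x y], of "\<Union>A" "\<Union>B"] cl by blast
  then obtain z t t' where z: "z \<in> ?S" "z \<in> t" "z \<in> t'" "t \<in> A" "t' \<in> B" by blast
  have tt': "t \<in> N" "t' \<in> N" "t \<noteq> t'" "t \<in> V" "t' \<in> V" using z by (auto simp: A_def B_def N_def)
  have zW: "z \<in> ?W" using z(1) SW by blast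
  let ?F = "t \<inter> t'"
  show False
  proof (cases "aff_dim ?F < int (DIM('a)) - 1")
    case False
    have "?F \<noteq> t" using tiles_disjoint[of t t'] tt' tile_interior[of t] interior_subset[of t] by blast
    then have "aff_dim ?F < aff_dim t"
      using face_of_aff_dim_lt tile_inter_face tile_convex tt' by blast
    then have "?F facet_of t"
      using False tile_aff_dim[OF tt'(4)] tile_inter_face(1)[OF tt'(4,5)] z by (auto simp: facet_of_def)
    then have "(t, t') \<in> adj ?W" using tt' z zW by (auto simp: adj_def)
    then have "t' \<in> A" using z(4) tt' by (auto simp: A_def)
    then show False using z(5) by (simp add: B_def)
  next
    case True
    then have F: "?F \<in> \<F>" using tt' z by (auto simp: \<F>_def)
    have "z \<noteq> x"
    proof
      assume "z = x"
      then have "x \<in> interior s \<inter> t" "x \<in> interior s \<inter> t'" using x(1) z by auto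
      then have "t = s" "t' = s" using tiles_disjoint[OF s(1)] tt'(4,5) by blast+
      then show False using tt' by simp
    qed
    then obtain l where l: "z = (1 - l) *\<^sub>R x + l *\<^sub>R y" "l \<noteq> 0"
      using z(1) by (force simp: closed_segment_def)
    have "(1/l) *\<^sub>R z = ((1 - l) / l) *\<^sub>R x + y"
      using l(2) by (simp add: l(1) scaleR_add_right)
    moreover have "(1 - l) / l = 1/l - 1" using l(2) by (simp add: diff_divide_distrib)
    ultimately have "y = (1 - 1/l) *\<^sub>R x + (1/l) *\<^sub>R z"
      by (simp add: algebra_simps)
    moreover have "x \<in> affine hull (insert x ?F)" "z \<in> affine hull (insert x ?F)"
      using z by (auto intro: hull_inc)
    ultimately have "y \<in> affine hull (insert x ?F)"
      using mem_affine[OF affine_affine_hull[of "insert x ?F"], of x z "1 - 1/l" "1/l"] by simp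
    then show False using y(3) F by (auto simp: Z_def)
  qed
qed

text \<open>
  A point of the frontier belongs to a tile inside and to a tile outside the patch.  The tiles around the
  point are connected through facets that contain it, so some such facet separates the two kinds of tiles.
\<close>

lemma frontier_patch:
  assumes P: "finite P" "P \<subseteq> V"
  shows "frontier (\<Union>P) = \<Union>(bdry P)"
proof (intro equalityI subsetI)
  fix p assume p: "p \<in> \<Union>(bdry P)"
  then obtain d where d: "p \<in> d" "d \<in> E" "(pos d \<in> P) \<noteq> (neg d \<in> P)" by (auto simp: bdry_def)
  then obtain s u where su: "s \<in> P" "u \<in> V" "u \<notin> P" "p \<in> s" "p \<in> u"
    using pos_neg[OF d(2)] facet_subset by blast
  have "p \<in> closure (interior u)" using su tile_closure_interior by auto
  moreover have "interior u \<subseteq> - \<Union>P" using tiles_disjoint[of u] su P by blast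
  ultimately have "p \<in> closure (- \<Union>P)" using closure_mono by blast
  moreover have "p \<in> closure (\<Union>P)" using su closure_subset[of "\<Union>P"] by blast
  ultimately show "p \<in> frontier (\<Union>P)" by (simp add: frontier_closures)
next
  fix p assume p: "p \<in> frontier (\<Union>P)"
  have "closed (\<Union>P)" using P tile_closed by (intro closed_Union) auto
  then have "p \<in> \<Union>P" using p frontier_subset_closed by blast
  then obtain s where s: "s \<in> P" "p \<in> s" by blast
  obtain e where e: "e > 0" "\<And>u. u \<in> V \<Longrightarrow> u \<inter> ball p e \<noteq> {} \<Longrightarrow> p \<in> u"
    using star_radius by metis
  have "p \<in> closure (- \<Union>P)" using p by (simp add: frontier_closures)
  then obtain y where y: "y \<in> ball p e" "y \<notin> \<Union>P"
    using e(1) by (metis Compl_iff closure_approachable dist_commute mem_ball)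
  obtain u where u: "u \<in> V" "y \<in> u" using tiles_cover by blast
  have "(s, u) \<in> (adj (ball p e))\<^sup>*"
    using s u y e(1) P by (intro tiles_connected) (auto intro: centre_in_ball[THEN iffD2])
  moreover have "u \<notin> P" using u y by blast
  ultimately obtain a b where ab: "(a, b) \<in> adj (ball p e)" "a \<in> P" "b \<notin> P"
    using s(1) by (induction rule: rtrancl_induct) auto
  then have d: "a \<in> V" "b \<in> V" "a \<noteq> b" "(a \<inter> b) facet_of a" "a \<inter> b \<inter> ball p e \<noteq> {}" by (auto simp: adj_def)
  then have dE: "a \<inter> b \<in> E" "(a \<inter> b) facet_of b" using facet_in_E shared_facet(2) by auto
  have "p \<in> a \<inter> b" using e(2)[of a] e(2)[of b] d by blast
  moreover have "a \<inter> b \<in> bdry P"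
    using facet_of_iff[OF dE(1)] d dE ab pos_neq_neg[OF dE(1)] by (auto simp: bdry_def)
  ultimately show "p \<in> \<Union>(bdry P)" by blast
qed

end

section \<open>Boundary area counts boundary facets\<close>

text \<open>
  The prism whose volume measures the area of the part of \<open>S\<close> in the hyperplane \<open>H\<close>.
\<close>

definition prism :: "'a::euclidean_space set \<Rightarrow> 'a set \<Rightarrow> 'a set" where
  "prism H S = {x + u |x u. x \<in> S \<inter> H \<and> norm u \<le> 1/2 \<and> (\<forall>p\<in>H. u \<bullet> (p - x) = 0)}"

definition hyperplane :: "'a::euclidean_space set \<Rightarrow> bool" where
  "hyperplane H \<longleftrightarrow> affine H \<and> aff_dim H = int (DIM('a)) - 1"

lemma hyperplane_obtain:
  fixes H :: "'a::euclidean_space set"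
  assumes "hyperplane H"
  obtains a b where "norm a = 1" "H = {x. a \<bullet> x = b}"
proof -
  have hull: "affine hull H = H" using assms by (simp add: hyperplane_def)
  have "aff_dim H = int (DIM('a)) - 1" using assms by (simp add: hyperplane_def)
  then have "aff_dim H = int (DIM('a) - 1)" using DIM_positive[where 'a='a] by linarith
  then have "\<exists>a b. a \<noteq> 0 \<and> affine hull H = {x. a \<bullet> x = b}" by (simp only: aff_dim_eq_hyperplane)
  then obtain a b where ab: "a \<noteq> 0" "H = {x. a \<bullet> x = b}" unfolding hull by blast
  show ?thesis
  proof (rule that)
    show "norm (a /\<^sub>R norm a) = 1" using ab by simp
    show "H = {x. (a /\<^sub>R norm a) \<bullet> x = b / norm a}" using ab by (auto simp: field_simps)
  qed
qed

text \<open>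
  The vectors orthogonal to a hyperplane are the multiples of its unit normal.
\<close>

lemma prism_eq:
  fixes a :: "'a::euclidean_space"
  assumes a: "norm a = 1" and H: "H = {x. a \<bullet> x = b}"
  shows "prism H S = (\<lambda>(x, t). x + t *\<^sub>R a) ` ((S \<inter> H) \<times> {-1/2..1/2})"
proof (intro equalityI subsetI)
  fix y assume "y \<in> prism H S"
  then obtain x u where y: "y = x + u" "x \<in> S \<inter> H" "norm u \<le> 1/2" "\<forall>p\<in>H. u \<bullet> (p - x) = 0"
    by (auto simp: prism_def)
  have aa: "a \<bullet> a = 1" using a by (simp add: norm_eq_1)
  define v where "v = u - (a \<bullet> u) *\<^sub>R a"
  have av: "a \<bullet> v = 0" by (simp add: v_def inner_diff_right aa)
  then have "x + v \<in> H" using y(2) H by (simp add: inner_add_right)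
  then have "u \<bullet> v = 0" using y(4) by fastforce
  moreover have "v \<bullet> v = u \<bullet> v - (a \<bullet> u) * (a \<bullet> v)" by (simp add: v_def inner_diff_left)
  ultimately have "v \<bullet> v = 0" using av by simp
  then have u: "u = (a \<bullet> u) *\<^sub>R a" by (simp add: v_def)
  then have "norm u = \<bar>a \<bullet> u\<bar>" using a by (metis norm_scaleR mult_1_right)
  then have "\<bar>a \<bullet> u\<bar> \<le> 1/2" using y(3) by simp
  then show "y \<in> (\<lambda>(x, t). x + t *\<^sub>R a) ` ((S \<inter> H) \<times> {-1/2..1/2})"
    using y u by (intro image_eqI[of _ _ "(x, a \<bullet> u)"]) (auto simp: abs_le_iff)
next
  fix y assume "y \<in> (\<lambda>(x, t). x + t *\<^sub>R a) ` ((S \<inter> H) \<times> {-1/2..1/2})"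
  then obtain x t where y: "y = x + t *\<^sub>R a" "x \<in> S \<inter> H" "-1/2 \<le> t" "t \<le> 1/2" by auto
  have "norm (t *\<^sub>R a) \<le> 1/2" using a y by (simp add: abs_le_iff)
  moreover have "\<forall>p\<in>H. (t *\<^sub>R a) \<bullet> (p - x) = 0" using H y by (simp add: inner_diff_right)
  ultimately show "y \<in> prism H S" unfolding prism_def using y by blast
qed

lemma prism_UN: "prism H (\<Union>G) = (\<Union>d\<in>G. prism H d)"
  by (auto simp: prism_def)

lemma prism_mono: "S \<subseteq> U \<Longrightarrow> prism H S \<subseteq> prism H U"
  by (auto simp: prism_def)

lemma prism_shift: "prism (shift w H) (shift w S) = shift w (prism H S)"
proof -
  have sub: "shift w (prism H S) \<subseteq> prism (shift w H) (shift w S)" for w :: 'a and H S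
  proof
    fix y assume "y \<in> shift w (prism H S)"
    then obtain x u where x: "y - w = x + u" "x \<in> S \<inter> H" "norm u \<le> 1/2" "\<forall>p\<in>H. u \<bullet> (p - x) = 0"
      by (auto simp: prism_def)
    have "u \<bullet> (p - (x + w)) = 0" if "p \<in> shift w H" for p
      using x(4) that by (auto simp: algebra_simps dest: bspec[of _ _ "p - w"])
    moreover have "y = (x + w) + u" using x(1) by (simp add: algebra_simps)
    moreover have "x + w \<in> shift w S \<inter> shift w H" using x by simp
    ultimately show "y \<in> prism (shift w H) (shift w S)" unfolding prism_def using x(3) by blast
  qed
  have "shift (- w) (prism (shift w H) (shift w S)) \<subseteq> prism H S"
    using sub[of "- w" "shift w H" "shift w S"] by simp
  then have "prism (shift w H) (shift w S) \<subseteq> shift w (prism H S)"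
    by (auto simp: subset_iff dest!: spec[of _ "_ - w"])
  with sub show ?thesis by blast
qed

lemma prism_convex:
  assumes "hyperplane H" "convex S"
  shows "convex (prism H S)"
proof -
  obtain a b where ab: "norm a = 1" "H = {x. a \<bullet> x = b}" using assms(1) by (rule hyperplane_obtain)
  have "linear (\<lambda>(x, t). x + t *\<^sub>R a)"
    by (auto simp: linear_iff algebra_simps)
  moreover have "convex ((S \<inter> H) \<times> {-1/2..1/2::real})"
    using assms by (intro convex_Times convex_Int) (auto simp: hyperplane_def affine_imp_convex)
  ultimately show ?thesis unfolding prism_eq[OF ab] by (rule convex_linear_image)
qed

lemma prism_subset_cball:
  assumes "S \<subseteq> cball p r"
  shows "prism H S \<subseteq> cball p (r + 1/2)"
proof
  fix y assume "y \<in> prism H S"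
  then obtain x u where y: "y = x + u" "x \<in> S" "norm u \<le> 1/2" by (auto simp: prism_def)
  have "dist p y \<le> dist p x + dist x y" by (rule dist_triangle)
  moreover have "dist p x \<le> r" using assms y by auto
  moreover have "dist x y \<le> 1/2" using y by (simp add: dist_norm)
  ultimately show "y \<in> cball p (r + 1/2)" by simp
qed

lemma prism_lmeasurable:
  assumes "hyperplane H" "convex S" "bounded S"
  shows "prism H S \<in> lmeasurable"
proof -
  obtain r where "S \<subseteq> cball 0 r" using assms(3) bounded_subset_ballD[of S 0] ball_subset_cball by blast
  then have "bounded (prism H S)" using prism_subset_cball bounded_cball bounded_subset by metis
  then show ?thesis using prism_convex assms measurable_convex by blast
qed

lemma negligible_convex_lowdim:
  fixes S :: "'a::euclidean_space set"
  assumes "convex S" "aff_dim S < int (DIM('a))"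
  shows "negligible S"
  using assms negligible_convex_interior by (metis aff_dim_nonempty_interior less_irrefl)

text \<open>
  The prism over a set of codimension two lies in a hyperplane.
\<close>

lemma prism_negligible:
  fixes S :: "'a::euclidean_space set"
  assumes "hyperplane H" "aff_dim (S \<inter> H) < int (DIM('a)) - 1"
  shows "negligible (prism H S)"
proof (cases "S \<inter> H = {}")
  case True
  then have "prism H S = {}" by (auto simp: prism_def)
  then show ?thesis by simp
next
  case False
  obtain a b where ab: "norm a = 1" "H = {x. a \<bullet> x = b}" using assms(1) by (rule hyperplane_obtain)
  obtain x0 where x0: "x0 \<in> S \<inter> H" using False by blast
  let ?A = "affine hull (insert (x0 + a) (S \<inter> H))"
  have "prism H S \<subseteq> ?A"
  proof
    fix y assume "y \<in> prism H S"
    then obtain x t where y: "y = x + t *\<^sub>R a" "x \<in> S \<inter> H" unfolding prism_eq[OF ab] by auto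
    have "1 *\<^sub>R x + t *\<^sub>R (x0 + a) + (- t) *\<^sub>R x0 \<in> ?A"
      using x0 y by (intro mem_affine_3 affine_affine_hull) (auto intro: hull_inc)
    then show "y \<in> ?A" using y by (simp add: algebra_simps)
  qed
  moreover have "aff_dim ?A < int (DIM('a))"
    using assms(2) aff_dim_insert[of "x0 + a" "S \<inter> H"] by (simp split: if_splits)
  then have "negligible ?A" using negligible_convex_lowdim affine_imp_convex affine_affine_hull by blast
  ultimately show ?thesis using negligible_subset by blast
qed

lemma prism_measure_pos:
  fixes S :: "'a::euclidean_space set"
  assumes H: "hyperplane H" and S: "convex S" "bounded S" "S \<subseteq> H" "aff_dim S = int (DIM('a)) - 1" "S \<noteq> {}"
  shows "measure lebesgue (prism H S) > 0"
proof -
  obtain a b where ab: "norm a = 1" "H = {x. a \<bullet> x = b}" using H by (rule hyperplane_obtain)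
  obtain x0 where x0: "x0 \<in> S" using S by blast
  define y where "y = x0 + (1/2) *\<^sub>R a"
  have "a \<bullet> a = 1" using ab(1) by (simp add: norm_eq_1)
  then have "y \<notin> H" using x0 S(3) by (auto simp: y_def ab(2) inner_add_right)
  moreover have "affine hull S \<subseteq> H" using S(3) H by (intro hull_minimal) (auto simp: hyperplane_def)
  ultimately have "aff_dim (insert y S) = int (DIM('a))" using S(4) aff_dim_insert[of y S] by auto
  moreover have "insert y S \<subseteq> prism H S"
  proof -
    have "y \<in> prism H S" unfolding prism_eq[OF ab] y_def
      using x0 S(3) by (intro image_eqI[of _ _ "(x0, 1/2)"]) auto
    moreover have "x \<in> prism H S" if "x \<in> S" for x unfolding prism_eq[OF ab]
      using that S(3) by (intro image_eqI[of _ _ "(x, 0)"]) auto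
    ultimately show ?thesis by blast
  qed
  ultimately have dim: "aff_dim (prism H S) = int (DIM('a))"
    using aff_dim_subset[of "insert y S" "prism H S"] aff_dim_le_DIM[of "prism H S"] by simp
  have "prism H S \<noteq> {}" using dim by auto
  then have "interior (prism H S) \<noteq> {}"
    using dim prism_convex[OF H S(1)] by (simp add: interior_rel_interior_gen rel_interior_eq_empty)
  then have "\<not> negligible (prism H S)"
    using negligible_convex_interior prism_convex[OF H S(1)] by blast
  then show ?thesis
    using prism_lmeasurable[OF H S(1,2)] negligible_iff_measure0 zero_less_measure_iff by metis
qed

lemma prism_disjoint:
  assumes "hyperplane H" "S \<inter> U = {}"
  shows "prism H S \<inter> prism H U = {}"
proof -
  obtain a b where ab: "norm a = 1" "H = {x. a \<bullet> x = b}" using assms(1) by (rule hyperplane_obtain)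
  have aa: "a \<bullet> a = 1" using ab(1) by (simp add: norm_eq_1)
  have False if "x \<in> S \<inter> H" "x' \<in> U \<inter> H" and eq: "x + t *\<^sub>R a = x' + t' *\<^sub>R a" for x x' t t'
  proof -
    have "a \<bullet> (x + t *\<^sub>R a) = a \<bullet> (x' + t' *\<^sub>R a)" using eq by simp
    moreover have "a \<bullet> x = b" "a \<bullet> x' = b" using that ab(2) by auto
    ultimately have "t = t'" by (simp add: inner_add_right aa)
    then have "x = x'" using eq by simp
    then show False using that assms(2) by blast
  qed
  then show ?thesis unfolding prism_eq[OF ab] by fast
qed

lemma hyperplane_area_prism: "hyperplane_area H S = measure lebesgue (prism H S)"
  by (simp add: hyperplane_area_def prism_def)

context flc_tiling
begin

lemma facet_hyperplane: "d \<in> E \<Longrightarrow> hyperplane (affine hull d)"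
  by (simp add: hyperplane_def facet_dim)

lemma facet_shift:
  assumes "d facet_of s"
  shows "shift w d facet_of shift w s"
  using assms unfolding facet_of_def shift_def
  by (simp add: face_of_translation_eq aff_dim_translation_eq)

lemma finite_facet_types: "\<exists>\<D>. finite \<D> \<and> (\<forall>d\<in>E. \<exists>w. shift w d \<in> \<D>)"
proof -
  define \<D> where "\<D> = (\<Union>N\<in>norm_tile ` V. {d. d facet_of N})"
  have "finite {d. d facet_of N}" if "N \<in> norm_tile ` V" for N
  proof -
    obtain s where s: "s \<in> V" "N = shift (- ref s) s" using \<open>N \<in> norm_tile ` V\<close> by (auto simp: norm_tile_def)
    have "{d. d facet_of N} \<subseteq> shift (- ref s) ` {d. d facet_of s}"
    proof
      fix d assume "d \<in> {d. d facet_of N}"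
      then have "shift (ref s) d facet_of shift (ref s) N" using facet_shift by blast
      then have "shift (ref s) d facet_of s" using s by simp
      then show "d \<in> shift (- ref s) ` {d. d facet_of s}"
        by (intro image_eqI[of _ _ "shift (ref s) d"]) auto
    qed
    then show ?thesis using finite_facets[OF s(1)] finite_surj by blast
  qed
  then have "finite \<D>" unfolding \<D>_def using finite_norm_tiles by blast
  moreover have "\<exists>w. shift w d \<in> \<D>" if d: "d \<in> E" for d
  proof -
    obtain s where s: "s \<in> V" "d facet_of s" using d by (rule E_facet)
    then have "shift (- ref s) d \<in> \<D>" using facet_shift[of d s "- ref s"] by (auto simp: \<D>_def norm_tile_def)
    then show ?thesis by blast
  qed
  ultimately show ?thesis by blast
qed

text \<open>
  There are finitely many facets up to translation, each with positive area.  Relative interiors are used,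
  because those of different facets in a hyperplane are disjoint.
\<close>

lemma facet_area_lower:
  "\<exists>a>0. \<forall>d\<in>E. a \<le> measure lebesgue (prism (affine hull d) (rel_interior d))"
proof -
  define g where "g d = measure lebesgue (prism (affine hull d) (rel_interior d))" for d :: "'a set"
  have g_shift: "g (shift w d) = g d" for w d
  proof -
    have "affine hull (shift w d) = shift w (affine hull d)" "rel_interior (shift w d) = shift w (rel_interior d)"
      unfolding shift_def by (rule affine_hull_translation) (rule rel_interior_translation)
    then show ?thesis by (simp add: g_def prism_shift measure_shift)
  qed
  have g_pos: "g d > 0" if d: "d \<in> E" for d
    unfolding g_def
  proof (rule prism_measure_pos)
    show "hyperplane (affine hull d)" using d by (rule facet_hyperplane)
    show "convex (rel_interior d)" using facet_convex[OF d] by (rule convex_rel_interior)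
    show "bounded (rel_interior d)"
      using compact_imp_bounded[OF facet_compact[OF d]] rel_interior_subset bounded_subset by blast
    show "rel_interior d \<subseteq> affine hull d" by (meson rel_interior_subset hull_subset subset_trans)
    show "aff_dim (rel_interior d) = int (DIM('a)) - 1"
      using facet_dim[OF d] facet_convex[OF d] by (simp add: rel_interior_aff_dim)
    show "rel_interior d \<noteq> {}" using facet_nonempty[OF d] facet_convex[OF d] by (simp add: rel_interior_eq_empty)
  qed
  obtain \<D> where D: "finite \<D>" "\<And>d. d \<in> E \<Longrightarrow> \<exists>w. shift w d \<in> \<D>" using finite_facet_types by blast
  define M where "M = insert 1 (g ` {d \<in> \<D>. g d > 0})"
  have "finite M" using D(1) by (simp add: M_def)
  moreover have "x > 0" if "x \<in> M" for x using that unfolding M_def by auto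
  ultimately have M: "finite M" "\<forall>x\<in>M. x > 0" by blast+
  have gM: "g d \<in> M" if d: "d \<in> E" for d
  proof -
    obtain w where w: "shift w d \<in> \<D>" using D(2)[OF d] by blast
    have "g (shift w d) > 0" unfolding g_shift using g_pos[OF d] .
    then have "g (shift w d) \<in> g ` {d \<in> \<D>. g d > 0}" using w by blast
    then show ?thesis unfolding M_def g_shift by blast
  qed
  have "M \<noteq> {}" by (simp add: M_def)
  then have "Min M > 0" using M by (simp add: Min_gr_iff)
  moreover have "\<forall>d\<in>E. Min M \<le> g d" using Min_le[OF M(1)] gM by blast
  ultimately show ?thesis unfolding g_def by blast
qed

lemma facet_subset_cball:
  assumes "d \<in> E" "p \<in> d"
  shows "d \<subseteq> cball p D"
proof -
  obtain s where s: "s \<in> V" "d facet_of s" using assms(1) by (rule E_facet)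
  then show ?thesis using facet_subset[OF s(2)] D_dist[OF s(1)] assms(2) by (meson mem_cball subsetD subsetI)
qed

lemma facet_area_upper:
  assumes "d \<in> E"
  shows "measure lebesgue (prism H d) \<le> measure lebesgue (cball (0::'a) (D + 1/2))"
proof -
  obtain p where p: "p \<in> d" using facet_nonempty[OF assms] by blast
  have "prism H d \<subseteq> cball p (D + 1/2)"
    using prism_subset_cball facet_subset_cball[OF assms p] by blast
  moreover have "prism H d \<in> sets lebesgue \<or> measure lebesgue (prism H d) = 0"
    using measure_notin_sets by blast
  ultimately have "measure lebesgue (prism H d) \<le> measure lebesgue (cball p (D + 1/2))"
    using measure_mono_fmeasurable[of "prism H d" "cball p (D + 1/2)" lebesgue] measure_nonneg[of lebesgue "cball p (D + 1/2)"]
      lmeasurable_cball by metis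
  also have "\<dots> = measure lebesgue (cball (0::'a) (D + 1/2))"
    using measure_shift[of p "cball 0 (D + 1/2)"] cball_translation[of p 0 "D + 1/2"] unfolding shift_def by simp
  finally show ?thesis .
qed

text \<open>
  A tile that contains a relative interior point of a facet of another tile contains this whole facet.
\<close>

lemma facets_rel_interior_disjoint:
  assumes d: "d \<in> E" and d': "d' \<in> E" and ne: "d \<noteq> d'" and hull: "affine hull d = affine hull d'"
  shows "rel_interior d \<inter> rel_interior d' = {}"
proof (rule ccontr)
  assume "rel_interior d \<inter> rel_interior d' \<noteq> {}"
  then obtain p where p: "p \<in> rel_interior d" "p \<in> rel_interior d'" by blast
  have sub: "d1 \<subseteq> d2"
    if d1: "d1 \<in> E" and d2: "d2 \<in> E" and p1: "p \<in> rel_interior d1" and p2: "p \<in> rel_interior d2"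
      and h: "affine hull d1 = affine hull d2" for d1 d2
  proof -
    have pd: "p \<in> d1" "p \<in> d2" using p1 p2 rel_interior_subset by blast+
    obtain s u where su: "s \<in> V" "d1 facet_of s" "u \<in> V" "d2 facet_of u" using d1 d2 E_facet by metis
    have "p \<in> u" using pd(2) facet_subset[OF su(4)] by blast
    then have "(s \<inter> u) \<inter> rel_interior d1 \<noteq> {}" using p1 pd(1) facet_subset[OF su(2)] by blast
    then have "d1 \<subseteq> s \<inter> u"
      using subset_of_face_of[OF tile_inter_face(1)[OF su(1,3)] facet_subset[OF su(2)]] by blast
    then have d1u: "d1 \<subseteq> u" by blast
    have "d2 = {x \<in> u. \<nu> d2 \<bullet> x = \<nu> d2 \<bullet> p}" by (rule facet_side(3)[OF su(3,4) pd(2)])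
    moreover have "d1 \<subseteq> {x. \<nu> d2 \<bullet> x = \<nu> d2 \<bullet> p}"
      using hull_subset[of d1 affine] unfolding h facet_affine_hull[OF d2 pd(2)] .
    ultimately show ?thesis using d1u by blast
  qed
  show False using sub[OF d d' p hull] sub[OF d' d p(2,1) hull[symmetric]] ne by blast
qed

lemma prism_rel_interior_lmeasurable:
  assumes "hyperplane H" "d \<in> E"
  shows "prism H (rel_interior d) \<in> lmeasurable"
proof (rule prism_lmeasurable[OF assms(1)])
  show "convex (rel_interior d)" using facet_convex[OF assms(2)] by (rule convex_rel_interior)
  show "bounded (rel_interior d)"
    using compact_imp_bounded[OF facet_compact[OF assms(2)]] rel_interior_subset bounded_subset by blast
qed

text \<open>
  Facets in other hyperplanes meet \<open>H\<close> in codimension two and contribute nothing.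
\<close>

lemma area_in_hyperplane:
  assumes H: "hyperplane H" and G: "finite G" "G \<subseteq> E"
    and a: "a > 0" "\<And>d. d \<in> E \<Longrightarrow> a \<le> measure lebesgue (prism (affine hull d) (rel_interior d))"
    and A: "A = measure lebesgue (cball (0::'a) (D + 1/2))"
  shows "a * card {d \<in> G. affine hull d = H} \<le> hyperplane_area H (\<Union>G)"
    and "hyperplane_area H (\<Union>G) \<le> A * card {d \<in> G. affine hull d = H}"
proof -
  let ?GH = "{d \<in> G. affine hull d = H}"
  have meas: "prism H d \<in> lmeasurable" if "d \<in> G" for d
    using that G H facet_convex facet_compact compact_imp_bounded prism_lmeasurable by blast
  have zero: "measure lebesgue (prism H d) = 0" if d: "d \<in> G" "affine hull d \<noteq> H" for d
  proof -
    have dE: "d \<in> E" using d G by blast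
    have "aff_dim (d \<inter> H) < int (DIM('a)) - 1"
    proof (rule ccontr)
      assume n: "\<not> aff_dim (d \<inter> H) < int (DIM('a)) - 1"
      have 1: "affine hull (d \<inter> H) \<subseteq> affine hull d" by (rule hull_mono) blast
      have 2: "affine hull (d \<inter> H) \<subseteq> H" using H by (intro hull_minimal) (auto simp: hyperplane_def)
      have ne: "d \<inter> H \<noteq> {}" 
        using n aff_dim_subset[of "d \<inter> H" d] facet_dim[OF dE] aff_dim_empty[of "d \<inter> H"] DIM_positive[where 'a='a] by linarith
      have dim: "aff_dim (affine hull (d \<inter> H)) = int (DIM('a)) - 1"
        using n aff_dim_subset[of "d \<inter> H" d] facet_dim[OF dE] by simp
      have "affine hull (d \<inter> H) = affine hull d"
        using affine_dim_equal[OF affine_affine_hull affine_affine_hull _ 1] ne dim facet_dim[OF dE] by simp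
      moreover have "affine hull (d \<inter> H) = H"
        using affine_dim_equal[OF affine_affine_hull _ _ 2] ne dim H by (simp add: hyperplane_def)
      ultimately show False using d by simp
    qed
    then show ?thesis using prism_negligible[OF H] negligible_imp_measure0 by blast
  qed
  have eq: "prism H (\<Union>G) = (\<Union>d\<in>G. prism H d)" by (rule prism_UN)
  have measU: "prism H (\<Union>G) \<in> lmeasurable"
    unfolding eq using G(1) meas by (intro fmeasurable.finite_UN) auto
  have "measure lebesgue (prism H (\<Union>G)) \<le> (\<Sum>d\<in>G. measure lebesgue (prism H d))"
    unfolding eq using G(1) meas by (intro measure_UNION_le) (auto simp: fmeasurableD)
  also have "\<dots> = (\<Sum>d\<in>?GH. measure lebesgue (prism H d))"
    using G(1) zero by (intro sum.mono_neutral_right) auto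
  also have "\<dots> \<le> (\<Sum>d\<in>?GH. A)"
    unfolding A using G(2) by (intro sum_mono facet_area_upper) auto
  finally show "hyperplane_area H (\<Union>G) \<le> A * card ?GH"
    by (simp add: hyperplane_area_prism mult.commute)
  have "a * card ?GH = (\<Sum>d\<in>?GH. a)" by simp
  also have "\<dots> \<le> (\<Sum>d\<in>?GH. measure lebesgue (prism H (rel_interior d)))"
    using a(2) G(2) by (intro sum_mono) auto
  also have "\<dots> = measure lebesgue (\<Union>d\<in>?GH. prism H (rel_interior d))"
  proof (rule measure_finite_Union[symmetric])
    show "finite ?GH" using G by simp
    show "(\<lambda>d. prism H (rel_interior d)) ` ?GH \<subseteq> sets lebesgue"
      using prism_rel_interior_lmeasurable[OF H] G(2) fmeasurableD by blast
    show "disjoint_family_on (\<lambda>d. prism H (rel_interior d)) ?GH"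
      unfolding disjoint_family_on_def
    proof (intro ballI impI)
      fix d d' assume d: "d \<in> ?GH" "d' \<in> ?GH" "d \<noteq> d'"
      show "prism H (rel_interior d) \<inter> prism H (rel_interior d') = {}"
        using d G(2) by (intro prism_disjoint H facets_rel_interior_disjoint) auto
    qed
    fix d assume "d \<in> ?GH"
    then have "prism H (rel_interior d) \<in> lmeasurable"
      using prism_rel_interior_lmeasurable[OF H] G(2) by blast
    then show "emeasure lebesgue (prism H (rel_interior d)) \<noteq> \<infinity>"
      using fmeasurableD2 by fastforce
  qed
  also have "\<dots> \<le> measure lebesgue (prism H (\<Union>G))"
  proof (rule measure_mono_fmeasurable[OF _ _ measU])
    show "(\<Union>d\<in>?GH. prism H (rel_interior d)) \<subseteq> prism H (\<Union>G)"
      using prism_mono[OF rel_interior_subset] eq by blast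
    show "(\<Union>d\<in>?GH. prism H (rel_interior d)) \<in> sets lebesgue"
    proof (rule sets.finite_UN)
      show "finite ?GH" using G(1) by simp
      show "prism H (rel_interior d) \<in> sets lebesgue" if "d \<in> ?GH" for d
        using that prism_rel_interior_lmeasurable[OF H] G(2) fmeasurableD by blast
    qed
  qed
  finally show "a * card ?GH \<le> hyperplane_area H (\<Union>G)"
    by (simp add: hyperplane_area_prism)
qed

text \<open>
  Only the finitely many hyperplanes spanned by boundary facets contribute to the area, and every
  boundary facet contributes an amount between fixed positive bounds.
\<close>

lemma boundary_area_bounds:
  "\<exists>a>0. \<exists>A>0. \<forall>P. finite P \<and> P \<subseteq> V \<longrightarrow>
     a * real (card (bdry P)) \<le> polyhedral_area (frontier (\<Union>P)) \<and>
     polyhedral_area (frontier (\<Union>P)) \<le> A * real (card (bdry P))"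
proof -
  obtain a where a: "a > 0" "\<And>d. d \<in> E \<Longrightarrow> a \<le> measure lebesgue (prism (affine hull d) (rel_interior d))"
    using facet_area_lower by blast
  define A where "A = measure lebesgue (cball (0::'a) (D + 1/2))"
  have A0: "A > 0" using D_pos by (simp add: A_def content_cball)
  have "a * card (bdry P) \<le> polyhedral_area (frontier (\<Union>P)) \<and>
     polyhedral_area (frontier (\<Union>P)) \<le> A * card (bdry P)" if P: "finite P" "P \<subseteq> V" for P
  proof -
    let ?G = "bdry P" and ?hull = "\<lambda>d::'a set. affine hull d"
    have G: "finite ?G" "?G \<subseteq> E" using finite_bdry[OF P] by (auto simp: bdry_def)
    have \<H>: "{H::'a set. affine H \<and> aff_dim H = int (DIM('a)) - 1} = Collect hyperplane"
      by (auto simp: hyperplane_def)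
    have "polyhedral_area (frontier (\<Union>P)) = (\<Sum>\<^sub>\<infinity>H\<in>Collect hyperplane. hyperplane_area H (\<Union>?G))"
      unfolding polyhedral_area_def \<H> frontier_patch[OF P] ..
    also have "\<dots> = (\<Sum>\<^sub>\<infinity>H\<in>?hull ` ?G. hyperplane_area H (\<Union>?G))"
    proof (rule infsum_cong_neutral)
      fix H :: "'a set" assume H: "H \<in> Collect hyperplane - ?hull ` ?G"
      then have none: "{d \<in> ?G. affine hull d = H} = {}" by blast
      have "hyperplane H" using H by blast
      from area_in_hyperplane[OF this G a A_def] show "hyperplane_area H (\<Union>?G) = 0"
        unfolding none by simp
    next
      fix H assume "H \<in> ?hull ` ?G - Collect hyperplane"
      then show "hyperplane_area H (\<Union>?G) = 0" using facet_hyperplane G(2) by blast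
    qed simp
    also have "\<dots> = (\<Sum>H\<in>?hull ` ?G. hyperplane_area H (\<Union>?G))"
      using G(1) by (intro infsum_finite finite_imageI)
    finally have area: "polyhedral_area (frontier (\<Union>P)) = (\<Sum>H\<in>?hull ` ?G. hyperplane_area H (\<Union>?G))" .
    have hp: "hyperplane H" if "H \<in> ?hull ` ?G" for H using that facet_hyperplane G(2) by blast
    have card: "card ?G = (\<Sum>H\<in>?hull ` ?G. card {d \<in> ?G. affine hull d = H})"
      using sum.image_gen[OF G(1), of "\<lambda>_. 1::nat" ?hull] by simp
    have "a * card ?G = (\<Sum>H\<in>?hull ` ?G. a * card {d \<in> ?G. affine hull d = H})"
      unfolding card by (simp add: sum_distrib_left)
    also have "\<dots> \<le> polyhedral_area (frontier (\<Union>P))"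
      unfolding area by (intro sum_mono area_in_hyperplane(1)[OF hp G a A_def])
    finally have 1: "a * card ?G \<le> polyhedral_area (frontier (\<Union>P))" .
    have "polyhedral_area (frontier (\<Union>P)) \<le> (\<Sum>H\<in>?hull ` ?G. A * card {d \<in> ?G. affine hull d = H})"
      unfolding area by (intro sum_mono area_in_hyperplane(2)[OF hp G a A_def])
    also have "\<dots> = A * card ?G"
      unfolding card by (simp add: sum_distrib_left)
    finally show ?thesis using 1 by blast
  qed
  then have "\<forall>P. finite P \<and> P \<subseteq> V \<longrightarrow> a * card (bdry P) \<le> polyhedral_area (frontier (\<Union>P)) \<and>
     polyhedral_area (frontier (\<Union>P)) \<le> A * card (bdry P)" by simp
  then show ?thesis using a(1) A0 by (intro exI[of _ a] exI[of _ A] conjI)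
qed

end

section \<open>Max-flow min-cut for tilings\<close>

context flc_tiling
begin

lemma coboundary_linear:
  "coboundary T \<nu> (\<lambda>d. x * \<beta> d + y * \<gamma> d) s = x * coboundary T \<nu> \<beta> s + y * coboundary T \<nu> \<gamma> s"
  by (simp add: coboundary_def sum_distrib_left sum.distrib[symmetric] algebra_simps)

text \<open>
  The coarea inequality: the cut condition extends from indicator functions to all functions \<open>g\<close> with finite
  support.  Subtracting the least positive value \<open>m\<close> of \<open>g\<close> on its support \<open>P\<close> lowers the left side by
  \<open>m\<close> times the sum over \<open>P\<close>, lowers the total variation by exactly \<open>m\<close> times the number of boundary facets
  of \<open>P\<close>, and shrinks the support.
\<close>

lemma coarea_nonneg:
  assumes cut: "\<And>P. finite P \<Longrightarrow> P \<subseteq> V \<Longrightarrow> (\<Sum>s\<in>P. \<alpha> s) \<le> c * real (card (bdry P))"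
    and S: "finite S" "S \<subseteq> V" and F: "finite F" "F \<subseteq> E" "(\<Union>s\<in>S. {d. d facet_of s}) \<subseteq> F"
    and g: "\<And>s. g s \<ge> 0" "\<And>s. s \<notin> S \<Longrightarrow> g s = 0"
  shows "(\<Sum>s\<in>S. g s * \<alpha> s) \<le> c * (\<Sum>d\<in>F. \<bar>g (pos d) - g (neg d)\<bar>)"
  using g
proof (induction "card {s. g s > 0}" arbitrary: g rule: less_induct)
  case less
  define P where "P = {s. g s > 0}"
  have PS: "P \<subseteq> S" using less.prems by (force simp: P_def)
  have fP: "finite P" using PS S finite_subset by blast
  show ?case
  proof (cases "P = {}")
    case True
    then have "g s = 0" for s using less.prems(1)[of s] by (auto simp: P_def not_less intro: antisym)
    then show ?thesis by simp
  next
    case False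
    define m where "m = Min (g ` P)"
    have "m \<in> g ` P" using False fP by (simp add: m_def)
    then obtain s0 where s0: "s0 \<in> P" "g s0 = m" by auto
    then have m0: "m > 0" by (auto simp: P_def)
    have mle: "m \<le> g s" if "s \<in> P" for s using fP that by (simp add: m_def)
    define h where "h s = (if s \<in> P then g s - m else 0)" for s
    have h0: "h s \<ge> 0" for s using mle by (simp add: h_def)
    have hP: "h s = 0" if "s \<notin> P" for s using that by (simp add: h_def)
    have hS: "h s = 0" if "s \<notin> S" for s using that PS by (auto simp: h_def)
    have "{s. h s > 0} \<subset> P" using s0 by (auto simp: h_def split: if_splits)
    then have "card {s. h s > 0} < card P" by (rule psubset_card_mono[OF fP])
    then have IH: "(\<Sum>s\<in>S. h s * \<alpha> s) \<le> c * (\<Sum>d\<in>F. \<bar>h (pos d) - h (neg d)\<bar>)"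
      using h0 hS by (intro less.hyps) (auto simp: P_def)
    have gh: "g s = h s + (if s \<in> P then m else 0)" for s
      using less.prems(1)[of s] by (auto simp: h_def P_def)
    have "(\<Sum>s\<in>S. g s * \<alpha> s) = (\<Sum>s\<in>S. h s * \<alpha> s) + (\<Sum>s\<in>S. if s \<in> P then m * \<alpha> s else 0)"
      unfolding sum.distrib[symmetric] gh by (intro sum.cong) (auto simp: algebra_simps)
    also have "(\<Sum>s\<in>S. if s \<in> P then m * \<alpha> s else 0) = m * (\<Sum>s\<in>P. \<alpha> s)"
      using S(1) PS by (simp add: sum.inter_restrict[symmetric] Int_absorb1 sum_distrib_left)
    also have "m * (\<Sum>s\<in>P. \<alpha> s) \<le> m * (c * real (card (bdry P)))"
      using m0 PS S fP by (intro mult_left_mono cut) auto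
    finally have le: "(\<Sum>s\<in>S. g s * \<alpha> s) \<le> c * ((\<Sum>d\<in>F. \<bar>h (pos d) - h (neg d)\<bar>) + m * real (card (bdry P)))"
      using IH by (simp add: algebra_simps)
    have "bdry P \<subseteq> F" using bdry_subset[of P] PS S F(3) by blast
    then have "m * real (card (bdry P)) = (\<Sum>d\<in>F. if d \<in> bdry P then m else 0)"
      using F(1) by (simp add: sum.inter_restrict[symmetric] Int_absorb1)
    then have "(\<Sum>d\<in>F. \<bar>h (pos d) - h (neg d)\<bar>) + m * real (card (bdry P)) =
        (\<Sum>d\<in>F. \<bar>h (pos d) - h (neg d)\<bar> + (if d \<in> bdry P then m else 0))"
      by (simp add: sum.distrib)
    also have "\<dots> = (\<Sum>d\<in>F. \<bar>g (pos d) - g (neg d)\<bar>)"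
    proof (rule sum.cong[OF refl])
      fix d assume "d \<in> F"
      then have "d \<in> E" using F by blast
      then show "\<bar>h (pos d) - h (neg d)\<bar> + (if d \<in> bdry P then m else 0) = \<bar>g (pos d) - g (neg d)\<bar>"
        using h0[of "pos d"] h0[of "neg d"] m0 hP
        by (cases "pos d \<in> P"; cases "neg d \<in> P") (simp_all add: gh bdry_def)
    qed
    finally show ?thesis using le by simp
  qed
qed

text \<open>
  Positive and negative part are treated separately; total variation is additive over the two.
\<close>

lemma coarea:
  assumes cut: "\<And>P. finite P \<Longrightarrow> P \<subseteq> V \<Longrightarrow> \<bar>\<Sum>s\<in>P. \<alpha> s\<bar> \<le> c * real (card (bdry P))"
    and S: "finite S" "S \<subseteq> V" and F: "finite F" "F \<subseteq> E" "(\<Union>s\<in>S. {d. d facet_of s}) \<subseteq> F"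
    and g: "\<And>s. s \<notin> S \<Longrightarrow> g s = 0"
  shows "(\<Sum>s\<in>S. g s * \<alpha> s) \<le> c * (\<Sum>d\<in>F. \<bar>g (pos d) - g (neg d)\<bar>)"
proof -
  let ?p = "\<lambda>s. max (g s) 0" and ?n = "\<lambda>s. max (- g s) 0"
  have cut1: "(\<Sum>s\<in>P. \<alpha> s) \<le> c * real (card (bdry P))" "(\<Sum>s\<in>P. - \<alpha> s) \<le> c * real (card (bdry P))"
    if "finite P" "P \<subseteq> V" for P
    using cut[OF that] by (auto simp: sum_negf)
  have "(\<Sum>s\<in>S. g s * \<alpha> s) = (\<Sum>s\<in>S. ?p s * \<alpha> s) + (\<Sum>s\<in>S. ?n s * - \<alpha> s)"
    unfolding sum.distrib[symmetric] by (intro sum.cong) (auto simp: max_def)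
  also have "\<dots> \<le> c * (\<Sum>d\<in>F. \<bar>?p (pos d) - ?p (neg d)\<bar>) + c * (\<Sum>d\<in>F. \<bar>?n (pos d) - ?n (neg d)\<bar>)"
    using g by (intro add_mono coarea_nonneg S F cut1) auto
  also have "\<dots> = c * (\<Sum>d\<in>F. \<bar>?p (pos d) - ?p (neg d)\<bar> + \<bar>?n (pos d) - ?n (neg d)\<bar>)"
    by (simp add: sum.distrib distrib_left)
  also have "\<dots> = c * (\<Sum>d\<in>F. \<bar>g (pos d) - g (neg d)\<bar>)"
    by (intro arg_cong[of _ _ "(*) c"] sum.cong) (auto simp: max_def)
  finally show ?thesis .
qed

definition flow_box :: "real \<Rightarrow> ('a set \<Rightarrow> real) set" where
  "flow_box c = {\<beta>. \<forall>d. \<beta> d \<in> (if d \<in> E then {- c..c} else {0})}"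

lemma flow_boxD:
  assumes "\<beta> \<in> flow_box c"
  shows "d \<in> E \<Longrightarrow> \<beta> d \<in> {- c..c}" and "d \<notin> E \<Longrightarrow> \<beta> d = 0"
proof -
  have "\<beta> d \<in> (if d \<in> E then {- c..c} else {0})" using assms unfolding flow_box_def by blast
  then show "d \<in> E \<Longrightarrow> \<beta> d \<in> {- c..c}" "d \<notin> E \<Longrightarrow> \<beta> d = 0" by (simp_all split: if_splits)
qed

lemma compact_flow_box: "compact (flow_box c)"
proof -
  have "flow_box c = PiE UNIV (\<lambda>d. if d \<in> E then {- c..c} else {0})"
    by (auto simp: flow_box_def PiE_def Pi_def)
  moreover have "compactin (product_topology (\<lambda>_. euclideanreal) UNIV) (PiE UNIV (\<lambda>d. if d \<in> E then {- c..c} else {0}))"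
    by (simp add: compactin_PiE)
  ultimately show ?thesis
    by (simp add: euclidean_product_topology)
qed

lemma continuous_coboundary: "continuous_on A (\<lambda>\<beta>. coboundary T \<nu> \<beta> s)"
proof (cases "s \<in> V")
  case True
  have "continuous_on A (\<lambda>\<beta>::'a set \<Rightarrow> real. \<beta> d)" for d
    by (rule continuous_on_subset[OF continuous_on_product_coordinates]) simp
  then show ?thesis unfolding coboundary_tile[OF True]
    by (intro continuous_on_sum continuous_on_mult continuous_on_const)
next
  case False
  then show ?thesis by (simp add: coboundary_nontile)
qed

text \<open>
  Minimise the squared defect \<open>\<Sum> (\<alpha> - \<delta>\<beta>)\<^sup>2\<close> over the compact convex set of admissible flows, and let \<open>g\<close> be the
  defect of a minimiser.  Moving towards the flow \<open>\<gamma>\<close> that saturates every facet along the gradient of \<open>g\<close> does not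
  help, so \<open>\<Sum> g \<delta>\<gamma> \<le> \<Sum> g \<delta>\<beta>\<close>.  The left side is \<open>c\<close> times the total variation of \<open>g\<close>, which by the coarea
  inequality is at least \<open>\<Sum> g \<alpha>\<close>.  Hence \<open>\<Sum> g\<^sup>2 \<le> 0\<close>.
\<close>

lemma flow_on_patch:
  assumes c: "c \<ge> 0"
    and cut: "\<And>P. finite P \<Longrightarrow> P \<subseteq> V \<Longrightarrow> \<bar>\<Sum>s\<in>P. \<alpha> s\<bar> \<le> c * real (card (bdry P))"
    and P: "finite P" "P \<subseteq> V"
  shows "\<exists>\<beta>\<in>flow_box c. \<forall>s\<in>P. coboundary T \<nu> \<beta> s = \<alpha> s"
proof -
  define J where "J \<beta> = (\<Sum>s\<in>P. (\<alpha> s - coboundary T \<nu> \<beta> s)\<^sup>2)" for \<beta>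
  have "continuous_on (flow_box c) J"
    unfolding J_def by (intro continuous_intros continuous_coboundary)
  moreover have "(\<lambda>_. 0) \<in> flow_box c" using c by (simp add: flow_box_def)
  ultimately obtain \<beta> where b: "\<beta> \<in> flow_box c" "\<And>\<gamma>. \<gamma> \<in> flow_box c \<Longrightarrow> J \<beta> \<le> J \<gamma>"
    using continuous_attains_inf[OF compact_flow_box, of c J] by blast
  define g where "g s = (if s \<in> P then \<alpha> s - coboundary T \<nu> \<beta> s else 0)" for s
  define F where "F = (\<Union>s\<in>P. {d. d facet_of s})"
  have F: "finite F" "F \<subseteq> E" using P finite_facets facet_in_E by (auto simp: F_def)
  \<comment> \<open>a competing flow that saturates every facet in the direction of the gradient of the defect\<close>
  define \<gamma> where "\<gamma> d = (if d \<in> F then c * sgn (g (pos d) - g (neg d)) else 0)" for d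
  have \<gamma>: "\<gamma> \<in> flow_box c"
    using c F(2) by (auto simp: flow_box_def \<gamma>_def sgn_if)
  define h where "h s = coboundary T \<nu> \<gamma> s - coboundary T \<nu> \<beta> s" for s
  have var: "2 * (\<Sum>s\<in>P. g s * h s) \<le> l * (\<Sum>s\<in>P. (h s)\<^sup>2)" if l: "0 < l" "l \<le> 1" for l
  proof -
    let ?b = "\<lambda>d. (1 - l) * \<beta> d + l * \<gamma> d"
    have "?b d \<in> (if d \<in> E then {- c..c} else {0})" for d
    proof (cases "d \<in> E")
      case True
      then have "\<beta> d \<in> {- c..c}" "\<gamma> d \<in> {- c..c}" using flow_boxD(1) b(1) \<gamma> by blast+
      then have "(1 - l) *\<^sub>R \<beta> d + l *\<^sub>R \<gamma> d \<in> {- c..c}"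
        using l convexD[OF convex_real_interval(5)[of "- c" c], of "\<beta> d" "\<gamma> d" "1 - l" l] by simp
      then show ?thesis using True by simp
    next
      case False
      then show ?thesis using flow_boxD(2)[OF b(1)] flow_boxD(2)[OF \<gamma>] by simp
    qed
    then have "?b \<in> flow_box c" by (simp add: flow_box_def)
    then have "J \<beta> \<le> J ?b" by (rule b(2))
    also have "J ?b = (\<Sum>s\<in>P. (g s - l * h s)\<^sup>2)"
      unfolding J_def coboundary_linear by (intro sum.cong) (auto simp: g_def h_def algebra_simps)
    also have "\<dots> = (\<Sum>s\<in>P. (g s)\<^sup>2 - 2 * l * (g s * h s) + l\<^sup>2 * (h s)\<^sup>2)"
      by (intro sum.cong) (auto simp: power2_eq_square algebra_simps)
    also have "\<dots> = (\<Sum>s\<in>P. (g s)\<^sup>2) - 2 * l * (\<Sum>s\<in>P. g s * h s) + l\<^sup>2 * (\<Sum>s\<in>P. (h s)\<^sup>2)"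
      by (simp add: sum.distrib sum_subtractf sum_distrib_left)
    also have "(\<Sum>s\<in>P. (g s)\<^sup>2) = J \<beta>" unfolding J_def by (intro sum.cong) (auto simp: g_def)
    finally have "l * (2 * (\<Sum>s\<in>P. g s * h s)) \<le> l * (l * (\<Sum>s\<in>P. (h s)\<^sup>2))"
      by (simp add: power2_eq_square algebra_simps)
    then show ?thesis using l by simp
  qed
  have gh: "(\<Sum>s\<in>P. g s * h s) \<le> 0"
  proof (rule ccontr)
    let ?X = "\<Sum>s\<in>P. g s * h s" and ?Y = "\<Sum>s\<in>P. (h s)\<^sup>2"
    assume n: "\<not> ?X \<le> 0"
    have Y: "?Y \<ge> 0" by (simp add: sum_nonneg)
    define l where "l = min 1 (?X / (?Y + 1))"
    have l: "0 < l" "l \<le> 1" using n Y by (auto simp: l_def)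
    have "l * ?Y \<le> ?X / (?Y + 1) * ?Y" using Y by (intro mult_right_mono) (auto simp: l_def)
    also have "\<dots> \<le> ?X" using n Y by (simp add: field_simps)
    finally show False using var[OF l] n by simp
  qed
  have "(\<Sum>s\<in>P. g s * \<alpha> s) \<le> c * (\<Sum>d\<in>F. \<bar>g (pos d) - g (neg d)\<bar>)"
    using F by (intro coarea cut P) (auto simp: F_def g_def)
  also have "\<dots> = (\<Sum>d\<in>F. \<gamma> d * (g (pos d) - g (neg d)))"
    by (simp add: sum_distrib_left \<gamma>_def abs_sgn mult.assoc mult.commute[of "sgn _"])
  also have "\<dots> = (\<Sum>d\<in>F. \<gamma> d * ((if pos d \<in> P then g (pos d) else 0) - (if neg d \<in> P then g (neg d) else 0)))"
    by (intro sum.cong) (auto simp: g_def)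
  also have "\<dots> = (\<Sum>s\<in>P. g s * coboundary T \<nu> \<gamma> s)"
    using F by (intro summation_by_parts[symmetric] P) (auto simp: F_def)
  also have "\<dots> = (\<Sum>s\<in>P. g s * coboundary T \<nu> \<beta> s) + (\<Sum>s\<in>P. g s * h s)"
    unfolding sum.distrib[symmetric] by (intro sum.cong) (auto simp: h_def algebra_simps)
  finally have "(\<Sum>s\<in>P. g s * \<alpha> s) - (\<Sum>s\<in>P. g s * coboundary T \<nu> \<beta> s) \<le> 0" using gh by simp
  also have "(\<Sum>s\<in>P. g s * \<alpha> s) - (\<Sum>s\<in>P. g s * coboundary T \<nu> \<beta> s) = (\<Sum>s\<in>P. (g s)\<^sup>2)"
    unfolding sum_subtractf[symmetric] by (intro sum.cong) (auto simp: g_def power2_eq_square algebra_simps)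
  finally have "(\<Sum>s\<in>P. (g s)\<^sup>2) = 0" by (intro antisym sum_nonneg) auto
  then have "\<forall>s\<in>P. (g s)\<^sup>2 = 0" using P(1) by (subst (asm) sum_nonneg_eq_0_iff) auto
  then have "\<forall>s\<in>P. coboundary T \<nu> \<beta> s = \<alpha> s" by (simp add: g_def)
  then show ?thesis using b(1) by blast
qed

text \<open>
  The flows that are correct on a given tile form a closed subset of a compact space, and finitely many
  of these sets have a common point by the result for patches.
\<close>

theorem max_flow_min_cut:
  assumes c: "c \<ge> 0"
    and cut: "\<And>P. finite P \<Longrightarrow> P \<subseteq> V \<Longrightarrow> \<bar>\<Sum>s\<in>P. \<alpha> s\<bar> \<le> c * real (card (bdry P))"
  shows "\<exists>\<beta>. (\<forall>d. \<bar>\<beta> d\<bar> \<le> c) \<and> (\<forall>d. d \<notin> E \<longrightarrow> \<beta> d = 0) \<and> (\<forall>s\<in>V. coboundary T \<nu> \<beta> s = \<alpha> s)"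
proof -
  define C where "C s = {\<beta>. coboundary T \<nu> \<beta> s = \<alpha> s}" for s
  have "flow_box c \<inter> \<Inter>(C ` V) \<noteq> {}"
  proof (rule compact_imp_fip[OF compact_flow_box])
    fix A assume "A \<in> C ` V"
    then obtain s where "A = C s" by blast
    then show "closed A" unfolding C_def
      by (simp add: closed_Collect_eq continuous_coboundary)
  next
    fix \<F> assume "finite \<F>" "\<F> \<subseteq> C ` V"
    then obtain P where P: "finite P" "P \<subseteq> V" "\<F> = C ` P" by (metis finite_subset_image)
    obtain \<beta> where "\<beta> \<in> flow_box c" "\<forall>s\<in>P. coboundary T \<nu> \<beta> s = \<alpha> s"
      using flow_on_patch[OF c cut P(1,2)] by blast
    then have "\<beta> \<in> flow_box c \<inter> \<Inter>\<F>" using P(3) by (auto simp: C_def)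
    then show "flow_box c \<inter> \<Inter>\<F> \<noteq> {}" by blast
  qed
  then obtain \<beta> where b: "\<beta> \<in> flow_box c" "\<forall>s\<in>V. coboundary T \<nu> \<beta> s = \<alpha> s"
    by (auto simp: C_def)
  have "\<bar>\<beta> d\<bar> \<le> c" for d
    using flow_boxD[OF b(1), of d] c by (cases "d \<in> E") (auto simp: abs_le_iff)
  moreover have "\<forall>d. d \<notin> E \<longrightarrow> \<beta> d = 0" using flow_boxD(2)[OF b(1)] by blast
  ultimately show ?thesis using b(2) by blast
qed

end

section \<open>From flows to couplings of tiles\<close>

context flc_tiling
begin

text \<open>
  Strong pattern equivariance of a function of sets, in the normal form with a translation vector.  Sets that
  are not cells need no exception, because the functions of interest vanish there.
\<close>

definition PE_cells :: "('a set \<Rightarrow> real) \<Rightarrow> bool" where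
  "PE_cells \<alpha> \<longleftrightarrow> (\<exists>R>0. \<forall>c x w. x \<in> c \<longrightarrow> same_pattern T R x (x + w) \<longrightarrow> \<alpha> (shift w c) = \<alpha> c)"

text \<open>
  Strong pattern equivariance of a function of pairs, relative to the pattern around the first set.
\<close>

definition PE_kernel :: "('a set \<Rightarrow> 'a set \<Rightarrow> real) \<Rightarrow> bool" where
  "PE_kernel \<phi> \<longleftrightarrow> (\<exists>R>0. \<forall>s u x w. x \<in> s \<longrightarrow> same_pattern T R x (x + w) \<longrightarrow>
     \<phi> (shift w s) (shift w u) = \<phi> s u)"

definition ranged :: "real \<Rightarrow> ('a set \<Rightarrow> 'a set \<Rightarrow> real) \<Rightarrow> bool" where
  "ranged r \<phi> \<longleftrightarrow> (\<forall>s u. \<phi> s u \<noteq> 0 \<longrightarrow> s \<in> V \<and> u \<in> V \<and> (\<forall>x\<in>s. \<forall>y\<in>u. dist x y \<le> r))"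

lemma rangedD:
  assumes "ranged r \<phi>" "\<phi> s u \<noteq> 0"
  shows "s \<in> V" "u \<in> V" "x \<in> s \<Longrightarrow> y \<in> u \<Longrightarrow> dist x y \<le> r"
  using assms unfolding ranged_def by blast+

text \<open>
  Whether a set is a cell is not asked for on the right: if neither \<open>c\<close> nor its translate is a cell, then both
  values are 0, and if only one of them is, then the condition can be read in the opposite direction.
\<close>

lemma strongly_PE_cochain_iff:
  "strongly_PE_cochain T k \<alpha> \<longleftrightarrow> cochain T k \<alpha> \<and> PE_cells \<alpha>"
proof (intro iffI conjI)
  assume s: "strongly_PE_cochain T k \<alpha>"
  then show co: "cochain T k \<alpha>" by (simp add: strongly_PE_cochain_def)
  obtain R where R: "R > 0" "\<And>c x y. c \<in> cells T k \<Longrightarrow> x \<in> c \<Longrightarrow> same_pattern T R x y \<Longrightarrow>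
      \<alpha> c = \<alpha> (shift (y - x) c)"
    using s unfolding strongly_PE_cochain_def shift_def by blast
  have "\<alpha> (shift w c) = \<alpha> c" if x: "x \<in> c" and sp: "same_pattern T R x (x + w)" for c x w
  proof (cases "c \<in> cells T k \<or> shift w c \<in> cells T k")
    case True
    then show ?thesis
    proof
      assume "c \<in> cells T k"
      then show ?thesis using R(2)[of c x "x + w"] x sp by simp
    next
      assume "shift w c \<in> cells T k"
      then show ?thesis using R(2)[of "shift w c" "x + w" x] x same_pattern_sym[OF sp] by simp
    qed
  next
    case False
    then show ?thesis using co by (simp add: cochain_def)
  qed
  then show "PE_cells \<alpha>" unfolding PE_cells_def using R(1) by blast
next
  assume a: "cochain T k \<alpha> \<and> PE_cells \<alpha>"
  then obtain R where R: "R > 0" "\<And>c x w. x \<in> c \<Longrightarrow> same_pattern T R x (x + w) \<Longrightarrow> \<alpha> (shift w c) = \<alpha> c"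
    unfolding PE_cells_def by blast
  have "\<alpha> c = \<alpha> (shift (y - x) c)" if "x \<in> c" "same_pattern T R x y" for c x y
    using R(2)[of x c "y - x"] that by simp
  then show "strongly_PE_cochain T k \<alpha>"
    using a R(1) unfolding strongly_PE_cochain_def shift_def by blast
qed

text \<open>
  Both tiles at the facet are visible from every point \<open>z\<close> of it.
\<close>

lemma facet_pattern:
  assumes d: "d \<in> E" and z: "z \<in> d" and sp: "same_pattern T R z (z + w)" and R: "R \<ge> 0"
  shows "shift w d \<in> E" "pos (shift w d) = shift w (pos d)" "neg (shift w d) = shift w (neg d)"
    and "\<nu> (shift w d) = \<nu> d"
    and "incidence \<nu> (shift w s) (shift w d) = incidence \<nu> s d"
proof -
  note pn = pos_neg[OF d]
  have "pos d \<inter> cball z R \<noteq> {}" "neg d \<inter> cball z R \<noteq> {}"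
    using z R facet_subset[OF pn(2)] facet_subset[OF pn(5)] by (force simp: disjoint_iff)+
  then have V: "shift w (pos d) \<in> V" "shift w (neg d) \<in> V" using tile_shift[OF sp] pn by auto
  have f: "shift w d facet_of shift w (pos d)" "shift w d facet_of shift w (neg d)"
    using facet_shift pn by auto
  show E': "shift w d \<in> E" using facet_in_E V f by blast
  show nu: "\<nu> (shift w d) = \<nu> d" by (rule normal_shift[OF d E'])
  have inc: "incidence \<nu> (shift w s) (shift w d) = incidence \<nu> s d" for s
  proof -
    have "(\<forall>p\<in>shift w s. \<forall>q\<in>shift w d. \<nu> d \<bullet> p \<le> \<nu> d \<bullet> q) \<longleftrightarrow> (\<forall>p\<in>s. \<forall>q\<in>d. \<nu> d \<bullet> p \<le> \<nu> d \<bullet> q)"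
      unfolding shift_def by (simp add: inner_add_right)
    then show ?thesis unfolding incidence_def nu by simp
  qed
  then show "incidence \<nu> (shift w s) (shift w d) = incidence \<nu> s d" .
  show "pos (shift w d) = shift w (pos d)" using V f pn inc by (intro pos_eqI) auto
  show "neg (shift w d) = shift w (neg d)" using V f pn inc by (intro neg_eqI) auto
qed

lemma facets_shift: "{d. d facet_of shift w s} = shift w ` {d. d facet_of s}"
proof (intro equalityI subsetI)
  fix d assume "d \<in> {d. d facet_of shift w s}"
  then have "shift (- w) d facet_of shift (- w) (shift w s)" using facet_shift by blast
  then have "shift (- w) d \<in> {d. d facet_of s}" by simp
  moreover have "d = shift w (shift (- w) d)" by simp
  ultimately show "d \<in> shift w ` {d. d facet_of s}" by blast
qed (use facet_shift in blast)

lemma coboundary_shift: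
  assumes u: "u \<in> V" "shift w u \<in> V"
    and d: "\<And>d. d facet_of u \<Longrightarrow> incidence \<nu> (shift w u) (shift w d) = incidence \<nu> u d \<and> G (shift w d) = F d"
  shows "coboundary T \<nu> G (shift w u) = coboundary T \<nu> F u"
proof -
  have "inj_on (shift w) {d. d facet_of u}" by (auto simp: inj_on_def)
  then have "coboundary T \<nu> G (shift w u) = (\<Sum>d | d facet_of u. incidence \<nu> (shift w u) (shift w d) * G (shift w d))"
    unfolding coboundary_tile[OF u(2)] facets_shift by (simp add: sum.reindex)
  also have "\<dots> = coboundary T \<nu> F u"
    unfolding coboundary_tile[OF u(1)] using d by (intro sum.cong) auto
  finally show ?thesis .
qed

lemma PE_cells_coboundary:
  assumes "PE_cells \<beta>"
  shows "PE_cells (coboundary T \<nu> \<beta>)"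
proof -
  obtain R where R: "R > 0" "\<And>c x w. x \<in> c \<Longrightarrow> same_pattern T R x (x + w) \<Longrightarrow> \<beta> (shift w c) = \<beta> c"
    using assms unfolding PE_cells_def by blast
  have "coboundary T \<nu> \<beta> (shift w c) = coboundary T \<nu> \<beta> c"
    if x: "x \<in> c" and sp: "same_pattern T (R + D) x (x + w)" for c x w
  proof (cases "c \<in> V")
    case True
    have "c \<inter> cball x (R + D) \<noteq> {}" using x R(1) D_pos by force
    then have V': "shift w c \<in> V" using tile_shift[OF sp] True by blast
    show ?thesis
    proof (rule coboundary_shift[OF True V'])
      fix d assume d: "d facet_of c"
      have dE: "d \<in> E" using facet_in_E[OF True d] .
      obtain z where z: "z \<in> d" using facet_nonempty[OF dE] by blast
      have "dist x z \<le> D" using D_dist[OF True x] facet_subset[OF d] z by blast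
      then have "same_pattern T R z (z + w)" using same_pattern_shift[OF sp] by simp
      then show "incidence \<nu> (shift w c) (shift w d) = incidence \<nu> c d \<and> \<beta> (shift w d) = \<beta> d"
        using R facet_pattern(5)[OF dE z] z by auto
    qed
  next
    case False
    have "x + w \<in> shift w c \<inter> cball (x + w) (R + D)" using x R(1) D_pos by simp
    then have "shift w c \<inter> cball (x + w) (R + D) \<noteq> {}" by blast
    then have "shift w c \<notin> V"
      using tile_shift[OF same_pattern_back[OF sp], of "shift w c"] False by auto
    then show ?thesis using False by (simp add: coboundary_nontile)
  qed
  then show ?thesis unfolding PE_cells_def using R(1) D_pos by (intro exI[of _ "R + D"]) auto
qed

lemma PE_cells_add: "PE_cells \<alpha> \<Longrightarrow> PE_cells \<beta> \<Longrightarrow> PE_cells (\<lambda>c. x * \<alpha> c + y * \<beta> c)"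
proof -
  assume "PE_cells \<alpha>" "PE_cells \<beta>"
  then obtain R R' where R: "R > 0" "\<And>c x w. x \<in> c \<Longrightarrow> same_pattern T R x (x + w) \<Longrightarrow> \<alpha> (shift w c) = \<alpha> c"
    and R': "R' > 0" "\<And>c x w. x \<in> c \<Longrightarrow> same_pattern T R' x (x + w) \<Longrightarrow> \<beta> (shift w c) = \<beta> c"
    unfolding PE_cells_def by metis
  have "x * \<alpha> (shift w c) + y * \<beta> (shift w c) = x * \<alpha> c + y * \<beta> c"
    if "p \<in> c" "same_pattern T (max R R') p (p + w)" for p c w
    using R(2)[OF that(1) same_pattern_mono[OF that(2)]] R'(2)[OF that(1) same_pattern_mono[OF that(2)]] by simp
  then show ?thesis unfolding PE_cells_def using R(1) by (intro exI[of _ "max R R'"]) auto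
qed

text \<open>
  It suffices to compare pairs with \<open>\<phi> s u \<noteq> 0\<close>: if the value vanishes at one pair but not at its translate,
  then exchanging the two pairs gives a contradiction.
\<close>

lemma PE_kernelI:
  assumes r: "ranged r \<phi>" and R: "R > 0"
    and eq: "\<And>s u x w. s \<in> V \<Longrightarrow> u \<in> V \<Longrightarrow> x \<in> s \<Longrightarrow> \<phi> s u \<noteq> 0 \<Longrightarrow> (\<And>y. y \<in> u \<Longrightarrow> dist x y \<le> r) \<Longrightarrow>
      same_pattern T R x (x + w) \<Longrightarrow> shift w s \<in> V \<Longrightarrow> shift w u \<in> V \<Longrightarrow>
      \<phi> (shift w s) (shift w u) = \<phi> s u"
  shows "PE_kernel \<phi>"
proof -
  define R' where "R' = max R r"
  have main: "\<phi> (shift w s) (shift w u) = \<phi> s u"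
    if x: "x \<in> s" and sp: "same_pattern T R' x (x + w)" and nz: "\<phi> s u \<noteq> 0" for s u x w
  proof -
    have V: "s \<in> V" "u \<in> V" and dst: "\<And>y. y \<in> u \<Longrightarrow> dist x y \<le> r" using rangedD[OF r nz] x by auto
    obtain y where y: "y \<in> u" using tile_nonempty[OF V(2)] by blast
    have "s \<inter> cball x R' \<noteq> {}" using x R by (force simp: R'_def)
    moreover have "u \<inter> cball x R' \<noteq> {}" using y dst[OF y] by (force simp: R'_def)
    ultimately have "shift w s \<in> V" "shift w u \<in> V" using tile_shift[OF sp] V by auto
    then show ?thesis
      using eq[OF V x nz dst] same_pattern_mono[OF sp, of R] by (simp add: R'_def)
  qed
  have "\<phi> (shift w s) (shift w u) = \<phi> s u" if x: "x \<in> s" and sp: "same_pattern T R' x (x + w)" for s u x w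
  proof (cases "\<phi> (shift w s) (shift w u) = 0")
    case True
    then show ?thesis using main[OF x sp, of u] by force
  next
    case False
    then show ?thesis using main[of "x + w" "shift w s" "- w" "shift w u"] same_pattern_back[OF sp] x by simp
  qed
  moreover have "R' > 0" using R by (simp add: R'_def)
  ultimately show ?thesis unfolding PE_kernel_def by blast
qed

lemma facet_count: "\<exists>K::nat. \<forall>s\<in>V. card {d. d facet_of s} \<le> K"
proof -
  have "card {d. d facet_of s} = card {d. d facet_of norm_tile s}" for s
  proof -
    have "inj_on (shift (- ref s)) {d. d facet_of s}" by (auto simp: inj_on_def)
    then show ?thesis unfolding norm_tile_def facets_shift by (simp add: card_image)
  qed
  then have "(\<lambda>s. card {d. d facet_of s}) ` V = (\<lambda>N. card {d. d facet_of N}) ` norm_tile ` V"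
    by (force simp: image_image)
  then have "finite ((\<lambda>s. card {d. d facet_of s}) ` V)" using finite_norm_tiles by simp
  then have "\<forall>s\<in>V. card {d. d facet_of s} \<le> Max ((\<lambda>s. card {d. d facet_of s}) ` V)" by auto
  then show ?thesis by blast
qed

definition K :: nat where "K = (SOME K. \<forall>s\<in>V. card {d. d facet_of s} \<le> K)"

lemma card_facets: "s \<in> V \<Longrightarrow> card {d. d facet_of s} \<le> K"
  using someI_ex[OF facet_count] unfolding K_def by blast

lemma coboundary_bound:
  assumes "\<And>d. d \<in> E \<Longrightarrow> \<bar>\<beta> d\<bar> \<le> c" "c \<ge> 0"
  shows "\<bar>coboundary T \<nu> \<beta> s\<bar> \<le> real K * c"
proof (cases "s \<in> V")
  case True
  have "\<bar>coboundary T \<nu> \<beta> s\<bar> \<le> (\<Sum>d | d facet_of s. \<bar>incidence \<nu> s d * \<beta> d\<bar>)"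
    unfolding coboundary_tile[OF True] by (rule sum_abs)
  also have "\<dots> \<le> (\<Sum>d | d facet_of s. c)"
    using assms(1) facet_in_E[OF True] by (intro sum_mono) (auto simp: incidence_def abs_mult)
  also have "\<dots> \<le> real K * c"
    using card_facets[OF True] assms(2) by (simp add: mult_right_mono)
  finally show ?thesis .
next
  case False
  then show ?thesis using assms(2) by (simp add: coboundary_nontile)
qed

text \<open>
  Couplings of the masses \<open>a\<close> and \<open>b\<close> of tiles with bounded range.  The sums are over the supports, which
  are finite by the bound on the range.
\<close>

definition coupling :: "real \<Rightarrow> ('a set \<Rightarrow> real) \<Rightarrow> ('a set \<Rightarrow> real) \<Rightarrow> ('a set \<Rightarrow> 'a set \<Rightarrow> real) \<Rightarrow> bool" where
  "coupling r a b \<phi> \<longleftrightarrow> ranged r \<phi> \<and> (\<forall>s u. 0 \<le> \<phi> s u) \<and>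
     (\<forall>s\<in>V. (\<Sum>u | \<phi> s u \<noteq> 0. \<phi> s u) = a s) \<and> (\<forall>u\<in>V. (\<Sum>s | \<phi> s u \<noteq> 0. \<phi> s u) = b u)"

definition mix :: "('a set \<Rightarrow> real) \<Rightarrow> ('a set \<Rightarrow> real) \<Rightarrow> real \<Rightarrow> 'a set \<Rightarrow> real" where
  "mix a b t s = (1 - t) * a s + t * b s"

text \<open>
  The upwind scheme: the flow \<open>\<beta>\<close> through a facet carries along the substance \<open>p\<close> of the tile that it comes from,
  in the proportion \<open>p / a\<close> in which this substance is present there.
\<close>

definition upwind :: "('a set \<Rightarrow> real) \<Rightarrow> ('a set \<Rightarrow> real) \<Rightarrow> ('a set \<Rightarrow> real) \<Rightarrow> 'a set \<Rightarrow> real" where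
  "upwind \<beta> a p d = (if d \<in> E then max 0 (\<beta> d) * p (pos d) / a (pos d) - max 0 (- \<beta> d) * p (neg d) / a (neg d) else 0)"

text \<open>
  Row \<open>s\<close> of \<open>\<phi>\<close> is the distribution of the mass that started in tile \<open>s\<close>.
\<close>

definition upwind_step :: "real \<Rightarrow> ('a set \<Rightarrow> real) \<Rightarrow> ('a set \<Rightarrow> real) \<Rightarrow> ('a set \<Rightarrow> 'a set \<Rightarrow> real) \<Rightarrow>
    'a set \<Rightarrow> 'a set \<Rightarrow> real" where
  "upwind_step h \<beta> a \<phi> s u = \<phi> s u - h * coboundary T \<nu> (upwind \<beta> a (\<phi> s)) u"

text \<open>
  A flow from \<open>a\<close> to \<open>b\<close> is carried out in \<open>N\<close> equal steps.  After \<open>k\<close> of them the masses of the tiles are the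
  interpolations \<open>mix a b (k / N)\<close>.
\<close>

primrec advect :: "nat \<Rightarrow> ('a set \<Rightarrow> real) \<Rightarrow> ('a set \<Rightarrow> real) \<Rightarrow> ('a set \<Rightarrow> real) \<Rightarrow> nat \<Rightarrow>
    'a set \<Rightarrow> 'a set \<Rightarrow> real" where
  "advect N a b \<beta> 0 = (\<lambda>s u. if s = u \<and> s \<in> V then a s else 0)"
| "advect N a b \<beta> (Suc k) = upwind_step (1 / N) \<beta> (mix a b (k / N)) (advect N a b \<beta> k)"

lemma upwind_nonzero:
  assumes r: "ranged r \<phi>" and nz: "upwind \<beta> a (\<phi> s) d \<noteq> 0"
  shows "d \<in> E" "s \<in> V" "x \<in> s \<Longrightarrow> z \<in> d \<Longrightarrow> dist x z \<le> r"
proof -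
  show d: "d \<in> E" using nz by (auto simp: upwind_def split: if_splits)
  have "\<phi> s (pos d) \<noteq> 0 \<or> \<phi> s (neg d) \<noteq> 0" using nz by (auto simp: upwind_def split: if_splits)
  then show "s \<in> V" "x \<in> s \<Longrightarrow> z \<in> d \<Longrightarrow> dist x z \<le> r"
    using rangedD[OF r] facet_subset pos_neg[OF d] by blast+
qed

lemma ranged_upwind_step:
  assumes r: "ranged r \<phi>"
  shows "ranged (r + D) (upwind_step h \<beta> a \<phi>)"
  unfolding ranged_def
proof (intro allI impI)
  fix s u assume nz: "upwind_step h \<beta> a \<phi> s u \<noteq> 0"
  show "s \<in> V \<and> u \<in> V \<and> (\<forall>x\<in>s. \<forall>y\<in>u. dist x y \<le> r + D)"
  proof (cases "\<phi> s u = 0")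
    case False
    then show ?thesis using rangedD[OF r False] D_pos by fastforce
  next
    case True
    then have c: "coboundary T \<nu> (upwind \<beta> a (\<phi> s)) u \<noteq> 0" using nz by (auto simp: upwind_step_def)
    then have u: "u \<in> V" using coboundary_nontile by blast
    then obtain d where d: "d facet_of u" "upwind \<beta> a (\<phi> s) d \<noteq> 0"
      using c by (metis (no_types, lifting) coboundary_tile mem_Collect_eq mult_zero_right sum.neutral)
    note un = upwind_nonzero[OF r d(2)]
    obtain z where z: "z \<in> d" using facet_nonempty[OF un(1)] by blast
    have "dist x y \<le> r + D" if "x \<in> s" "y \<in> u" for x y
      using un(3)[OF that(1) z] D_dist[OF u _ that(2), of z] facet_subset[OF d(1)] z dist_triangle[of x y z] by auto
    then show ?thesis using u un(2) by blast
  qed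
qed

lemma ranged_advect: "ranged (D * (k + 1)) (advect N a b \<beta> k)"
proof (induction k)
  case 0
  then show ?case using D_dist by (auto simp: ranged_def split: if_splits)
next
  case (Suc k)
  then show ?case using ranged_upwind_step[OF Suc] by (simp add: algebra_simps)
qed

text \<open>
  Only facets at distance at most \<open>r + D\<close> from \<open>s\<close> take part in the step.
\<close>

lemma PE_kernel_upwind_step:
  assumes r: "ranged r \<phi>" and a: "PE_cells a" and \<beta>: "PE_cells \<beta>" and \<phi>: "PE_kernel \<phi>"
  shows "PE_kernel (upwind_step h \<beta> a \<phi>)"
proof -
  obtain Ra where Ra: "Ra > 0" "\<And>c x w. x \<in> c \<Longrightarrow> same_pattern T Ra x (x + w) \<Longrightarrow> a (shift w c) = a c"
    using a unfolding PE_cells_def by blast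
  obtain Rb where Rb: "Rb > 0" "\<And>c x w. x \<in> c \<Longrightarrow> same_pattern T Rb x (x + w) \<Longrightarrow> \<beta> (shift w c) = \<beta> c"
    using \<beta> unfolding PE_cells_def by blast
  obtain Rp where Rp: "Rp > 0" "\<And>s u x w. x \<in> s \<Longrightarrow> same_pattern T Rp x (x + w) \<Longrightarrow> \<phi> (shift w s) (shift w u) = \<phi> s u"
    using \<phi> unfolding PE_kernel_def by blast
  define R where "R = Ra + Rb + Rp + \<bar>r\<bar> + D"
  have R: "R > 0" using Ra Rb Rp D_pos by (simp add: R_def)
  show ?thesis
  proof (rule PE_kernelI[OF ranged_upwind_step[OF r] R])
    fix s u x w
    assume V: "s \<in> V" "u \<in> V" and x: "x \<in> s" and dst: "\<And>y. y \<in> u \<Longrightarrow> dist x y \<le> r + D"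
      and sp: "same_pattern T R x (x + w)" and V': "shift w s \<in> V" "shift w u \<in> V"
    have p: "same_pattern T Rp x (x + w)" using same_pattern_mono[OF sp] Ra Rb D_pos by (simp add: R_def)
    have "coboundary T \<nu> (upwind \<beta> a (\<phi> (shift w s))) (shift w u) = coboundary T \<nu> (upwind \<beta> a (\<phi> s)) u"
    proof (rule coboundary_shift[OF V(2) V'(2)])
      fix d assume d: "d facet_of u"
      have dE: "d \<in> E" using facet_in_E[OF V(2) d] .
      obtain z where z: "z \<in> d" using facet_nonempty[OF dE] by blast
      have "dist x z \<le> r + D" using dst facet_subset[OF d] z by blast
      then have spz: "same_pattern T (Ra + Rb) z (z + w)"
        using same_pattern_shift[OF sp, of z "Ra + Rb"] Rp(1) by (simp add: R_def)
      have pa: "same_pattern T Ra z (z + w)" and pb: "same_pattern T Rb z (z + w)"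
        using same_pattern_mono[OF spz] Ra(1) Rb(1) by auto
      note fp = facet_pattern[OF dE z pa less_imp_le[OF Ra(1)]]
      have zz: "z \<in> pos d" "z \<in> neg d" using pos_neg[OF dE] facet_subset z by blast+
      have "upwind \<beta> a (\<phi> (shift w s)) (shift w d) = upwind \<beta> a (\<phi> s) d"
        unfolding upwind_def fp(2,3)
        using dE fp(1) Ra(2)[OF zz(1) pa] Ra(2)[OF zz(2) pa] Rb(2)[OF z pb] Rp(2)[OF x p] by simp
      then show "incidence \<nu> (shift w u) (shift w d) = incidence \<nu> u d \<and>
          upwind \<beta> a (\<phi> (shift w s)) (shift w d) = upwind \<beta> a (\<phi> s) d"
        using fp(5) by blast
    qed
    then show "upwind_step h \<beta> a \<phi> (shift w s) (shift w u) = upwind_step h \<beta> a \<phi> s u"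
      by (simp add: upwind_step_def Rp(2)[OF x p])
  qed
qed

lemma PE_kernel_advect:
  assumes a: "PE_cells a" and b: "PE_cells b" and \<beta>: "PE_cells \<beta>"
  shows "PE_kernel (advect N a b \<beta> k)"
proof (induction k)
  case 0
  obtain Ra where Ra: "Ra > 0" "\<And>c x w. x \<in> c \<Longrightarrow> same_pattern T Ra x (x + w) \<Longrightarrow> a (shift w c) = a c"
    using a unfolding PE_cells_def by blast
  show ?case
    by (rule PE_kernelI[OF ranged_advect Ra(1)]) (auto simp: Ra(2))
next
  case (Suc k)
  have "PE_cells (mix a b (k / N))" unfolding mix_def by (rule PE_cells_add[OF a b])
  then show ?case using PE_kernel_upwind_step[OF ranged_advect _ \<beta> Suc] by simp
qed

text \<open>
  Difference estimate for the product of flow and concentration.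
\<close>

lemma upwind_close:
  assumes m: "m > 0" "\<And>s. s \<in> V \<Longrightarrow> m \<le> a s"
    and M: "\<And>d. d \<in> E \<Longrightarrow> \<bar>\<beta> d\<bar> \<le> M" "\<And>d. d \<in> E \<Longrightarrow> \<bar>\<beta>' d\<bar> \<le> M" "M \<ge> 0"
    and B: "\<And>u. \<bar>p u\<bar> \<le> B" "\<And>u. \<bar>p' u\<bar> \<le> B" "B \<ge> 0"
    and e: "\<And>d. d \<in> E \<Longrightarrow> \<bar>\<beta> d - \<beta>' d\<bar> \<le> e" "\<And>u. \<bar>p u - p' u\<bar> \<le> f"
    and d: "d \<in> E"
  shows "\<bar>upwind \<beta> a p d - upwind \<beta>' a p' d\<bar> \<le> 2 * (e * B + M * f) / m"
proof -
  have one: "\<bar>x * p u / a u - x' * p' u / a u\<bar> \<le> (e * B + M * f) / m"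
    if u: "u \<in> V" and x: "\<bar>x - x'\<bar> \<le> e" "\<bar>x'\<bar> \<le> M" for x x' u
  proof -
    have "\<bar>x * p u - x' * p' u\<bar> = \<bar>(x - x') * p u + x' * (p u - p' u)\<bar>" by (simp add: algebra_simps)
    also have "\<dots> \<le> \<bar>x - x'\<bar> * \<bar>p u\<bar> + \<bar>x'\<bar> * \<bar>p u - p' u\<bar>"
      unfolding abs_mult[symmetric] by (rule abs_triangle_ineq)
    also have "\<dots> \<le> e * B + M * f"
      using x B(1)[of u] e(2)[of u] M(3) by (intro add_mono mult_mono) auto
    finally have n: "\<bar>x * p u - x' * p' u\<bar> \<le> e * B + M * f" .
    have au: "m \<le> a u" "0 < a u" using m u by force+
    have "\<bar>x * p u / a u - x' * p' u / a u\<bar> = \<bar>x * p u - x' * p' u\<bar> / a u"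
      using au by (simp add: diff_divide_distrib[symmetric])
    also have "\<dots> \<le> (e * B + M * f) / m"
      using n au m(1) by (intro frac_le) auto
    finally show ?thesis .
  qed
  have "\<bar>max 0 (\<beta> d) - max 0 (\<beta>' d)\<bar> \<le> e" "\<bar>max 0 (- \<beta> d) - max 0 (- \<beta>' d)\<bar> \<le> e"
    "\<bar>max 0 (\<beta>' d)\<bar> \<le> M" "\<bar>max 0 (- \<beta>' d)\<bar> \<le> M"
    using e(1)[OF d] M(2)[OF d] by auto
  note * = one[OF pos_V[OF d] this(1,3)] one[OF neg_V[OF d] this(2,4)]
  have tri: "\<bar>(A - A') - (C - C')\<bar> \<le> \<bar>A - C\<bar> + \<bar>A' - C'\<bar>" for A A' C C' :: real by linarith
  have "\<bar>upwind \<beta> a p d - upwind \<beta>' a p' d\<bar> \<le> (e * B + M * f) / m + (e * B + M * f) / m"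
    unfolding upwind_def using d order_trans[OF tri add_mono[OF *]] by simp
  then show ?thesis by (simp add: field_simps)
qed

lemma mix_lower:
  assumes "m \<le> a s" "m \<le> b s" "0 \<le> t" "t \<le> 1"
  shows "m \<le> mix a b t s"
proof -
  have "(1 - t) * m + t * m \<le> (1 - t) * a s + t * b s"
    using assms by (intro add_mono mult_left_mono) auto
  then show ?thesis by (simp add: mix_def algebra_simps)
qed

text \<open>
  The constants do not depend on the flow as long as it is bounded by \<open>M\<close>, so advection preserves uniform
  limits of flows.  This carries weak pattern equivariance from flows to couplings.
\<close>

lemma advect_lipschitz:
  assumes m: "m > 0" "\<And>s. s \<in> V \<Longrightarrow> m \<le> a s" "\<And>s. s \<in> V \<Longrightarrow> m \<le> b s"
    and A: "\<And>s. s \<in> V \<Longrightarrow> \<bar>a s\<bar> \<le> A" "A \<ge> 0" and M: "M \<ge> 0" and k: "k \<le> N"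
  shows "\<exists>B\<ge>0. \<exists>C\<ge>0. \<forall>\<beta> \<beta>' e. (\<forall>d\<in>E. \<bar>\<beta> d\<bar> \<le> M) \<and> (\<forall>d\<in>E. \<bar>\<beta>' d\<bar> \<le> M) \<and> (\<forall>d\<in>E. \<bar>\<beta> d - \<beta>' d\<bar> \<le> e) \<and> e \<ge> 0 \<longrightarrow>
    (\<forall>s u. \<bar>advect N a b \<beta> k s u\<bar> \<le> B) \<and> (\<forall>s u. \<bar>advect N a b \<beta> k s u - advect N a b \<beta>' k s u\<bar> \<le> C * e)"
  using k
proof (induction k)
  case 0
  then show ?case using A by (intro exI[of _ A] exI[of _ 0] conjI) (auto simp: abs_le_iff)
next
  case (Suc k)
  then obtain B C where BC: "B \<ge> 0" "C \<ge> 0"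
    and IH: "\<And>\<beta> \<beta>' e. (\<forall>d\<in>E. \<bar>\<beta> d\<bar> \<le> M) \<Longrightarrow> (\<forall>d\<in>E. \<bar>\<beta>' d\<bar> \<le> M) \<Longrightarrow> (\<forall>d\<in>E. \<bar>\<beta> d - \<beta>' d\<bar> \<le> e) \<Longrightarrow> e \<ge> 0 \<Longrightarrow>
      (\<forall>s u. \<bar>advect N a b \<beta> k s u\<bar> \<le> B) \<and> (\<forall>s u. \<bar>advect N a b \<beta> k s u - advect N a b \<beta>' k s u\<bar> \<le> C * e)"
    by auto
  have N: "N > 0" "k / N \<le> 1" using Suc.prems by auto
  define h where "h = 1 / real N"
  have h: "h > 0" using N by (simp add: h_def)
  define w where "w = mix a b (k / N)"
  have w: "m \<le> w s" if "s \<in> V" for s unfolding w_def using m that N by (intro mix_lower) auto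
  define B' where "B' = B + h * (K * (2 * (M * B + M * B) / m))"
  define C' where "C' = C + h * (K * (2 * (B + M * C) / m))"
  have BC': "B' \<ge> 0" "C' \<ge> 0" using BC h M m(1) by (auto simp: B'_def C'_def)
  have step: "(\<forall>s u. \<bar>advect N a b \<beta> (Suc k) s u\<bar> \<le> B') \<and>
      (\<forall>s u. \<bar>advect N a b \<beta> (Suc k) s u - advect N a b \<beta>' (Suc k) s u\<bar> \<le> C' * e)"
    if b1: "\<forall>d\<in>E. \<bar>\<beta> d\<bar> \<le> M" and b2: "\<forall>d\<in>E. \<bar>\<beta>' d\<bar> \<le> M" and be: "\<forall>d\<in>E. \<bar>\<beta> d - \<beta>' d\<bar> \<le> e" and e: "e \<ge> 0" for \<beta> \<beta>' e
  proof (intro conjI allI)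
    fix s u
    let ?p = "advect N a b \<beta> k s" and ?p' = "advect N a b \<beta>' k s"
    have p: "\<bar>?p u\<bar> \<le> B" and pp: "\<bar>?p u - ?p' u\<bar> \<le> C * e" for u
      using IH[OF b1 b2 be e] by blast+
    have p': "\<bar>?p' u\<bar> \<le> B" for u using IH[OF b2 b2, of 0] by simp
    have z0: "upwind (\<lambda>_. 0) w (\<lambda>_. 0) d = 0" for d by (simp add: upwind_def)
    have "\<bar>upwind \<beta> w ?p d\<bar> \<le> 2 * (M * B + M * B) / m" if "d \<in> E" for d
    proof -
      have "\<bar>upwind \<beta> w ?p d - upwind (\<lambda>_. 0) w (\<lambda>_. 0) d\<bar> \<le> 2 * (M * B + M * B) / m"
        using b1 p M BC that by (intro upwind_close[OF m(1) w]) auto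
      then show ?thesis unfolding z0 by simp
    qed
    then have "\<bar>coboundary T \<nu> (upwind \<beta> w ?p) u\<bar> \<le> K * (2 * (M * B + M * B) / m)"
      using M BC m(1) by (intro coboundary_bound) auto
    then have "h * \<bar>coboundary T \<nu> (upwind \<beta> w ?p) u\<bar> \<le> h * (K * (2 * (M * B + M * B) / m))"
      using h by (intro mult_left_mono) auto
    then show "\<bar>advect N a b \<beta> (Suc k) s u\<bar> \<le> B'"
      using p[of u] h abs_triangle_ineq4[of "?p u" "h * coboundary T \<nu> (upwind \<beta> w ?p) u"]
      by (simp add: upwind_step_def B'_def abs_mult h_def[symmetric] w_def[symmetric])
    have "\<bar>upwind \<beta> w ?p d - upwind \<beta>' w ?p' d\<bar> \<le> 2 * (e * B + M * (C * e)) / m" if "d \<in> E" for d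
      using b1 b2 be that by (intro upwind_close[OF m(1) w _ _ M p p' BC(1) _ pp]) simp_all
    then have "\<bar>coboundary T \<nu> (\<lambda>d. 1 * upwind \<beta> w ?p d + (- 1) * upwind \<beta>' w ?p' d) u\<bar>
        \<le> K * (2 * (e * B + M * (C * e)) / m)"
      using M BC m(1) e by (intro coboundary_bound) auto
    then have "h * \<bar>coboundary T \<nu> (upwind \<beta> w ?p) u - coboundary T \<nu> (upwind \<beta>' w ?p') u\<bar>
        \<le> h * (K * (2 * (e * B + M * (C * e)) / m))"
      unfolding coboundary_linear using h by (intro mult_left_mono) auto
    moreover have "advect N a b \<beta> (Suc k) s u - advect N a b \<beta>' (Suc k) s u =
       (?p u - ?p' u) - h * (coboundary T \<nu> (upwind \<beta> w ?p) u - coboundary T \<nu> (upwind \<beta>' w ?p') u)"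
      by (simp add: upwind_step_def h_def[symmetric] w_def[symmetric] algebra_simps)
    ultimately have "\<bar>advect N a b \<beta> (Suc k) s u - advect N a b \<beta>' (Suc k) s u\<bar> \<le>
        C * e + h * (K * (2 * (e * B + M * (C * e)) / m))"
      using pp[of u] h abs_triangle_ineq4[of "?p u - ?p' u" "h * (coboundary T \<nu> (upwind \<beta> w ?p) u - coboundary T \<nu> (upwind \<beta>' w ?p') u)"]
      by (simp add: abs_mult)
    also have "\<dots> = C' * e" by (simp add: C'_def algebra_simps add_divide_distrib)
    finally show "\<bar>advect N a b \<beta> (Suc k) s u - advect N a b \<beta>' (Suc k) s u\<bar> \<le> C' * e" .
  qed
  show ?case
    by (rule exI[of _ B'], rule conjI[OF BC'(1)], rule exI[of _ C'], rule conjI[OF BC'(2)],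
        intro allI impI, elim conjE, rule step)
qed

lemma ranged_support:
  assumes "ranged r \<phi>"
  shows "x \<in> s \<Longrightarrow> {u. \<phi> s u \<noteq> 0} \<subseteq> near r x" and "y \<in> u \<Longrightarrow> {s. \<phi> s u \<noteq> 0} \<subseteq> near r y"
proof -
  show "{u. \<phi> s u \<noteq> 0} \<subseteq> near r x" if "x \<in> s"
  proof
    fix u assume "u \<in> {u. \<phi> s u \<noteq> 0}"
    then have "u \<in> V" "\<And>y. y \<in> u \<Longrightarrow> dist x y \<le> r" using rangedD[OF assms] that by auto
    then show "u \<in> near r x" using tile_nonempty[of u] by (force simp: near_def)
  qed
  show "{s. \<phi> s u \<noteq> 0} \<subseteq> near r y" if "y \<in> u"
  proof
    fix s assume "s \<in> {s. \<phi> s u \<noteq> 0}"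
    then have "s \<in> V" "\<And>x. x \<in> s \<Longrightarrow> dist x y \<le> r" using rangedD[OF assms] that by auto
    then show "s \<in> near r y" using tile_nonempty[of s] by (force simp: near_def dist_commute)
  qed
qed

lemma sum_support:
  assumes "finite X" "{u. f u \<noteq> (0::real)} \<subseteq> X"
  shows "(\<Sum>u | f u \<noteq> 0. f u) = (\<Sum>u\<in>X. f u)"
  using assms by (intro sum.mono_neutral_left) auto

lemma near_mono: "r \<le> r' \<Longrightarrow> near r x \<subseteq> near r' x"
  by (force simp: near_def)

text \<open>
  Moving substance between tiles preserves the amount of each substance, hence the row sums.  All
  substances together move along \<open>\<beta>\<close>, hence the column sums change by the divergence of \<open>\<beta>\<close>.  The result is
  nonnegative if the step is so small that no tile is asked for more than it contains.
\<close>

lemma coupling_upwind_step: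
  assumes c: "coupling r a w \<phi>" and r: "r \<ge> 0"
    and m: "m > 0" "\<And>s. s \<in> V \<Longrightarrow> m \<le> w s"
    and M: "\<And>d. d \<in> E \<Longrightarrow> \<bar>\<beta> d\<bar> \<le> M" and M0: "M \<ge> 0" and h: "h \<ge> 0" "h * (K * (M / m)) \<le> 1"
    and w': "\<And>s. s \<in> V \<Longrightarrow> w' s = w s - h * coboundary T \<nu> \<beta> s"
  shows "coupling (r + D) a w' (upwind_step h \<beta> w \<phi>)"
proof -
  let ?\<psi> = "upwind_step h \<beta> w \<phi>"
  have rg: "ranged r \<phi>" and nn: "\<And>s u. 0 \<le> \<phi> s u" and row: "\<And>s. s \<in> V \<Longrightarrow> (\<Sum>u | \<phi> s u \<noteq> 0. \<phi> s u) = a s"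
    and col: "\<And>u. u \<in> V \<Longrightarrow> (\<Sum>s | \<phi> s u \<noteq> 0. \<phi> s u) = w u"
    using c by (auto simp: coupling_def)
  have rg': "ranged (r + D) ?\<psi>" by (rule ranged_upwind_step[OF rg])
  have "0 \<le> ?\<psi> s u" for s u
  proof (cases "u \<in> V")
    case True
    have wu: "m \<le> w u" "0 < w u" using m True by force+
    have "incidence \<nu> u d * upwind \<beta> w (\<phi> s) d \<le> M * \<phi> s u / m" if d: "d facet_of u" for d
    proof -
      have dE: "d \<in> E" using facet_in_E[OF True d] .
      note pn = pos_neg[OF dE]
      have t: "0 \<le> x * \<phi> s v / w v" if "v \<in> V" "0 \<le> x" for x v
        using m that nn[of s v] by (force intro!: divide_nonneg_nonneg)
      have b: "x * \<phi> s u / w u \<le> M * \<phi> s u / m" if "x \<le> M" for x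
        using that nn[of s u] wu m(1) M0 by (intro frac_le mult_right_mono mult_nonneg_nonneg) auto
      consider "u = pos d" | "u = neg d" using facet_of_iff[OF dE True] d by blast
      then show ?thesis
      proof cases
        case 1
        have "upwind \<beta> w (\<phi> s) d \<le> max 0 (\<beta> d) * \<phi> s u / w u"
          using t[OF pn(4), of "max 0 (- \<beta> d)"] dE 1 by (simp add: upwind_def)
        also have "\<dots> \<le> M * \<phi> s u / m" using M[OF dE] M0 by (intro b) auto
        finally show ?thesis using 1 pn by simp
      next
        case 2
        have "- upwind \<beta> w (\<phi> s) d \<le> max 0 (- \<beta> d) * \<phi> s u / w u"
          using t[OF pn(1), of "max 0 (\<beta> d)"] dE 2 by (simp add: upwind_def)
        also have "\<dots> \<le> M * \<phi> s u / m" using M[OF dE] M0 by (intro b) auto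
        finally show ?thesis using 2 pn by simp
      qed
    qed
    then have "coboundary T \<nu> (upwind \<beta> w (\<phi> s)) u \<le> card {d. d facet_of u} * (M * \<phi> s u / m)"
      unfolding coboundary_tile[OF True] by (intro sum_bounded_above) simp
    also have "\<dots> \<le> K * (M * \<phi> s u / m)"
      using card_facets[OF True] nn[of s u] m(1) M0 by (intro mult_right_mono) auto
    finally have "h * coboundary T \<nu> (upwind \<beta> w (\<phi> s)) u \<le> h * (K * (M * \<phi> s u / m))"
      using h(1) by (rule mult_left_mono)
    also have "\<dots> = (h * (K * (M / m))) * \<phi> s u" by simp
    also have "\<dots> \<le> 1 * \<phi> s u" using h(2) nn[of s u] by (intro mult_right_mono) auto
    finally show ?thesis by (simp add: upwind_step_def)
  next
    case False
    then show ?thesis using nn by (simp add: upwind_step_def coboundary_nontile)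
  qed
  moreover have "(\<Sum>u | ?\<psi> s u \<noteq> 0. ?\<psi> s u) = a s" if s: "s \<in> V" for s
  proof -
    obtain x where x: "x \<in> s" using tile_nonempty[OF s] by blast
    define X where "X = near (r + D) x"
    have X: "finite X" by (simp add: X_def)
    have XV: "X \<subseteq> V" by (auto simp: X_def near_def)
    have sX: "{u. \<phi> s u \<noteq> 0} \<subseteq> X"
      using ranged_support(1)[OF rg x] near_mono[of r "r + D" x] D_pos by (auto simp: X_def)
    have "(\<Sum>u\<in>X. 1 * coboundary T \<nu> (upwind \<beta> w (\<phi> s)) u) =
        (\<Sum>d\<in>(\<Union>u\<in>X. {d. d facet_of u}). upwind \<beta> w (\<phi> s) d * ((if pos d \<in> X then 1 else 0) - (if neg d \<in> X then 1 else 0)))"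
      using X XV finite_facets facet_in_E by (intro summation_by_parts) auto
    also have "\<dots> = 0"
    proof (rule sum.neutral, rule ballI)
      fix d
      show "upwind \<beta> w (\<phi> s) d * ((if pos d \<in> X then 1 else 0) - (if neg d \<in> X then 1 else 0)) = 0"
      proof (cases "upwind \<beta> w (\<phi> s) d = 0")
        case False
        note un = upwind_nonzero[OF rg False]
        note pn = pos_neg[OF un(1)]
        obtain z where z: "z \<in> d" using facet_nonempty[OF un(1)] by blast
        then have "dist x z \<le> r + D" using un(3)[OF x z] D_pos by simp
        moreover have "z \<in> pos d" "z \<in> neg d" using z facet_subset pn by blast+
        ultimately have "pos d \<in> X" "neg d \<in> X" using pn by (auto simp: X_def near_def)
        then show ?thesis by simp
      qed simp
    qed
    finally have "(\<Sum>u\<in>X. ?\<psi> s u) = (\<Sum>u\<in>X. \<phi> s u)"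
      by (simp add: upwind_step_def sum_subtractf sum_distrib_left[symmetric])
    moreover have "{u. ?\<psi> s u \<noteq> 0} \<subseteq> X" using ranged_support(1)[OF rg' x] by (simp add: X_def)
    ultimately show ?thesis using sum_support[OF X] sX row[OF s] by simp
  qed
  moreover have "(\<Sum>s | ?\<psi> s u \<noteq> 0. ?\<psi> s u) = w' u" if u: "u \<in> V" for u
  proof -
    obtain y where y: "y \<in> u" using tile_nonempty[OF u] by blast
    define X where "X = near (r + D) y"
    have X: "finite X" by (auto simp: X_def)
    have colX: "(\<Sum>s\<in>X. \<phi> s t) = w t" if t: "t \<in> V" "z \<in> t" "z \<in> u" for t z
    proof -
      have "{s. \<phi> s t \<noteq> 0} \<subseteq> near (r + D) y"
      proof
        fix s assume "s \<in> {s. \<phi> s t \<noteq> 0}"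
        then have sz: "s \<in> V" "\<And>x. x \<in> s \<Longrightarrow> dist x z \<le> r" using rangedD[OF rg] t by auto
        obtain x where x: "x \<in> s" using tile_nonempty[OF sz(1)] by blast
        have "dist y x \<le> r + D"
          using sz(2)[OF x] D_dist[OF u y t(3)] dist_triangle[of y x z] by (simp add: dist_commute)
        then show "s \<in> near (r + D) y" using x sz(1) by (auto simp: near_def)
      qed
      then show ?thesis using sum_support[OF X] col[OF t(1)] by (simp add: X_def)
    qed
    have F: "(\<Sum>s\<in>X. upwind \<beta> w (\<phi> s) d) = \<beta> d" if d: "d facet_of u" for d
    proof -
      have dE: "d \<in> E" using facet_in_E[OF u d] .
      note pn = pos_neg[OF dE]
      obtain z where z: "z \<in> d" using facet_nonempty[OF dE] by blast
      then have zz: "z \<in> pos d" "z \<in> neg d" "z \<in> u" using facet_subset pn d by blast+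
      have w0: "w (pos d) > 0" "w (neg d) > 0" using m pn by force+
      have "(\<Sum>s\<in>X. upwind \<beta> w (\<phi> s) d) =
          max 0 (\<beta> d) * (\<Sum>s\<in>X. \<phi> s (pos d)) / w (pos d) - max 0 (- \<beta> d) * (\<Sum>s\<in>X. \<phi> s (neg d)) / w (neg d)"
        using dE by (simp add: upwind_def sum_subtractf sum_distrib_left sum_divide_distrib)
      also have "\<dots> = \<beta> d"
        unfolding colX[OF pn(1) zz(1,3)] colX[OF pn(4) zz(2,3)] using w0 by simp
      finally show ?thesis .
    qed
    have "(\<Sum>s\<in>X. coboundary T \<nu> (upwind \<beta> w (\<phi> s)) u) =
        (\<Sum>d | d facet_of u. incidence \<nu> u d * (\<Sum>s\<in>X. upwind \<beta> w (\<phi> s) d))"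
      unfolding coboundary_tile[OF u] sum_distrib_left by (rule sum.swap)
    also have "\<dots> = coboundary T \<nu> \<beta> u"
      unfolding coboundary_tile[OF u] using F by (intro sum.cong) auto
    finally have "(\<Sum>s\<in>X. ?\<psi> s u) = w' u"
      using colX[OF u y y] w'[OF u] by (simp add: upwind_step_def sum_subtractf sum_distrib_left[symmetric])
    moreover have "{s. ?\<psi> s u \<noteq> 0} \<subseteq> X" using ranged_support(2)[OF rg' y] by (simp add: X_def)
    ultimately show ?thesis using sum_support[OF X] by simp
  qed
  ultimately show ?thesis using rg' unfolding coupling_def by blast
qed

text \<open>
  The interpolated masses never fall below \<open>m\<close>, so the same small step size is admissible throughout.
\<close>

theorem advect_coupling:
  assumes m: "m > 0" "\<And>s. s \<in> V \<Longrightarrow> m \<le> a s" "\<And>s. s \<in> V \<Longrightarrow> m \<le> b s"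
    and M: "\<And>d. d \<in> E \<Longrightarrow> \<bar>\<beta> d\<bar> \<le> M" "M \<ge> 0" and N: "N > 0" "K * (M / m) \<le> N"
    and ab: "\<And>s. s \<in> V \<Longrightarrow> coboundary T \<nu> \<beta> s = a s - b s"
  shows "coupling (D * (N + 1)) a b (advect N a b \<beta> N)"
proof -
  have "coupling (D * (k + 1)) a (mix a b (k / N)) (advect N a b \<beta> k)" if "k \<le> N" for k
    using that
  proof (induction k)
    case 0
    have 1: "{u. (if s = u \<and> s \<in> V then a s else 0) \<noteq> 0} = {s}" if "s \<in> V" for s
      using m that by force
    have 2: "{u. (if u = s \<and> u \<in> V then a u else 0) \<noteq> 0} = {s}" if "s \<in> V" for s
      using m that by force
    have "0 \<le> a s" if "s \<in> V" for s using m that by force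
    then show ?case
      using ranged_advect[of 0 N a b \<beta>] 1 2 by (auto simp: coupling_def mix_def)
  next
    case (Suc k)
    have "coupling (D * (real k + 1) + D) a (mix a b (Suc k / N)) (upwind_step (1 / N) \<beta> (mix a b (k / N)) (advect N a b \<beta> k))"
    proof (rule coupling_upwind_step[OF _ _ m(1) _ M])
      show "coupling (D * (real k + 1)) a (mix a b (k / N)) (advect N a b \<beta> k)"
        using Suc.IH[OF Suc_leD[OF Suc.prems]] by (simp add: add.commute)
      show "0 \<le> D * (real k + 1)" using D_pos by simp
      show "m \<le> mix a b (k / N) s" if "s \<in> V" for s using m that Suc.prems by (intro mix_lower) auto
      have "K * (M / m) / N \<le> 1" using N by (subst divide_le_eq_1_pos) auto
      then show "1 / N * (K * (M / m)) \<le> 1" by (simp only: times_divide_eq_left mult_1)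
      show "mix a b (Suc k / N) s = mix a b (k / N) s - 1 / N * coboundary T \<nu> \<beta> s" if "s \<in> V" for s
        unfolding ab[OF that] mix_def by (simp add: algebra_simps add_divide_distrib)
    qed auto
    then show ?case by (simp add: algebra_simps)
  qed
  from this[of N] show ?thesis using N(1) by (simp add: coupling_def mix_def)
qed

end

section \<open>From couplings of tiles to flows\<close>

context flc_tiling
begin

text \<open>
  A flow of one unit from \<open>s\<close> to \<open>u\<close>, of size at most \<open>B\<close> and supported near \<open>p\<close>.
\<close>

definition joins :: "real \<Rightarrow> 'a \<Rightarrow> real \<Rightarrow> 'a set \<Rightarrow> 'a set \<Rightarrow> ('a set \<Rightarrow> real) \<Rightarrow> bool" where
  "joins B p r s u \<gamma> \<longleftrightarrow>
     (\<forall>d. \<gamma> d \<noteq> 0 \<longrightarrow> d \<in> E \<and> d \<subseteq> cball p r) \<and> (\<forall>d. \<bar>\<gamma> d\<bar> \<le> B) \<and>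
     (\<forall>v\<in>V. coboundary T \<nu> \<gamma> v = of_bool (v = s) - of_bool (v = u))"

text \<open>
  Every step of a path in the dual graph contributes one unit through the facet that it crosses.
\<close>

lemma joins_path:
  assumes "(s, u) \<in> adj (ball p r) ^^ n"
  shows "\<exists>\<gamma>. joins (real n) p (r + D) s u \<gamma>"
  using assms
proof (induction n arbitrary: u)
  case 0
  then show ?case by (intro exI[of _ "\<lambda>_. 0"]) (auto simp: joins_def coboundary_def)
next
  case (Suc n)
  then obtain t where t: "(s, t) \<in> adj (ball p r) ^^ n" "(t, u) \<in> adj (ball p r)" by auto
  obtain \<gamma> where g: "joins (real n) p (r + D) s t \<gamma>" using Suc.IH[OF t(1)] by blast
  define d where "d = t \<inter> u"
  have tu: "t \<in> V" "u \<in> V" "t \<noteq> u" "d facet_of t" "d \<inter> ball p r \<noteq> {}"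
    using t(2) by (auto simp: adj_def d_def)
  have du: "d facet_of u" using shared_facet(2)[OF tu(1,2,3,4)] by (simp add: d_def)
  have dE: "d \<in> E" using facet_in_E tu by blast
  define i where "i = incidence \<nu> t d"
  have i1: "i * i = 1" using incidence_cases[of t d] by (auto simp: i_def)
  have iu: "incidence \<nu> u d = - i"
    using same_side_unique[OF tu(1,4,2) du] tu(3) incidence_cases[of t d] incidence_cases[of u d] by (auto simp: i_def)
  define \<gamma>' where "\<gamma>' e = 1 * \<gamma> e + i * (if e = d then 1 else 0)" for e
  obtain z where z: "z \<in> d" "dist p z < r" using tu(5) by auto
  have "d \<subseteq> cball p (r + D)"
  proof
    fix y assume "y \<in> d"
    then have "dist z y \<le> D" using facet_subset_cball[OF dE z(1)] by auto
    then show "y \<in> cball p (r + D)" using z(2) dist_triangle[of p y z] by auto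
  qed
  then have "\<gamma>' e \<noteq> 0 \<longrightarrow> e \<in> E \<and> e \<subseteq> cball p (r + D)" for e
    using g dE by (cases "e = d") (auto simp: joins_def \<gamma>'_def)
  moreover have "\<bar>\<gamma>' e\<bar> \<le> real (Suc n)" for e
  proof -
    have "\<bar>\<gamma> e\<bar> \<le> real n" using g by (simp add: joins_def)
    moreover have "\<bar>i\<bar> = 1" using incidence_cases[of t d] by (auto simp: i_def)
    ultimately show ?thesis by (auto simp: \<gamma>'_def)
  qed
  moreover have "coboundary T \<nu> \<gamma>' v = of_bool (v = s) - of_bool (v = u)" if v: "v \<in> V" for v
  proof -
    have "coboundary T \<nu> \<gamma>' v = of_bool (v = s) - of_bool (v = t) + i * coboundary T \<nu> (\<lambda>e. if e = d then 1 else 0) v"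
      using g v unfolding \<gamma>'_def coboundary_linear by (simp add: joins_def)
    also have "coboundary T \<nu> (\<lambda>e. if e = d then 1 else 0) v = (if d facet_of v then incidence \<nu> v d else 0)"
      unfolding coboundary_tile[OF v] using finite_facets[OF v] by (simp add: if_distrib[of "(*) _"] cong: if_cong)
    also have "i * (if d facet_of v then incidence \<nu> v d else 0) = of_bool (v = t) - of_bool (v = u)"
    proof -
      have "d facet_of v \<longleftrightarrow> v = t \<or> v = u"
        using facet_of_iff[OF dE v] facet_of_iff[OF dE tu(1)] facet_of_iff[OF dE tu(2)] tu du by blast
      then show ?thesis using tu(3) iu i1 by (auto simp: i_def[symmetric])
    qed
    finally show ?thesis by simp
  qed
  ultimately show ?case unfolding joins_def by blast
qed

text \<open>
  The radius and the size of the joining flows for tiles at distance at most \<open>r\<close>.  A shortest path does not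
  use more steps than there are pairs of adjacent tiles, hence the square.
\<close>

definition reach :: "real \<Rightarrow> real" where "reach r = 2 * D + r + 1"
definition load :: "real \<Rightarrow> real" where "load r = real ((Q (D + r + 1))\<^sup>2)"

lemma joins_exists:
  assumes s: "s \<in> V" and u: "u \<in> V" and r: "r \<ge> 0" "\<And>x y. x \<in> s \<Longrightarrow> y \<in> u \<Longrightarrow> dist x y \<le> r"
  shows "\<exists>\<gamma>. joins (load r) (ref s) (reach r) s u \<gamma>"
proof -
  let ?p = "ref s" and ?q = "D + r + 1"
  obtain x y where xy: "x \<in> s" "y \<in> u" using tile_nonempty s u by blast
  have "dist ?p x \<le> D" using D_ref[OF s xy(1)] by (simp add: dist_commute)
  moreover have "dist ?p y \<le> dist ?p x + dist x y" by (rule dist_triangle)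
  ultimately have "x \<in> ball ?p ?q" "y \<in> ball ?p ?q" using r(1) r(2)[OF xy] by auto
  then have conn: "(s, u) \<in> (adj (ball ?p ?q))\<^sup>*" using xy s u by (intro tiles_connected) auto
  have sub: "adj (ball ?p ?q) \<subseteq> near ?q ?p \<times> near ?q ?p"
    unfolding adj_def near_def using ball_subset_cball by blast
  have fin: "finite (adj (ball ?p ?q))" by (rule finite_subset[OF sub]) simp
  have "card (adj (ball ?p ?q)) \<le> card (near ?q ?p \<times> near ?q ?p)" using sub by (intro card_mono) auto
  also have "\<dots> \<le> Q ?q * Q ?q" unfolding card_cartesian_product by (intro mult_le_mono card_near)
  finally have cd: "real (card (adj (ball ?p ?q))) \<le> load r" by (simp add: load_def power2_eq_square flip: of_nat_mult)
  obtain n where n: "(s, u) \<in> adj (ball ?p ?q) ^^ n" "n \<le> card (adj (ball ?p ?q))"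
    using conn rtrancl_finite_eq_relpow[OF fin] by auto
  obtain \<gamma> where g: "joins (real n) ?p (?q + D) s u \<gamma>" using joins_path[OF n(1)] by blast
  have "\<bar>\<gamma> d\<bar> \<le> load r" for d
  proof -
    have "\<bar>\<gamma> d\<bar> \<le> real n" using g by (simp add: joins_def)
    then show ?thesis using n(2) cd by linarith
  qed
  moreover have "?q + D = reach r" by (simp add: reach_def)
  ultimately have "joins (load r) ?p (reach r) s u \<gamma>" using g by (simp add: joins_def)
  then show ?thesis by blast
qed

text \<open>
  Far from \<open>s\<close> the flow vanishes, and nearby the tiles and incidence numbers are carried along by \<open>w\<close>.
\<close>

lemma joins_shift:
  assumes j: "joins B (ref s) r s u \<gamma>" and s: "s \<in> V" "x \<in> s" and u: "\<And>y. y \<in> u \<Longrightarrow> dist x y \<le> r" "u \<in> V"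
    and sp: "same_pattern T (2 * D + r) x (x + w)" and r: "r \<ge> 0"
  shows "joins B (ref (shift w s)) r (shift w s) (shift w u) (\<lambda>d. \<gamma> (shift (- w) d))"
proof -
  have j1: "d \<in> E" "d \<subseteq> cball (ref s) r" if "\<gamma> d \<noteq> 0" for d using j that by (auto simp: joins_def)
  have near_x: "dist x z \<le> D + r" if "\<gamma> d \<noteq> 0" "z \<in> d" for d z
    using j1(2)[OF that(1)] that(2) D_ref[OF s] dist_triangle[of x z "ref s"] by auto
  have ref': "ref (shift w s) = w + ref s" using tile_ref_shift[OF s(1)] .
  have "d \<in> E \<and> d \<subseteq> cball (ref (shift w s)) r" if nz: "\<gamma> (shift (- w) d) \<noteq> 0" for d
  proof -
    let ?e = "shift (- w) d"
    obtain z where z: "z \<in> ?e" using facet_nonempty j1(1)[OF nz] by blast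
    have "same_pattern T D z (z + w)" using same_pattern_shift[OF sp, of z D] near_x[OF nz z] by simp
    then have "shift w ?e \<in> E"
      by (rule facet_pattern(1)[OF j1(1)[OF nz] z]) (use D_pos in simp)
    moreover have "d \<subseteq> cball (ref (shift w s)) r"
    proof
      fix y assume "y \<in> d"
      then have "y - w \<in> ?e" by simp
      then have "dist (ref s) (y - w) \<le> r" using j1(2)[OF nz] by (meson mem_cball subsetD)
      then show "y \<in> cball (ref (shift w s)) r" unfolding ref' by (simp add: dist_norm algebra_simps)
    qed
    ultimately show ?thesis by simp
  qed
  moreover have "\<bar>\<gamma> (shift (- w) d)\<bar> \<le> B" for d using j by (simp add: joins_def)
  moreover have "coboundary T \<nu> (\<lambda>d. \<gamma> (shift (- w) d)) v = of_bool (v = shift w s) - of_bool (v = shift w u)"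
    if v: "v \<in> V" for v
  proof (cases "v \<inter> cball (x + w) (D + r) = {}")
    case False
    let ?v = "shift (- w) v"
    have "v \<inter> cball (x + w) (2 * D + r) \<noteq> {}" using False D_pos by (auto simp: disjoint_iff)
    then have v': "?v \<in> V" using tile_shift[OF same_pattern_back[OF sp]] v by blast
    obtain y where y: "y \<in> v" "dist (x + w) y \<le> D + r" using False by auto
    have "coboundary T \<nu> (\<lambda>d. \<gamma> (shift (- w) d)) (shift w ?v) = coboundary T \<nu> \<gamma> ?v"
    proof (rule coboundary_shift[OF v'])
      show "shift w ?v \<in> V" using v by simp
      fix d assume d: "d facet_of ?v"
      have dE: "d \<in> E" using facet_in_E[OF v' d] .
      obtain z where z: "z \<in> d" using facet_nonempty[OF dE] by blast
      have "dist x (y - w) \<le> D + r" using y(2) by (simp add: dist_norm algebra_simps)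
      moreover have "dist (y - w) z \<le> D" using D_dist[OF v', of "y - w" z] y(1) z facet_subset[OF d] by auto
      ultimately have "dist x z \<le> 2 * D + r" using dist_triangle[of x z "y - w"] by linarith
      then have "same_pattern T 0 z (z + w)" using same_pattern_shift[OF sp, of z 0] by simp
      then show "incidence \<nu> (shift w ?v) (shift w d) = incidence \<nu> ?v d \<and> \<gamma> (shift (- w) (shift w d)) = \<gamma> d"
        using facet_pattern(5)[OF dE z _ order_refl, of w ?v] by simp
    qed
    moreover have "coboundary T \<nu> \<gamma> ?v = of_bool (?v = s) - of_bool (?v = u)" using j v' by (simp add: joins_def)
    moreover have "?v = t \<longleftrightarrow> v = shift w t" for t
      using shift_eq_iff[of w ?v t] by simp
    ultimately show ?thesis by simp
  next
    case True
    have "x + w \<in> shift w s \<inter> cball (x + w) (D + r)" using s(2) D_pos r by simp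
    then have "v \<noteq> shift w s" using True by blast
    moreover have "v \<noteq> shift w u"
    proof
      assume eq: "v = shift w u"
      obtain y where y: "y \<in> u" using tile_nonempty[OF u(2)] by blast
      have "y + w \<in> v \<inter> cball (x + w) (D + r)" using y u(1)[OF y] D_pos eq by (simp add: dist_norm)
      then show False using True by blast
    qed
    moreover have "\<gamma> (shift (- w) d) = 0" if d: "d facet_of v" for d
    proof (rule ccontr)
      assume nz: "\<gamma> (shift (- w) d) \<noteq> 0"
      obtain z where z: "z \<in> d" using facet_nonempty[OF facet_in_E[OF v d]] by blast
      have "dist x (z - w) \<le> D + r" using near_x[OF nz, of "z - w"] z by simp
      then have "z \<in> cball (x + w) (D + r)" by (simp add: dist_norm algebra_simps)
      then show False using True z facet_subset[OF d] by blast
    qed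
    then have "coboundary T \<nu> (\<lambda>d. \<gamma> (shift (- w) d)) v = 0" unfolding coboundary_tile[OF v] by simp
    ultimately show ?thesis by simp
  qed
  ultimately show ?thesis unfolding joins_def by blast
qed

text \<open>
  A joining flow has to be chosen in a pattern equivariant way.  The choice is made in coordinates relative
  to the reference point of \<open>s\<close>, from the set of all candidates; this set depends on the local pattern only, and
  equal sets give equal choices.
\<close>

definition joiners :: "real \<Rightarrow> 'a set \<Rightarrow> 'a set \<Rightarrow> ('a set \<Rightarrow> real) set" where
  "joiners r s u = {g. joins (load r) (ref s) (reach r) s u (\<lambda>d. g (shift (- ref s) d))}"

definition link :: "real \<Rightarrow> 'a set \<Rightarrow> 'a set \<Rightarrow> 'a set \<Rightarrow> real" where
  "link r s u d = (SOME g. g \<in> joiners r s u) (shift (- ref s) d)"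

lemma joins_link:
  assumes "s \<in> V" "u \<in> V" "r \<ge> 0" "\<And>x y. x \<in> s \<Longrightarrow> y \<in> u \<Longrightarrow> dist x y \<le> r"
  shows "joins (load r) (ref s) (reach r) s u (link r s u)"
proof -
  obtain \<gamma> where "joins (load r) (ref s) (reach r) s u \<gamma>" using joins_exists[OF assms] by blast
  then have "(\<lambda>d. \<gamma> (shift (ref s) d)) \<in> joiners r s u" by (simp add: joiners_def)
  then have "(SOME g. g \<in> joiners r s u) \<in> joiners r s u"
    by (rule someI[where P = "\<lambda>g. g \<in> joiners r s u"])
  then show ?thesis by (simp add: joiners_def link_def[abs_def])
qed

lemma joiners_shift_subset:
  assumes s: "s \<in> V" "x \<in> s" and u: "\<And>y. y \<in> u \<Longrightarrow> dist x y \<le> r" "u \<in> V"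
    and sp: "same_pattern T (2 * D + reach r) x (x + w)" and r: "r \<ge> 0"
  shows "joiners r s u \<subseteq> joiners r (shift w s) (shift w u)"
proof
  fix g assume "g \<in> joiners r s u"
  then have "joins (load r) (ref s) (reach r) s u (\<lambda>d. g (shift (- ref s) d))" by (simp add: joiners_def)
  moreover have "r \<le> reach r" "reach r \<ge> 0" using D_pos r by (auto simp: reach_def)
  ultimately have "joins (load r) (ref (shift w s)) (reach r) (shift w s) (shift w u)
      (\<lambda>d. g (shift (- ref s) (shift (- w) d)))"
    using s u sp by (intro joins_shift) (auto intro: order_trans)
  then show "g \<in> joiners r (shift w s) (shift w u)"
    unfolding joiners_def using tile_ref_shift[OF s(1), of w] by (simp add: algebra_simps)
qed

lemma link_shift:
  assumes s: "s \<in> V" "x \<in> s" and u: "\<And>y. y \<in> u \<Longrightarrow> dist x y \<le> r" "u \<in> V"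
    and sp: "same_pattern T (2 * D + reach r) x (x + w)" and r: "r \<ge> 0"
  shows "link r (shift w s) (shift w u) (shift w d) = link r s u d"
proof -
  have R: "r \<le> 2 * D + reach r" using D_pos by (simp add: reach_def)
  obtain y where y: "y \<in> u" using tile_nonempty[OF u(2)] by blast
  have "s \<inter> cball x (2 * D + reach r) \<noteq> {}" "u \<inter> cball x (2 * D + reach r) \<noteq> {}"
    using s(2) y u(1)[OF y] R r by (force simp: disjoint_iff)+
  then have V': "shift w s \<in> V" "shift w u \<in> V" using tile_shift[OF sp] s u by auto
  have "joiners r (shift w s) (shift w u) \<subseteq> joiners r (shift (- w) (shift w s)) (shift (- w) (shift w u))"
  proof (rule joiners_shift_subset[OF V'(1) _ _ V'(2) same_pattern_back[OF sp] r])
    show "x + w \<in> shift w s" using s(2) by simp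
    show "dist (x + w) z \<le> r" if "z \<in> shift w u" for z
      using u(1)[of "z - w"] that by (simp add: dist_norm algebra_simps)
  qed
  then have "joiners r (shift w s) (shift w u) = joiners r s u"
    using joiners_shift_subset[OF assms] by auto
  then show ?thesis unfolding link_def using tile_ref_shift[OF s(1), of w] by (simp add: algebra_simps)
qed

text \<open>
  The tiles whose joining flows can pass through \<open>d\<close>.  A facet has no reference point of its own, so that of the
  adjacent tile is used.
\<close>

definition flow_tiles :: "real \<Rightarrow> 'a set \<Rightarrow> 'a set set" where
  "flow_tiles r d = near (reach r + 2 * D + r) (ref (pos d))"

text \<open>
  The superposition of the joining flows, weighted by the coupling.
\<close>

definition flow_of :: "real \<Rightarrow> ('a set \<Rightarrow> 'a set \<Rightarrow> real) \<Rightarrow> 'a set \<Rightarrow> real" where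
  "flow_of r \<phi> d = (if d \<in> E then \<Sum>s\<in>flow_tiles r d. \<Sum>u\<in>flow_tiles r d. \<phi> s u * link r s u d else 0)"

lemma link_support:
  assumes rg: "ranged r \<phi>" and r: "r \<ge> 0" and nz: "\<phi> s u * link r s u d \<noteq> 0"
  shows "s \<in> flow_tiles r d" "u \<in> flow_tiles r d"
proof -
  have p: "\<phi> s u \<noteq> 0" and l: "link r s u d \<noteq> 0" using nz by auto
  note rD = rangedD[OF rg p]
  have j: "joins (load r) (ref s) (reach r) s u (link r s u)" using rD r by (intro joins_link) auto
  then have d: "d \<in> E" "d \<subseteq> cball (ref s) (reach r)" using l by (auto simp: joins_def)
  obtain z where z: "z \<in> d" using facet_nonempty[OF d(1)] by blast
  obtain x y where xy: "x \<in> s" "y \<in> u" using tile_nonempty rD(1,2) by blast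
  have "dist (ref s) z \<le> reach r" using d(2) z by auto
  then have "dist x z \<le> D + reach r" using D_ref[OF rD(1) xy(1)] dist_triangle[of x z "ref s"] by linarith
  moreover have "dist z (ref (pos d)) \<le> D"
    using D_ref[OF pos_V[OF d(1)]] facet_subset[OF pos_facet[OF d(1)]] z by blast
  ultimately have x: "dist x (ref (pos d)) \<le> reach r + 2 * D" using dist_triangle[of x "ref (pos d)" z] by linarith
  moreover have "dist x y \<le> r" using rD(3) xy by blast
  ultimately have "dist y (ref (pos d)) \<le> reach r + 2 * D + r"
    using dist_triangle3[of y "ref (pos d)" x] by linarith
  then have "y \<in> u \<inter> cball (ref (pos d)) (reach r + 2 * D + r)" using xy by (simp add: dist_commute)
  moreover have "x \<in> s \<inter> cball (ref (pos d)) (reach r + 2 * D + r)" using x xy r by (simp add: dist_commute)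
  ultimately show "s \<in> flow_tiles r d" "u \<in> flow_tiles r d"
    using rD(1,2) unfolding flow_tiles_def near_def by blast+
qed

lemma flow_of_sum:
  assumes rg: "ranged r \<phi>" and r: "r \<ge> 0" and d: "d \<in> E" and X: "finite X" "flow_tiles r d \<subseteq> X"
  shows "flow_of r \<phi> d = (\<Sum>s\<in>X. \<Sum>u\<in>X. \<phi> s u * link r s u d)"
proof -
  let ?H = "flow_tiles r d"
  have "flow_of r \<phi> d = (\<Sum>(s, u)\<in>?H \<times> ?H. \<phi> s u * link r s u d)"
    using d by (simp add: flow_of_def sum.cartesian_product)
  also have "\<dots> = (\<Sum>(s, u)\<in>X \<times> X. \<phi> s u * link r s u d)"
    using X link_support[OF rg r] by (intro sum.mono_neutral_left) auto
  finally show ?thesis by (simp add: sum.cartesian_product)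
qed

lemma coboundary_sum:
  "coboundary T \<nu> (\<lambda>d. \<Sum>i\<in>I. c i * f i d) v = (\<Sum>i\<in>I. c i * coboundary T \<nu> (f i) v)"
proof (cases "v \<in> V")
  case True
  show ?thesis unfolding coboundary_tile[OF True] sum_distrib_left
    by (subst sum.swap) (simp add: algebra_simps)
next
  case False
  then show ?thesis by (simp add: coboundary_nontile)
qed

text \<open>
  Each joining flow from \<open>s\<close> to \<open>u\<close> has divergence 1 at \<open>s\<close> and -1 at \<open>u\<close>; the sums of the weights are the
  row and column sums of the coupling.
\<close>

theorem coboundary_flow_of:
  assumes c: "coupling r a b \<phi>" and r: "r \<ge> 0" and v: "v \<in> V"
  shows "coboundary T \<nu> (flow_of r \<phi>) v = a v - b v"
proof -
  have rg: "ranged r \<phi>" using c by (simp add: coupling_def)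
  obtain y where y: "y \<in> v" using tile_nonempty[OF v] by blast
  \<comment> \<open>contains \<open>flow_tiles r d\<close> for every facet \<open>d\<close> of \<open>v\<close>\<close>
  define X where "X = near (reach r + 4 * D + r) y"
  have fX: "finite X" by (simp add: X_def)
  have vX: "v \<in> X" using v y D_pos r by (force simp: X_def near_def reach_def disjoint_iff)
  have hX: "flow_tiles r d \<subseteq> X" if d: "d facet_of v" for d
  proof
    fix s assume "s \<in> flow_tiles r d"
    then obtain x where x: "s \<in> V" "x \<in> s" "dist (ref (pos d)) x \<le> reach r + 2 * D + r"
      by (auto simp: flow_tiles_def near_def)
    have dE: "d \<in> E" using facet_in_E[OF v d] .
    obtain z where z: "z \<in> d" using facet_nonempty[OF dE] by blast
    have "dist y z \<le> D" using D_dist[OF v y] facet_subset[OF d] z by blast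
    moreover have "dist z (ref (pos d)) \<le> D"
      using D_ref[OF pos_V[OF dE]] facet_subset[OF pos_facet[OF dE]] z by blast
    ultimately have "dist y x \<le> reach r + 4 * D + r"
      using x(3) dist_triangle[of y x z] dist_triangle[of z x "ref (pos d)"] by linarith
    then show "s \<in> X" using x by (auto simp: X_def near_def)
  qed
  have "coboundary T \<nu> (flow_of r \<phi>) v = coboundary T \<nu> (\<lambda>d. \<Sum>i\<in>X \<times> X. \<phi> (fst i) (snd i) * link r (fst i) (snd i) d) v"
    unfolding coboundary_tile[OF v]
  proof (rule sum.cong[OF refl])
    fix d assume "d \<in> {d. d facet_of v}"
    then have d: "d facet_of v" by simp
    show "incidence \<nu> v d * flow_of r \<phi> d = incidence \<nu> v d * (\<Sum>i\<in>X \<times> X. \<phi> (fst i) (snd i) * link r (fst i) (snd i) d)"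
      using flow_of_sum[OF rg r facet_in_E[OF v d] fX hX[OF d]] by (simp add: sum.cartesian_product split_beta)
  qed
  also have "\<dots> = (\<Sum>i\<in>X \<times> X. \<phi> (fst i) (snd i) * coboundary T \<nu> (link r (fst i) (snd i)) v)"
    by (rule coboundary_sum)
  also have "\<dots> = (\<Sum>i\<in>X \<times> X. \<phi> (fst i) (snd i) * (of_bool (v = fst i) - of_bool (v = snd i)))"
  proof (rule sum.cong[OF refl])
    fix i assume "i \<in> X \<times> X"
    show "\<phi> (fst i) (snd i) * coboundary T \<nu> (link r (fst i) (snd i)) v =
        \<phi> (fst i) (snd i) * (of_bool (v = fst i) - of_bool (v = snd i))"
    proof (cases "\<phi> (fst i) (snd i) = 0")
      case False
      then have "joins (load r) (ref (fst i)) (reach r) (fst i) (snd i) (link r (fst i) (snd i))"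
        using rangedD[OF rg False] r by (intro joins_link) auto
      then show ?thesis using v by (simp add: joins_def)
    qed simp
  qed
  also have "\<dots> = (\<Sum>s\<in>X. \<Sum>u\<in>X. \<phi> s u * of_bool (v = s)) - (\<Sum>s\<in>X. \<Sum>u\<in>X. \<phi> s u * of_bool (v = u))"
    by (simp add: sum.cartesian_product split_beta sum_subtractf[symmetric] algebra_simps)
  also have "(\<Sum>s\<in>X. \<Sum>u\<in>X. \<phi> s u * of_bool (v = u)) = (\<Sum>s\<in>X. \<phi> s v)"
    using fX vX by (simp add: of_bool_def if_distrib[of "(*) _"] cong: if_cong)
  also have "(\<Sum>s\<in>X. \<Sum>u\<in>X. \<phi> s u * of_bool (v = s)) = (\<Sum>u\<in>X. \<phi> v u)"
    using fX vX by (subst sum.swap) (simp add: of_bool_def if_distrib[of "(*) _"] cong: if_cong)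
  also have "(\<Sum>u\<in>X. \<phi> v u) = a v"
  proof -
    have "{u. \<phi> v u \<noteq> 0} \<subseteq> X"
      using ranged_support(1)[OF rg y] near_mono[of r "reach r + 4 * D + r" y] D_pos r by (auto simp: X_def reach_def)
    then show ?thesis using sum_support[OF fX, of "\<phi> v"] c v by (simp add: coupling_def)
  qed
  also have "(\<Sum>s\<in>X. \<phi> s v) = b v"
  proof -
    have "{s. \<phi> s v \<noteq> 0} \<subseteq> X"
      using ranged_support(2)[OF rg y] near_mono[of r "reach r + 4 * D + r" y] D_pos r by (auto simp: X_def reach_def)
    then show ?thesis using sum_support[OF fX, of "\<lambda>s. \<phi> s v"] c v by (simp add: coupling_def)
  qed
  finally show ?thesis .
qed

lemma cochain_flow_of: "cochain T (DIM('a) - 1) (flow_of r \<phi>)"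
  by (simp add: cochain_def flow_of_def E_def)

text \<open>
  The flow is linear in the coupling, with a bounded number of bounded terms at every facet.
\<close>

lemma flow_of_close:
  assumes "ranged r \<phi>" "ranged r \<psi>" and r: "r \<ge> 0" and e: "\<And>s u. \<bar>\<phi> s u - \<psi> s u\<bar> \<le> e"
  shows "\<bar>flow_of r \<phi> d - flow_of r \<psi> d\<bar> \<le> (real (Q (reach r + 2 * D + r)))\<^sup>2 * (e * load r)"
proof (cases "d \<in> E")
  case True
  let ?H = "flow_tiles r d" and ?q = "Q (reach r + 2 * D + r)"
  have e0: "e \<ge> 0" using e[of "{}" "{}"] by linarith
  have l0: "load r \<ge> 0" by (simp add: load_def)
  have t: "\<bar>(\<phi> s u - \<psi> s u) * link r s u d\<bar> \<le> e * load r" for s u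
  proof (cases "\<phi> s u = 0 \<and> \<psi> s u = 0")
    case True
    then show ?thesis using e0 l0 by simp
  next
    case False
    then have "s \<in> V" "u \<in> V" "\<And>x y. x \<in> s \<Longrightarrow> y \<in> u \<Longrightarrow> dist x y \<le> r"
      using rangedD[OF assms(1), of s u] rangedD[OF assms(2), of s u] by blast+
    then have "joins (load r) (ref s) (reach r) s u (link r s u)" using r by (intro joins_link) auto
    then have "\<bar>link r s u d\<bar> \<le> load r" by (simp add: joins_def)
    then show ?thesis unfolding abs_mult using e[of s u] e0 by (intro mult_mono) auto
  qed
  have eq: "flow_of r \<phi> d - flow_of r \<psi> d = (\<Sum>(s, u)\<in>?H \<times> ?H. (\<phi> s u - \<psi> s u) * link r s u d)"
    using True by (simp add: flow_of_def sum.cartesian_product sum_subtractf[symmetric] split_beta algebra_simps)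
  have "\<bar>flow_of r \<phi> d - flow_of r \<psi> d\<bar> \<le> (\<Sum>(s, u)\<in>?H \<times> ?H. \<bar>(\<phi> s u - \<psi> s u) * link r s u d\<bar>)"
    unfolding eq split_beta by (rule sum_abs)
  also have "\<dots> \<le> (\<Sum>i\<in>?H \<times> ?H. e * load r)"
  proof (rule sum_mono)
    fix i
    show "(case i of (s, u) \<Rightarrow> \<bar>(\<phi> s u - \<psi> s u) * link r s u d\<bar>) \<le> e * load r"
      unfolding split_beta by (rule t)
  qed
  also have "\<dots> = (real (card ?H))\<^sup>2 * (e * load r)" by (simp add: card_cartesian_product power2_eq_square)
  also have "\<dots> \<le> (real ?q)\<^sup>2 * (e * load r)"
    using e0 l0 card_near by (intro mult_right_mono power_mono) (auto simp: flow_tiles_def)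
  finally show ?thesis .
next
  case False
  have "e \<ge> 0" using e[of "{}" "{}"] by linarith
  then show ?thesis using False by (simp add: flow_of_def load_def)
qed

theorem PE_cells_flow_of:
  assumes rg: "ranged r \<phi>" and r: "r \<ge> 0" and pe: "PE_kernel \<phi>"
  shows "PE_cells (flow_of r \<phi>)"
proof -
  obtain Rp where Rp: "Rp > 0" "\<And>s u x w. x \<in> s \<Longrightarrow> same_pattern T Rp x (x + w) \<Longrightarrow> \<phi> (shift w s) (shift w u) = \<phi> s u"
    using pe unfolding PE_kernel_def by blast
  have Rr: "reach r > 0" using D_pos r by (simp add: reach_def)
  define H where "H = reach r + 2 * D + r"
  \<comment> \<open>radii for the kernel and for the joining flows, and the distance to the tiles from which they are read off\<close>
  define R where "R = Rp + (2 * D + reach r) + (D + H)"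
  have H0: "H > 0" using Rr D_pos r by (simp add: H_def)
  have R0: "R > 0" using Rp(1) Rr D_pos H0 by (simp add: R_def)
  have main: "flow_of r \<phi> (shift w d) = flow_of r \<phi> d"
    if z: "z \<in> d" and sp: "same_pattern T R z (z + w)" and dE: "d \<in> E" for d z w
  proof -
    note fp = facet_pattern[OF dE z sp less_imp_le[OF R0]]
    have pV: "pos d \<in> V" using pos_V[OF dE] .
    have "dist z (ref (pos d)) \<le> D" using D_ref[OF pV] facet_subset[OF pos_facet[OF dE]] z by blast
    then have "near H (ref (pos d) + w) = shift w ` near H (ref (pos d))"
      using Rp(1) Rr D_pos by (intro near_shift[OF sp]) (simp add: R_def)
    then have hull: "flow_tiles r (shift w d) = shift w ` flow_tiles r d"
      unfolding flow_tiles_def H_def[symmetric] fp(2) tile_ref_shift[OF pV] by (simp only: add.commute)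
    have inj: "inj_on (shift w) (flow_tiles r d)" by (auto simp: inj_on_def)
    have t: "\<phi> (shift w s) (shift w u) * link r (shift w s) (shift w u) (shift w d) = \<phi> s u * link r s u d"
      if s: "s \<in> flow_tiles r d" for s u
    proof -
      obtain x where x: "x \<in> s" "dist (ref (pos d)) x \<le> H" "s \<in> V"
        using s by (auto simp: flow_tiles_def near_def H_def)
      have "dist z x \<le> D + H"
        using x(2) \<open>dist z (ref (pos d)) \<le> D\<close> dist_triangle[of z x "ref (pos d)"] by linarith
      then have sx: "same_pattern T (Rp + (2 * D + reach r)) x (x + w)"
        by (intro same_pattern_shift[OF sp]) (simp add: R_def)
      have p1: "same_pattern T Rp x (x + w)" and p2: "same_pattern T (2 * D + reach r) x (x + w)"
        using same_pattern_mono[OF sx] Rp(1) Rr D_pos by auto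
      show ?thesis
      proof (cases "\<phi> s u = 0")
        case True
        then show ?thesis using Rp(2)[OF x(1) p1] by simp
      next
        case False
        then show ?thesis
          using Rp(2)[OF x(1) p1] link_shift[OF x(3,1) _ _ p2 r, of u d] rangedD[OF rg False] x(1) by simp
      qed
    qed
    show ?thesis
      unfolding flow_of_def hull using dE fp(1) t by (simp add: sum.reindex[OF inj])
  qed
  have "flow_of r \<phi> (shift w d) = flow_of r \<phi> d" if z: "z \<in> d" and sp: "same_pattern T R z (z + w)" for d z w
  proof (cases "d \<in> E")
    case True
    then show ?thesis using main[OF z sp] by blast
  next
    case False
    show ?thesis
    proof (cases "shift w d \<in> E")
      case True
      then show ?thesis using main[of "z + w" "shift w d" "- w"] same_pattern_back[OF sp] z by simp
    next
      case False
      then show ?thesis using \<open>d \<notin> E\<close> by (simp add: flow_of_def)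
    qed
  qed
  then show ?thesis unfolding PE_cells_def using R0 by blast
qed

end

section \<open>From transports to couplings of tiles\<close>

lemma uniform_limit_le:
  fixes g :: "'i \<Rightarrow> real"
  assumes "uniform_limit X h g sequentially" "e > 0"
  obtains j where "\<And>x. x \<in> X \<Longrightarrow> \<bar>h j x - g x\<bar> \<le> e"
proof -
  obtain j where "\<forall>x\<in>X. dist (h j x) (g x) < e"
    using uniform_limitD[OF assms] by (auto simp: eventually_sequentially)
  then show ?thesis using that[of j] by (auto simp: dist_real_def less_imp_le)
qed

lemma uniform_limit_rate:
  fixes g :: "'i \<Rightarrow> real"
  assumes "\<And>j x. \<bar>h j x - g x\<bar> \<le> C * (1 / (real j + 1))" "C \<ge> 0"
  shows "uniform_limit X h g sequentially"
proof (rule uniform_limitI)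
  fix e :: real assume e: "e > 0"
  obtain j0 :: nat where j0: "C / e < real j0" using reals_Archimedean2 by blast
  have "dist (h j x) (g x) < e" if "j \<ge> j0" for j x
  proof -
    have "C / e < real j + 1" using j0 that by linarith
    then have "C * (1 / (real j + 1)) < e" using e by (simp add: field_simps)
    then show ?thesis using assms(1)[of j x] by (simp add: dist_real_def)
  qed
  then show "\<forall>\<^sub>F j in sequentially. \<forall>x\<in>X. dist (h j x) (g x) < e"
    unfolding eventually_sequentially by blast
qed

text \<open>
  Measure zero of the exceptional set is tested by integrating its sections in the other order.
\<close>

lemma AE_lborel_pair_swap:
  fixes P :: "'a::euclidean_space \<times> 'b::euclidean_space \<Rightarrow> bool"
  assumes "AE z in lborel. P z"
  shows "AE y in lborel. AE x in lborel. P (x, y)"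
proof -
  obtain N where N: "N \<in> null_sets lborel" "{z. \<not> P z} \<subseteq> N"
    using assms by (auto simp: eventually_ae_filter)
  have sN: "N \<in> sets (lborel \<Otimes>\<^sub>M lborel)" using N(1) by (simp only: lborel_prod) auto
  have "(\<integral>\<^sup>+ y. (\<integral>\<^sup>+ x. indicator N (x, y) \<partial>lborel) \<partial>lborel) = (\<integral>\<^sup>+ z. indicator N z \<partial>(lborel \<Otimes>\<^sub>M lborel))"
    using sN by (intro lborel_pair.nn_integral_snd) auto
  also have "\<dots> = emeasure lborel N" using sN by (simp only: lborel_prod nn_integral_indicator)
  also have "\<dots> = 0" using N(1) by auto
  finally have "(\<integral>\<^sup>+ y. (\<integral>\<^sup>+ x. indicator N (x, y) \<partial>lborel) \<partial>lborel) = (0::ennreal)" .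
  moreover have "(\<lambda>y. \<integral>\<^sup>+ x. indicator N (x, y) \<partial>lborel) \<in> borel_measurable (lborel::'b measure)"
  proof -
    have "(\<lambda>(y, x). indicator N (x, y) :: ennreal) \<in> borel_measurable (lborel \<Otimes>\<^sub>M lborel)"
      using measurable_pair_swap[of "indicator N" lborel lborel borel] sN by (simp add: split_beta)
    then show ?thesis by (rule lborel.borel_measurable_nn_integral)
  qed
  ultimately have "AE y in lborel. (\<integral>\<^sup>+ x. indicator N (x, y) \<partial>lborel) = (0::ennreal)"
    by (subst (asm) nn_integral_0_iff_AE) auto
  then show ?thesis
  proof eventually_elim
    case (elim y)
    have "(\<lambda>x. indicator N (x, y) :: ennreal) \<in> borel_measurable (lborel::'a measure)"
      using sN by (intro measurable_compose[OF measurable_Pair2' borel_measurable_indicator]) auto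
    then have "AE x in lborel. indicator N (x, y) = (0::ennreal)"
      using elim by (subst (asm) nn_integral_0_iff_AE) auto
    then show "AE x in lborel. P (x, y)"
      by eventually_elim (use N(2) in \<open>auto simp: indicator_def split: if_splits\<close>)
  qed
qed

lemma AE_lborel_pair:
  fixes P :: "'a::euclidean_space \<times> 'b::euclidean_space \<Rightarrow> bool"
  assumes "AE z in lborel. P z"
  shows "AE x in lborel. AE y in lborel. P (x, y)"
proof (rule lborel_pair.AE_pair)
  show "AE z in lborel \<Otimes>\<^sub>M lborel. P z" unfolding lborel_prod by (rule assms)
qed

text \<open>
  A Lebesgue measurable function agrees almost everywhere with a Borel function, and then almost all of its
  sections agree almost everywhere with those of the Borel function.  The inner integral is only known for almost
  every section, just as for the marginals of a transport.
\<close>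

lemma tonelli_lebesgue:
  fixes g :: "'a::euclidean_space \<times> 'b::euclidean_space \<Rightarrow> ennreal"
  assumes g: "g \<in> borel_measurable lebesgue"
  shows tonelli_lebesgue_fst: "(AE x in lebesgue. (\<integral>\<^sup>+ y. g (x, y) \<partial>lebesgue) = G x) \<Longrightarrow>
      (\<integral>\<^sup>+ z. g z \<partial>lebesgue) = (\<integral>\<^sup>+ x. G x \<partial>lebesgue)"
    and tonelli_lebesgue_snd: "(AE y in lebesgue. (\<integral>\<^sup>+ x. g (x, y) \<partial>lebesgue) = H y) \<Longrightarrow>
      (\<integral>\<^sup>+ z. g z \<partial>lebesgue) = (\<integral>\<^sup>+ y. H y \<partial>lebesgue)"
proof -
  obtain h where h: "h \<in> borel_measurable lborel" "AE z in lborel. g z = h z"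
    using completion_ex_borel_measurable[OF g] by blast
  have hm: "h \<in> borel_measurable (lborel \<Otimes>\<^sub>M lborel)" using h(1) by (simp add: lborel_prod)
  have gh: "(\<integral>\<^sup>+ z. g z \<partial>lebesgue) = (\<integral>\<^sup>+ z. h z \<partial>(lborel \<Otimes>\<^sub>M lborel))"
    unfolding nn_integral_completion lborel_prod by (rule nn_integral_cong_AE[OF h(2)])
  show "(\<integral>\<^sup>+ z. g z \<partial>lebesgue) = (\<integral>\<^sup>+ x. G x \<partial>lebesgue)"
    if G: "AE x in lebesgue. (\<integral>\<^sup>+ y. g (x, y) \<partial>lebesgue) = G x"
  proof -
    have "AE x in lborel. (\<integral>\<^sup>+ y. h (x, y) \<partial>lborel) = (\<integral>\<^sup>+ y. g (x, y) \<partial>lborel)"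
      using AE_lborel_pair[OF h(2)]
    proof eventually_elim
      case (elim x)
      show ?case by (rule nn_integral_cong_AE) (use elim in \<open>eventually_elim, simp\<close>)
    qed
    moreover have "AE x in lborel. (\<integral>\<^sup>+ y. g (x, y) \<partial>lborel) = G x"
      using G by (simp only: AE_completion_iff nn_integral_completion)
    ultimately have ae: "AE x in lborel. (\<integral>\<^sup>+ y. h (x, y) \<partial>lborel) = G x" by eventually_elim simp
    have "(\<integral>\<^sup>+ z. h z \<partial>(lborel \<Otimes>\<^sub>M lborel)) = (\<integral>\<^sup>+ x. (\<integral>\<^sup>+ y. h (x, y) \<partial>lborel) \<partial>lborel)"
      by (rule lborel.nn_integral_fst[OF hm, symmetric])
    also have "\<dots> = (\<integral>\<^sup>+ x. G x \<partial>lborel)" by (rule nn_integral_cong_AE[OF ae])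
    finally show ?thesis unfolding gh by (simp only: nn_integral_completion)
  qed
  show "(\<integral>\<^sup>+ z. g z \<partial>lebesgue) = (\<integral>\<^sup>+ y. H y \<partial>lebesgue)"
    if H: "AE y in lebesgue. (\<integral>\<^sup>+ x. g (x, y) \<partial>lebesgue) = H y"
  proof -
    have "AE y in lborel. (\<integral>\<^sup>+ x. h (x, y) \<partial>lborel) = (\<integral>\<^sup>+ x. g (x, y) \<partial>lborel)"
      using AE_lborel_pair_swap[OF h(2)]
    proof eventually_elim
      case (elim x)
      show ?case by (rule nn_integral_cong_AE) (use elim in \<open>eventually_elim, simp\<close>)
    qed
    moreover have "AE y in lborel. (\<integral>\<^sup>+ x. g (x, y) \<partial>lborel) = H y"
      using H by (simp only: AE_completion_iff nn_integral_completion)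
    ultimately have ae: "AE y in lborel. (\<integral>\<^sup>+ x. h (x, y) \<partial>lborel) = H y" by eventually_elim simp
    have "(\<integral>\<^sup>+ z. h z \<partial>(lborel \<Otimes>\<^sub>M lborel)) = (\<integral>\<^sup>+ y. (\<integral>\<^sup>+ x. h (x, y) \<partial>lborel) \<partial>lborel)"
      by (rule lborel_pair.nn_integral_snd[OF hm, symmetric])
    also have "\<dots> = (\<integral>\<^sup>+ y. H y \<partial>lborel)" by (rule nn_integral_cong_AE[OF ae])
    finally show ?thesis unfolding gh by (simp only: nn_integral_completion)
  qed
qed

lemma lebesgue_distr_shift:
  fixes w :: "'a::euclidean_space"
  shows "(+) w \<in> lebesgue \<rightarrow>\<^sub>M lebesgue" and "distr lebesgue lebesgue ((+) w) = lebesgue"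
proof -
  have pre: "(+) w -` A = (+) (- w) ` A" for A :: "'a set"
    by (force simp: image_iff algebra_simps)
  have sp: "space lebesgue = (UNIV :: 'a set)" by simp
  have st: "(+) w -` A \<in> sets lebesgue" if "A \<in> sets lebesgue" for A :: "'a set"
    unfolding pre by (rule lebesgue_sets_translation[OF that])
  show m: "(+) w \<in> lebesgue \<rightarrow>\<^sub>M lebesgue"
    by (rule measurableI) (simp_all only: sp st Int_UNIV_right UNIV_I)
  show "distr lebesgue lebesgue ((+) w) = lebesgue"
  proof (rule measure_eqI)
    fix A :: "'a set" assume "A \<in> sets (distr lebesgue lebesgue ((+) w))"
    then have A: "A \<in> sets lebesgue" by simp
    have "emeasure (distr lebesgue lebesgue ((+) w)) A = emeasure lebesgue ((+) (- w) ` A)"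
      using A m by (simp only: emeasure_distr pre sp Int_UNIV_right)
    also have "\<dots> = emeasure lebesgue A"
      using emeasure_lebesgue_affine[of 1 "- w" A] by (simp add: add.commute cong: image_cong_simp)
    finally show "emeasure (distr lebesgue lebesgue ((+) w)) A = emeasure lebesgue A" .
  qed simp
qed

lemma set_integral_shift:
  fixes g :: "'a::euclidean_space \<Rightarrow> real"
  assumes "(\<lambda>z. indicator (shift w S) z *\<^sub>R g z) \<in> borel_measurable lebesgue"
  shows "(LINT z:shift w S|lebesgue. g z) = (LINT z:S|lebesgue. g (w + z))"
proof -
  have "(LINT z:shift w S|lebesgue. g z) = integral\<^sup>L (distr lebesgue lebesgue ((+) w)) (\<lambda>z. indicator (shift w S) z *\<^sub>R g z)"
    by (simp add: set_lebesgue_integral_def lebesgue_distr_shift(2))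
  also have "\<dots> = integral\<^sup>L lebesgue (\<lambda>z. indicator (shift w S) (w + z) *\<^sub>R g (w + z))"
    by (rule integral_distr[OF lebesgue_distr_shift(1) assms])
  also have "\<dots> = (LINT z:S|lebesgue. g (w + z))"
    by (simp add: set_lebesgue_integral_def indicator_def)
  finally show ?thesis .
qed

context flc_tiling
begin

text \<open>
  Every value is attained near one of finitely many sample points.
\<close>

lemma strongly_PE_image:
  assumes "strongly_PE T f"
  shows "\<exists>C. compact C \<and> f ` UNIV = f ` C"
proof -
  obtain R where R: "R > 0" "\<And>x y. same_pattern T R x y \<Longrightarrow> f x = f y"
    using assms unfolding strongly_PE_def by blast
  obtain X where X: "finite X" "\<And>x. \<exists>x0\<in>X. \<exists>w. same_pattern T (R + D) x0 (x0 + w) \<and> dist (x0 + w) x \<le> D"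
    using finite_pattern_types[of "R + D"] R D_pos by (metis add_nonneg_nonneg less_imp_le)
  have "f x \<in> f ` (\<Union>x0\<in>X. cball x0 D)" for x
  proof -
    obtain x0 w where xw: "x0 \<in> X" "same_pattern T (R + D) x0 (x0 + w)" "dist (x0 + w) x \<le> D"
      using X(2) by blast
    have dst: "dist x0 (x - w) \<le> D" using xw(3) by (simp add: dist_norm algebra_simps)
    then have "same_pattern T R (x - w) (x - w + w)" by (intro same_pattern_shift[OF xw(2)]) simp
    then have "f (x - w) = f x" using R(2) by fastforce
    then show ?thesis using xw(1) dst by (intro image_eqI[of _ _ "x - w"]) auto
  qed
  moreover have "compact (\<Union>x0\<in>X. cball x0 D)" using X(1) by (intro compact_UN) auto
  ultimately show ?thesis by (intro exI[of _ "\<Union>x0\<in>X. cball x0 D"]) blast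
qed

lemma strongly_PE_bounds:
  assumes "strongly_PE T f" "\<And>x. f x > 0"
  shows "\<exists>l>0. \<exists>L. \<forall>x. l \<le> f x \<and> f x \<le> L"
proof -
  obtain C where C: "compact C" "f ` UNIV = f ` C" using strongly_PE_image[OF assms(1)] by blast
  have ne: "C \<noteq> {}" using C(2) by auto
  have co: "continuous_on C f" using assms(1) continuous_on_subset unfolding strongly_PE_def by blast
  obtain p where p: "p \<in> C" "\<forall>y\<in>C. f p \<le> f y" using continuous_attains_inf[OF C(1) ne co] by blast
  obtain q where q: "q \<in> C" "\<forall>y\<in>C. f y \<le> f q" using continuous_attains_sup[OF C(1) ne co] by blast
  have "f p \<le> f x \<and> f x \<le> f q" for x
  proof -
    have "f x \<in> f ` C" using C(2) by blast
    then show ?thesis using p q by auto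
  qed
  then show ?thesis using assms(2)[of p] by blast
qed

text \<open>
  Every facet has a copy near one of finitely many sample points, where there are finitely many facets.
\<close>

lemma strongly_PE_cochain_bounded:
  assumes "strongly_PE_cochain T (DIM('a) - 1) \<beta>"
  shows "\<exists>M\<ge>0. \<forall>d. \<bar>\<beta> d\<bar> \<le> M"
proof -
  have co: "cochain T (DIM('a) - 1) \<beta>" and "PE_cells \<beta>" using assms by (auto simp: strongly_PE_cochain_iff)
  then obtain R where R: "R > 0" "\<And>c x w. x \<in> c \<Longrightarrow> same_pattern T R x (x + w) \<Longrightarrow> \<beta> (shift w c) = \<beta> c"
    unfolding PE_cells_def by blast
  obtain X where X: "finite X" "\<And>x. \<exists>x0\<in>X. \<exists>w. same_pattern T (R + D) x0 (x0 + w) \<and> dist (x0 + w) x \<le> D"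
    using finite_pattern_types[of "R + D"] R D_pos by (metis add_nonneg_nonneg less_imp_le)
  define \<D> where "\<D> = (\<Union>x0\<in>X. \<Union>s\<in>near D x0. {d. d facet_of s})"
  have "finite {d. d facet_of s}" if "s \<in> near D x0" for s x0
    using that finite_facets by (auto simp: near_def)
  then have "finite \<D>" unfolding \<D>_def by (intro finite_UN_I X(1) finite_near)
  then have fin: "finite (\<beta> ` \<D>)" by simp
  have mem: "\<beta> d \<in> insert 0 (\<beta> ` \<D>)" for d
  proof (cases "d \<in> E")
    case True
    obtain z where z: "z \<in> d" using facet_nonempty[OF True] by blast
    obtain x0 w where xw: "x0 \<in> X" "same_pattern T (R + D) x0 (x0 + w)" "dist (x0 + w) z \<le> D"
      using X(2) by blast
    have dst: "dist x0 (z - w) \<le> D" using xw(3) by (simp add: dist_norm algebra_simps)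
    then have sp: "same_pattern T R (z - w) (z - w + w)" by (intro same_pattern_shift[OF xw(2)]) simp
    then have sp': "same_pattern T R z (z + - w)" using same_pattern_sym by fastforce
    have d': "shift (- w) d \<in> E" using facet_pattern(1)[OF True z sp'] R(1) by simp
    have zd: "z - w \<in> shift (- w) d" using z by simp
    have pf: "pos (shift (- w) d) \<in> V" "shift (- w) d facet_of pos (shift (- w) d)" using pos_neg[OF d'] by auto
    then have "z - w \<in> pos (shift (- w) d) \<inter> cball x0 D" using subsetD[OF facet_subset[OF pf(2)] zd] dst by simp
    then have "pos (shift (- w) d) \<in> near D x0" using pf(1) unfolding near_def by blast
    then have "shift (- w) d \<in> \<D>" using pf(2) xw(1) unfolding \<D>_def by blast
    moreover have "\<beta> (shift (- w) d) = \<beta> d" by (rule R(2)[OF z sp'])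
    ultimately have "\<beta> d \<in> \<beta> ` \<D>" by (metis imageI)
    then show ?thesis by blast
  next
    case False
    then show ?thesis using co by (simp add: cochain_def E_def)
  qed
  define M where "M = Max (abs ` insert 0 (\<beta> ` \<D>))"
  have "\<bar>\<beta> d\<bar> \<le> M" for d unfolding M_def using fin mem[of d] by (intro Max_ge) auto
  moreover have "0 \<le> M" using \<open>\<bar>\<beta> {}\<bar> \<le> M\<close> abs_ge_zero order_trans by blast
  ultimately show ?thesis by blast
qed

definition mass :: "('a \<Rightarrow> real) \<Rightarrow> 'a set \<Rightarrow> real" where
  "mass f = mass_cochain T f"

lemma mass_tile: "s \<in> V \<Longrightarrow> mass f s = (LINT x:s|lebesgue. f x)"
  by (simp add: mass_def mass_cochain_def cells_top)

lemma mass_nontile: "s \<notin> V \<Longrightarrow> mass f s = 0"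
  by (simp add: mass_def mass_cochain_def cells_top)

lemma integrable_on_tile:
  assumes "continuous_on UNIV f" "s \<in> V"
  shows "integrable lebesgue (\<lambda>x. indicator s x *\<^sub>R (f x :: real))"
proof -
  have i: "integrable lborel (\<lambda>x. indicator s x *\<^sub>R f x)"
    using assms tile_compact continuous_on_subset by (intro borel_integrable_compact) blast+
  then show ?thesis by (subst integrable_completion) auto
qed

lemma mass_bounds:
  assumes f: "continuous_on UNIV f" "\<And>x. l \<le> f x" "\<And>x. f x \<le> L" "l > 0"
  shows "\<exists>m>0. \<forall>s\<in>V. m \<le> mass f s" and "\<exists>A\<ge>0. \<forall>s\<in>V. \<bar>mass f s\<bar> \<le> A"
proof -
  obtain m where m: "m > 0" "\<And>s. s \<in> V \<Longrightarrow> m \<le> measure lebesgue s" using tile_measure_lower by blast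
  have L: "L > 0" using f(2)[of 0] f(3)[of 0] f(4) by linarith
  have bnd: "l * measure lebesgue s \<le> mass f s \<and> mass f s \<le> L * measure lebesgue s" if s: "s \<in> V" for s
  proof -
    have sm: "s \<in> lmeasurable" using tile_compact[OF s] by (rule lmeasurable_compact)
    have c: "integrable lebesgue (\<lambda>x. indicator s x * c)" "(LINT x|lebesgue. indicator s x * c) = c * measure lebesgue s" for c :: real
      using sm by (auto simp: fmeasurable_def)
    have "(LINT x|lebesgue. indicator s x * l) \<le> (LINT x|lebesgue. indicator s x *\<^sub>R f x)"
      "(LINT x|lebesgue. indicator s x *\<^sub>R f x) \<le> (LINT x|lebesgue. indicator s x * L)"
      by (rule integral_mono[OF c(1) integrable_on_tile[OF f(1) s]], use f(2) in \<open>simp add: indicator_def\<close>)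
        (rule integral_mono[OF integrable_on_tile[OF f(1) s] c(1)], use f(3) in \<open>simp add: indicator_def\<close>)
    then show ?thesis unfolding mass_tile[OF s] set_lebesgue_integral_def c by simp
  qed
  have "l * m \<le> mass f s" if s: "s \<in> V" for s
    using bnd[OF s] mult_left_mono[OF m(2)[OF s], of l] f(4) by linarith
  then show "\<exists>m>0. \<forall>s\<in>V. m \<le> mass f s" using m(1) f(4) by (intro exI[of _ "l * m"]) auto
  have "\<bar>mass f s\<bar> \<le> L * measure lebesgue (cball (0::'a) D)" if s: "s \<in> V" for s
  proof -
    have "s \<subseteq> cball (ref s) D" using D_ref[OF s] by (auto simp: dist_commute)
    then have "measure lebesgue s \<le> measure lebesgue (cball (ref s) D)"
      using tile_compact[OF s] by (intro measure_mono_fmeasurable) (auto intro: lmeasurable_compact fmeasurableD)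
    also have "\<dots> = measure lebesgue (cball (0::'a) D)"
      using measure_shift[of "ref s" "cball 0 D"] cball_translation[of "ref s" 0 D] unfolding shift_def by simp
    finally have "L * measure lebesgue s \<le> L * measure lebesgue (cball (0::'a) D)" using L by simp
    moreover have "0 \<le> l * measure lebesgue s" using f(4) by simp
    ultimately show ?thesis using bnd[OF s] by linarith
  qed
  moreover have "L * measure lebesgue (cball (0::'a) D) \<ge> 0" using L by simp
  ultimately show "\<exists>A\<ge>0. \<forall>s\<in>V. \<bar>mass f s\<bar> \<le> A" by blast
qed

lemma PE_cells_mass:
  assumes "strongly_PE T f"
  shows "PE_cells (mass f)"
proof -
  obtain R where R: "R > 0" "\<And>x y. same_pattern T R x y \<Longrightarrow> f x = f y" and co: "continuous_on UNIV f"
    using assms unfolding strongly_PE_def by blast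
  have "mass f (shift w s) = mass f s" if x: "x \<in> s" and sp: "same_pattern T (R + D) x (x + w)" for s x w
  proof (cases "s \<in> V")
    case True
    have "x \<in> s \<inter> cball x (R + D)" using x R D_pos by simp
    then have V': "shift w s \<in> V" using tile_shift[OF sp _ True] by blast
    have m: "(\<lambda>z. indicator (shift w s) z *\<^sub>R f z) \<in> borel_measurable lebesgue"
      using integrable_on_tile[OF co V'] by (rule borel_measurable_integrable)
    have "f (w + z) = f z" if "z \<in> s" for z
    proof -
      have "same_pattern T R z (z + w)"
        using D_dist[OF True x that] by (intro same_pattern_shift[OF sp]) simp
      then show ?thesis using R(2) by (metis add.commute)
    qed
    then have "(LINT z:s|lebesgue. f (w + z)) = (LINT z:s|lebesgue. f z)"
      unfolding set_lebesgue_integral_def by (intro Bochner_Integration.integral_cong) (auto simp: indicator_def)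
    then show ?thesis using mass_tile[OF True] mass_tile[OF V'] set_integral_shift[OF m] by simp
  next
    case False
    have "x + w \<in> shift w s \<inter> cball (x + w) (R + D)" using x R D_pos by simp
    then have "shift w s \<inter> cball (x + w) (R + D) \<noteq> {}" by blast
    then have "shift w s \<notin> V"
      using tile_shift[OF same_pattern_back[OF sp], of "shift w s"] False by auto
    then show ?thesis using False by (simp add: mass_nontile)
  qed
  then show ?thesis unfolding PE_cells_def using R(1) D_pos by (intro exI[of _ "R + D"]) auto
qed

text \<open>
  The amount moved from tile to tile.  For a transport of range \<open>r\<close> the distance condition does not change
  the value; it provides a finite range without reference to the transport.
\<close>

definition coupling_of :: "real \<Rightarrow> ('a \<times> 'a \<Rightarrow> real) \<Rightarrow> 'a set \<Rightarrow> 'a set \<Rightarrow> real" where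
  "coupling_of r b s u =
     (if s \<in> V \<and> u \<in> V \<and> (\<forall>x\<in>s. \<forall>y\<in>u. dist x y \<le> r + 2 * D) then (LINT z:s \<times> u|lebesgue. b z) else 0)"

lemma ranged_coupling_of: "ranged (r + 2 * D) (coupling_of r b)"
  by (auto simp: ranged_def coupling_of_def split: if_splits)

lemma coupling_of_tiles:
  assumes s: "s \<in> V" and u: "u \<in> V" and rng: "\<And>x y. dist x y > r \<Longrightarrow> b (x, y) = 0"
  shows "coupling_of r b s u = (LINT z:s \<times> u|lebesgue. b z)"
proof (cases "\<exists>x\<in>s. \<exists>y\<in>u. dist x y \<le> r")
  case True
  then obtain x y where xy: "x \<in> s" "y \<in> u" "dist x y \<le> r" by blast
  have "dist x' y' \<le> r + 2 * D" if "x' \<in> s" "y' \<in> u" for x' y'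
    using D_dist[OF s that(1) xy(1)] D_dist[OF u xy(2) that(2)] xy(3)
      dist_triangle[of x' y' x] dist_triangle[of x y' y] by linarith
  then show ?thesis using s u by (simp add: coupling_of_def)
next
  case False
  then have eq: "(\<lambda>z. indicator (s \<times> u) z *\<^sub>R b z) = (\<lambda>_. 0)"
    using rng by (auto simp: indicator_def not_le fun_eq_iff)
  have "(LINT z:s \<times> u|lebesgue. b z) = 0" unfolding set_lebesgue_integral_def eq by simp
  then show ?thesis by (simp add: coupling_of_def)
qed

lemma AE_not_frontier:
  assumes "finite N" "N \<subseteq> V"
  shows "AE y in lebesgue. y \<notin> (\<Union>u\<in>N. frontier u)"
proof -
  have "negligible (\<Union>u\<in>N. frontier u)"
    using assms tile_convex negligible_convex_frontier by (intro negligible_Union) auto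
  then show ?thesis
    by (intro AE_not_in) (simp add: negligible_iff_null_sets)
qed

text \<open>
  Off the frontiers a point belongs to one tile only.
\<close>

lemma tile_cover_once:
  assumes N: "finite N" "N \<subseteq> V" and u: "u \<in> N" "y \<in> u" and y: "y \<notin> (\<Union>u\<in>N. frontier u)"
  shows "(\<Sum>v\<in>N. indicator v y) = (1::ennreal)"
proof -
  have "y \<in> interior u" using u y closure_subset[of u] unfolding frontier_def by blast
  then have "y \<notin> v" if "v \<in> N" "v \<noteq> u" for v using tiles_disjoint[of u v] that u N by blast
  then have "(\<Sum>v\<in>N. indicator v y) = (\<Sum>v\<in>N. if v = u then 1 else (0::ennreal))"
    using u by (intro sum.cong) auto
  then show ?thesis using N(1) u(1) by simp
qed

text \<open>
  The tiles cover the support of \<open>h\<close>, and they overlap in null sets.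
\<close>

lemma nn_integral_over_tiles:
  fixes h :: "'a \<Rightarrow> ennreal"
  assumes N: "finite N" "N \<subseteq> V" and h: "\<And>y. h y \<noteq> 0 \<Longrightarrow> \<exists>u\<in>N. y \<in> u"
  shows "(\<integral>\<^sup>+ y. (\<Sum>u\<in>N. indicator u y * h y) \<partial>lebesgue) = (\<integral>\<^sup>+ y. h y \<partial>lebesgue)"
proof (rule nn_integral_cong_AE)
  show "AE y in lebesgue. (\<Sum>u\<in>N. indicator u y * h y) = h y"
    using AE_not_frontier[OF N]
  proof eventually_elim
    case (elim y)
    show ?case
    proof (cases "h y = 0")
      case False
      then obtain u where "u \<in> N" "y \<in> u" using h by blast
      from tile_cover_once[OF N this elim] show ?thesis by (simp add: sum_distrib_right[symmetric])
    qed simp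
  qed
qed

text \<open>
  The rows are computed by integrating over the target first, where the tiles within reach of \<open>s\<close> can be
  summed because they cover all targets and overlap in null sets; the columns by integrating over the source first.
\<close>

lemma coupling_of_transport:
  assumes b: "bounded_transport f1 f2 b" and rng: "\<And>x y. dist x y > r \<Longrightarrow> b (x, y) = 0" and r: "r \<ge> 0"
    and f: "\<And>x. f1 x \<ge> 0" "\<And>x. f2 x \<ge> 0" "continuous_on UNIV f1" "continuous_on UNIV f2"
  shows "coupling (r + 2 * D) (mass f1) (mass f2) (coupling_of r b)"
proof -
  have nn: "0 \<le> b z" for z using b unfolding bounded_transport_def by blast
  have si: "integrable lebesgue (\<lambda>z. indicator (s \<times> u) z *\<^sub>R b z)" if "s \<in> V" "u \<in> V" for s u
  proof -
    have "compact (s \<times> u)" using tile_compact that by (intro compact_Times)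
    then have "set_integrable lebesgue (s \<times> u) b" using b unfolding bounded_transport_def by blast
    then show ?thesis unfolding set_integrable_def .
  qed
  have m1: "AE x in lebesgue. has_bochner_integral lebesgue (\<lambda>y. b (x, y)) (f1 x)"
    and m2: "AE y in lebesgue. has_bochner_integral lebesgue (\<lambda>x. b (x, y)) (f2 y)"
    using b unfolding bounded_transport_def by blast+
  have hb: "(\<integral>\<^sup>+ y. ennreal (h y) \<partial>lebesgue) = ennreal c"
    if "has_bochner_integral lebesgue h c" "\<And>y. 0 \<le> h y" for h :: "'a \<Rightarrow> real" and c
    using that nn_integral_eq_integral[of lebesgue h] by (auto simp: has_bochner_integral_iff)
  have e: "ennreal (coupling_of r b s u) = (\<integral>\<^sup>+ z. indicator s (fst z) * indicator u (snd z) * ennreal (b z) \<partial>lebesgue)"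
    if "s \<in> V" "u \<in> V" for s u
  proof -
    have eq: "coupling_of r b s u = (LINT z:s \<times> u|lebesgue. b z)"
      by (rule coupling_of_tiles[OF that]) (rule rng)
    have "ennreal (coupling_of r b s u) = (\<integral>\<^sup>+ z. ennreal (indicator (s \<times> u) z *\<^sub>R b z) \<partial>lebesgue)"
      unfolding eq set_lebesgue_integral_def
      using si[OF that] nn by (intro nn_integral_eq_integral[symmetric]) auto
    also have "\<dots> = (\<integral>\<^sup>+ z. indicator s (fst z) * indicator u (snd z) * ennreal (b z) \<partial>lebesgue)"
      by (intro nn_integral_cong) (auto simp: indicator_def split: prod.splits)
    finally show ?thesis .
  qed
  have meas: "(\<lambda>z. indicator s (fst z) * indicator u (snd z) * ennreal (b z)) \<in> borel_measurable lebesgue"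
    if "s \<in> V" "u \<in> V" for s u
  proof -
    have "(\<lambda>z. ennreal (indicator (s \<times> u) z *\<^sub>R b z)) \<in> borel_measurable lebesgue"
      using si[OF that] by (intro measurable_compose[OF borel_measurable_integrable measurable_ennreal])
    moreover have "(\<lambda>z. ennreal (indicator (s \<times> u) z *\<^sub>R b z)) =
        (\<lambda>z. indicator s (fst z) * indicator u (snd z) * ennreal (b z))"
      by (auto simp: indicator_def fun_eq_iff)
    ultimately show ?thesis by simp
  qed
  have mass_nn: "ennreal (mass f s) = (\<integral>\<^sup>+ x. indicator s x * ennreal (f x) \<partial>lebesgue)"
    if "s \<in> V" "continuous_on UNIV f" "\<And>x. f x \<ge> 0" for f s
  proof -
    have "ennreal (mass f s) = (\<integral>\<^sup>+ x. ennreal (indicator s x *\<^sub>R f x) \<partial>lebesgue)"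
      unfolding mass_tile[OF that(1)] set_lebesgue_integral_def
      using integrable_on_tile[OF that(2,1)] that(3) by (intro nn_integral_eq_integral[symmetric]) auto
    also have "\<dots> = (\<integral>\<^sup>+ x. indicator s x * ennreal (f x) \<partial>lebesgue)"
      by (intro nn_integral_cong) (auto simp: indicator_def)
    finally show ?thesis .
  qed
  have c0: "0 \<le> coupling_of r b s u" for s u
    using nn by (auto simp: coupling_of_def set_lebesgue_integral_def intro!: integral_nonneg_AE)
  have m0: "0 \<le> mass f s" if "\<And>x. f x \<ge> 0" for f s
    using that by (cases "s \<in> V") (auto simp: mass_tile mass_nontile set_lebesgue_integral_def intro!: integral_nonneg_AE)
  have row: "(\<Sum>u | coupling_of r b s u \<noteq> 0. coupling_of r b s u) = mass f1 s" if s: "s \<in> V" for s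
  proof -
    obtain x0 where x0: "x0 \<in> s" using tile_nonempty[OF s] by blast
    define N where "N = near (r + 2 * D) x0"
    have N: "finite N" "N \<subseteq> V" by (simp add: N_def) (auto simp: N_def near_def)
    have "ennreal (\<Sum>u\<in>N. coupling_of r b s u) = (\<Sum>u\<in>N. ennreal (coupling_of r b s u))"
      using c0 by (simp add: sum_ennreal)
    also have "\<dots> = (\<Sum>u\<in>N. \<integral>\<^sup>+ z. indicator s (fst z) * indicator u (snd z) * ennreal (b z) \<partial>lebesgue)"
      using e s N by (intro sum.cong) auto
    also have "\<dots> = (\<integral>\<^sup>+ z. (\<Sum>u\<in>N. indicator s (fst z) * indicator u (snd z) * ennreal (b z)) \<partial>lebesgue)"
      using meas s N by (intro nn_integral_sum[symmetric]) auto
    also have "\<dots> = (\<integral>\<^sup>+ x. indicator s x * ennreal (f1 x) \<partial>lebesgue)"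
    proof (rule tonelli_lebesgue_fst)
      show "(\<lambda>z. \<Sum>u\<in>N. indicator s (fst z) * indicator u (snd z) * ennreal (b z)) \<in> borel_measurable lebesgue"
        using meas s N by (intro borel_measurable_sum) auto
      show "AE x in lebesgue. (\<integral>\<^sup>+ y. (\<Sum>u\<in>N. indicator s (fst (x, y)) * indicator u (snd (x, y)) * ennreal (b (x, y))) \<partial>lebesgue)
          = indicator s x * ennreal (f1 x)"
        using m1
      proof (rule AE_mp, intro AE_I2 impI)
        fix x assume hx: "has_bochner_integral lebesgue (\<lambda>y. b (x, y)) (f1 x)"
        show "(\<integral>\<^sup>+ y. (\<Sum>u\<in>N. indicator s (fst (x, y)) * indicator u (snd (x, y)) * ennreal (b (x, y))) \<partial>lebesgue)
          = indicator s x * ennreal (f1 x)"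
        proof (cases "x \<in> s")
          case True
          have "\<exists>u\<in>N. y \<in> u" if nz: "ennreal (b (x, y)) \<noteq> 0" for y
          proof -
            have "\<not> dist x y > r" using nz rng[of x y] by force
            then have "dist x0 y \<le> r + 2 * D"
              using D_dist[OF s x0 True] dist_triangle[of x0 y x] D_pos by linarith
            moreover obtain u where "u \<in> V" "y \<in> u" using tiles_cover by blast
            ultimately have "u \<in> N" "y \<in> u" by (auto simp: N_def near_def)
            then show ?thesis by blast
          qed
          from nn_integral_over_tiles[OF N this] True
          have "(\<integral>\<^sup>+ y. (\<Sum>u\<in>N. indicator s (fst (x, y)) * indicator u (snd (x, y)) * ennreal (b (x, y))) \<partial>lebesgue)
             = (\<integral>\<^sup>+ y. ennreal (b (x, y)) \<partial>lebesgue)"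
            by simp
          then show ?thesis using True hb[OF hx nn] by simp
        next
          case False
          then show ?thesis by simp
        qed
      qed
    qed
    also have "\<dots> = ennreal (mass f1 s)" using mass_nn[OF s f(3,1)] by simp
    finally have "(\<Sum>u\<in>N. coupling_of r b s u) = mass f1 s"
      using c0 m0[OF f(1)] by (simp add: sum_nonneg)
    moreover have "{u. coupling_of r b s u \<noteq> 0} \<subseteq> N"
      using ranged_support(1)[OF ranged_coupling_of x0] by (simp add: N_def)
    ultimately show ?thesis using sum_support[OF N(1), of "coupling_of r b s"] by simp
  qed
  have col: "(\<Sum>s | coupling_of r b s u \<noteq> 0. coupling_of r b s u) = mass f2 u" if u: "u \<in> V" for u
  proof -
    obtain y0 where y0: "y0 \<in> u" using tile_nonempty[OF u] by blast
    define N where "N = near (r + 2 * D) y0"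
    have N: "finite N" "N \<subseteq> V" by (simp add: N_def) (auto simp: N_def near_def)
    have "ennreal (\<Sum>s\<in>N. coupling_of r b s u) = (\<Sum>s\<in>N. ennreal (coupling_of r b s u))"
      using c0 by (simp add: sum_ennreal)
    also have "\<dots> = (\<Sum>s\<in>N. \<integral>\<^sup>+ z. indicator s (fst z) * indicator u (snd z) * ennreal (b z) \<partial>lebesgue)"
      using e u N by (intro sum.cong) auto
    also have "\<dots> = (\<integral>\<^sup>+ z. (\<Sum>s\<in>N. indicator s (fst z) * indicator u (snd z) * ennreal (b z)) \<partial>lebesgue)"
      using meas u N by (intro nn_integral_sum[symmetric]) auto
    also have "\<dots> = (\<integral>\<^sup>+ y. indicator u y * ennreal (f2 y) \<partial>lebesgue)"
    proof (rule tonelli_lebesgue_snd)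
      show "(\<lambda>z. \<Sum>s\<in>N. indicator s (fst z) * indicator u (snd z) * ennreal (b z)) \<in> borel_measurable lebesgue"
        using meas u N by (intro borel_measurable_sum) auto
      show "AE y in lebesgue. (\<integral>\<^sup>+ x. (\<Sum>s\<in>N. indicator s (fst (x, y)) * indicator u (snd (x, y)) * ennreal (b (x, y))) \<partial>lebesgue)
          = indicator u y * ennreal (f2 y)"
        using m2
      proof (rule AE_mp, intro AE_I2 impI)
        fix y assume hy: "has_bochner_integral lebesgue (\<lambda>x. b (x, y)) (f2 y)"
        show "(\<integral>\<^sup>+ x. (\<Sum>s\<in>N. indicator s (fst (x, y)) * indicator u (snd (x, y)) * ennreal (b (x, y))) \<partial>lebesgue)
          = indicator u y * ennreal (f2 y)"
        proof (cases "y \<in> u")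
          case True
          have "\<exists>s\<in>N. x \<in> s" if nz: "ennreal (b (x, y)) \<noteq> 0" for x
          proof -
            have "\<not> dist x y > r" using nz rng[of x y] by force
            then have "dist y0 x \<le> r + 2 * D"
              using D_dist[OF u y0 True] dist_triangle[of y0 x y] D_pos by (simp add: dist_commute)
            moreover obtain s where "s \<in> V" "x \<in> s" using tiles_cover by blast
            ultimately have "s \<in> N" "x \<in> s" by (auto simp: N_def near_def)
            then show ?thesis by blast
          qed
          from nn_integral_over_tiles[OF N this] True
          have "(\<integral>\<^sup>+ x. (\<Sum>s\<in>N. indicator s (fst (x, y)) * indicator u (snd (x, y)) * ennreal (b (x, y))) \<partial>lebesgue)
             = (\<integral>\<^sup>+ x. ennreal (b (x, y)) \<partial>lebesgue)"
            by simp
          then show ?thesis using True hb[OF hy nn] by simp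
        next
          case False
          then show ?thesis by simp
        qed
      qed
    qed
    also have "\<dots> = ennreal (mass f2 u)" using mass_nn[OF u f(4,2)] by simp
    finally have "(\<Sum>s\<in>N. coupling_of r b s u) = mass f2 u"
      using c0 m0[OF f(2)] by (simp add: sum_nonneg)
    moreover have "{s. coupling_of r b s u \<noteq> 0} \<subseteq> N"
      using ranged_support(2)[OF ranged_coupling_of y0] by (simp add: N_def)
    ultimately show ?thesis using sum_support[OF N(1), of "\<lambda>s. coupling_of r b s u"] by simp
  qed
  show ?thesis unfolding coupling_def using ranged_coupling_of c0 row col by blast
qed

end

section \<open>From couplings of tiles to transports\<close>

context flc_tiling
begin

text \<open>
  Translation invariance of Lebesgue measure, applied to a product of tiles.
\<close>

lemma PE_kernel_coupling_of:
  assumes b: "bounded_transport f1 f2 b" and pe: "strongly_PE2 T b"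
  shows "PE_kernel (coupling_of r b)"
proof -
  obtain R where R: "R > 0" "\<And>x x' v. same_pattern T R x x' \<Longrightarrow> b (x, x + v) = b (x', x' + v)"
    using pe unfolding strongly_PE2_def by blast
  have "R + D > 0" using R D_pos by simp
  then show ?thesis
  proof (rule PE_kernelI[OF ranged_coupling_of])
    fix s u x w
    assume V: "s \<in> V" "u \<in> V" and x: "x \<in> s" and nz: "coupling_of r b s u \<noteq> 0"
      and sp: "same_pattern T (R + D) x (x + w)" and V': "shift w s \<in> V" "shift w u \<in> V"
    have c: "\<forall>x\<in>s. \<forall>y\<in>u. dist x y \<le> r + 2 * D"
      using nz unfolding coupling_of_def by presburger
    have c': "\<forall>x\<in>shift w s. \<forall>y\<in>shift w u. dist x y \<le> r + 2 * D"
    proof (intro ballI)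
      fix p q assume "p \<in> shift w s" "q \<in> shift w u"
      then have "dist (p - w) (q - w) \<le> r + 2 * D" using c by simp
      then show "dist p q \<le> r + 2 * D" by (simp add: dist_norm)
    qed
    have prod: "shift w s \<times> shift w u = shift (w, w) (s \<times> u)" by auto
    have "compact (shift w s \<times> shift w u)" using tile_compact V' by (intro compact_Times)
    then have "set_integrable lebesgue (shift (w, w) (s \<times> u)) b"
      using b unfolding bounded_transport_def prod by blast
    then have m: "(\<lambda>z. indicator (shift (w, w) (s \<times> u)) z *\<^sub>R b z) \<in> borel_measurable lebesgue"
      unfolding set_integrable_def by (rule borel_measurable_integrable)
    have eq: "b ((w, w) + z) = b z" if z: "z \<in> s \<times> u" for z
    proof -
      obtain p q where pq: "z = (p, q)" "p \<in> s" "q \<in> u" using z by blast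
      have "same_pattern T R p (p + w)"
        using D_dist[OF V(1) x pq(2)] by (intro same_pattern_shift[OF sp]) simp
      then have "b (p, p + (q - p)) = b (p + w, p + w + (q - p))" by (rule R(2))
      then show ?thesis by (simp add: pq add.commute)
    qed
    have "(LINT z:shift w s \<times> shift w u|lebesgue. b z) = (LINT z:s \<times> u|lebesgue. b ((w, w) + z))"
      unfolding prod by (rule set_integral_shift[OF m])
    also have "\<dots> = (LINT z:s \<times> u|lebesgue. b z)"
      unfolding set_lebesgue_integral_def
      by (intro Bochner_Integration.integral_cong refl) (use eq in \<open>auto simp: indicator_def simp del: plus_prod_def\<close>)
    finally show "coupling_of r b (shift w s) (shift w u) = coupling_of r b s u"
      unfolding coupling_of_def using V V' c c' by simp
  qed
qed

text \<open>
  The range of the approximating kernels is fixed in advance, so that all sums over partners stay uniformly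
  finite in the limit.
\<close>

definition weakly_PE_kernel :: "real \<Rightarrow> ('a set \<Rightarrow> 'a set \<Rightarrow> real) \<Rightarrow> bool" where
  "weakly_PE_kernel r \<phi> \<longleftrightarrow>
     (\<forall>e>0. \<exists>\<psi>. PE_kernel \<psi> \<and> ranged r \<psi> \<and> (\<forall>s u. \<bar>\<phi> s u - \<psi> s u\<bar> \<le> e))"

text \<open>
  The definition provides approximations separately for every pair of compact sets.  Only finitely many
  pairs are needed, namely the tiles moved to the origin; the remaining dependence on the tiles is through
  their reference points.
\<close>

lemma weakly_PE_coupling_of:
  assumes b: "weakly_PE_transport T f1 f2 b" and rng: "\<And>x y. dist x y > r \<Longrightarrow> b (x, y) = 0"
  shows "weakly_PE_kernel (r + 2 * D) (coupling_of r b)"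
  unfolding weakly_PE_kernel_def
proof (intro allI impI)
  fix e :: real assume e: "e > 0"
  let ?N = "norm_tile ` V"
  let ?I = "\<lambda>A B (x, y). LINT z:((+) x ` A) \<times> ((+) y ` B)|lebesgue. b z"
  define good where "good A B h R \<longleftrightarrow> R > (0::real) \<and>
      (\<forall>x x'. same_pattern T R x x' \<longrightarrow> (\<forall>v. h (x, x + v) = h (x', x' + v))) \<and> (\<forall>z. \<bar>h z - ?I A B z\<bar> \<le> e)" for A B h R
  have ex: "\<exists>h R. good A B h R" if AB: "A \<in> ?N" "B \<in> ?N" for A B
  proof -
    have cpt: "compact A" if "A \<in> ?N" for A
    proof -
      obtain s where s: "s \<in> V" "A = shift (- ref s) s" using \<open>A \<in> ?N\<close> by (auto simp: norm_tile_def)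
      then show ?thesis unfolding s(2) shift_def by (intro compact_translation tile_compact)
    qed
    then have "weakly_PE2 T (?I A B)" using b AB unfolding weakly_PE_transport_def by blast
    then obtain h where h: "\<And>j. strongly_PE2 T (h j)" "uniform_limit UNIV h (?I A B) sequentially"
      unfolding weakly_PE2_def by blast
    obtain j where "\<And>z. \<bar>h j z - ?I A B z\<bar> \<le> e" using uniform_limit_le[OF h(2) e] by auto
    then show ?thesis using h(1)[of j] unfolding strongly_PE2_def good_def by blast
  qed
  then obtain h R where "\<And>A B. A \<in> ?N \<Longrightarrow> B \<in> ?N \<Longrightarrow> good A B (h A B) (R A B)" by metis
  then have h: "\<And>A B. A \<in> ?N \<Longrightarrow> B \<in> ?N \<Longrightarrow> R A B > (0::real)"
      "\<And>A B x x' v. A \<in> ?N \<Longrightarrow> B \<in> ?N \<Longrightarrow> same_pattern T (R A B) x x' \<Longrightarrow> h A B (x, x + v) = h A B (x', x' + v)"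
      "\<And>A B z. A \<in> ?N \<Longrightarrow> B \<in> ?N \<Longrightarrow> \<bar>h A B z - ?I A B z\<bar> \<le> e"
    unfolding good_def by blast+
  define near2 where "near2 s u \<longleftrightarrow> s \<in> V \<and> u \<in> V \<and> (\<forall>x\<in>s. \<forall>y\<in>u. dist x y \<le> r + 2 * D)" for s u
  define \<psi> where "\<psi> s u = (if near2 s u then h (norm_tile s) (norm_tile u) (ref s, ref u) else 0)" for s u
  have rg: "ranged (r + 2 * D) \<psi>" by (auto simp: ranged_def \<psi>_def near2_def split: if_splits)
  define M where "M = Max (insert 1 ((\<lambda>(A, B). R A B) ` (?N \<times> ?N)))"
  have M: "R A B \<le> M" if "A \<in> ?N" "B \<in> ?N" for A B
    unfolding M_def using finite_norm_tiles that by (intro Max_ge) auto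
  have "1 \<le> M" unfolding M_def using finite_norm_tiles by (intro Max_ge) auto
  then have "M + D > 0" using D_pos by simp
  then have "PE_kernel \<psi>"
  proof (rule PE_kernelI[OF rg])
    fix s u x w
    assume V: "s \<in> V" "u \<in> V" and x: "x \<in> s" and nz: "\<psi> s u \<noteq> 0"
      and sp: "same_pattern T (M + D) x (x + w)" and V': "shift w s \<in> V" "shift w u \<in> V"
    have c: "near2 s u" using nz unfolding \<psi>_def by presburger
    have c': "near2 (shift w s) (shift w u)"
      unfolding near2_def
    proof (intro conjI V' ballI)
      fix p q assume "p \<in> shift w s" "q \<in> shift w u"
      then have "dist (p - w) (q - w) \<le> r + 2 * D" using c by (simp add: near2_def)
      then show "dist p q \<le> r + 2 * D" by (simp add: dist_norm)
    qed
    have N: "norm_tile s \<in> ?N" "norm_tile u \<in> ?N" using V by auto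
    have "same_pattern T (R (norm_tile s) (norm_tile u)) (ref s) (ref s + w)"
      using D_ref[OF V(1) x] M[OF N] by (intro same_pattern_shift[OF sp]) simp
    from h(2)[OF N this, of "ref u - ref s"]
    show "\<psi> (shift w s) (shift w u) = \<psi> s u"
      using c c' by (simp add: \<psi>_def norm_tile_shift[OF V(1)] norm_tile_shift[OF V(2)]
          tile_ref_shift[OF V(1)] tile_ref_shift[OF V(2)] add.commute)
  qed
  moreover have "\<bar>coupling_of r b s u - \<psi> s u\<bar> \<le> e" for s u
  proof (cases "near2 s u")
    case True
    then have V: "s \<in> V" "u \<in> V" by (auto simp: near2_def)
    have "(+) (ref s) ` norm_tile s = s" "(+) (ref u) ` norm_tile u = u"
      using tile_eq_shift_norm[of s] tile_eq_shift_norm[of u] by (simp_all only: shift_def)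
    then have "?I (norm_tile s) (norm_tile u) (ref s, ref u) = (LINT z:s \<times> u|lebesgue. b z)" by simp
    moreover have "coupling_of r b s u = (LINT z:s \<times> u|lebesgue. b z)"
      by (rule coupling_of_tiles[OF V]) (rule rng)
    moreover have "norm_tile s \<in> ?N" "norm_tile u \<in> ?N" using V by auto
    ultimately show ?thesis
      using h(3)[of "norm_tile s" "norm_tile u" "(ref s, ref u)"] True
      by (simp add: \<psi>_def abs_minus_commute)
  next
    case False
    have "coupling_of r b s u = 0" using False unfolding coupling_of_def near2_def by (rule if_not_P)
    moreover have "\<psi> s u = 0" using False unfolding \<psi>_def by (rule if_not_P)
    ultimately show ?thesis using e by simp
  qed
  ultimately show "\<exists>\<psi>. PE_kernel \<psi> \<and> ranged (r + 2 * D) \<psi> \<and> (\<forall>s u. \<bar>coupling_of r b s u - \<psi> s u\<bar> \<le> e)"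
    using rg by blast
qed

text \<open>
  The tile whose interior contains \<open>x\<close>, with the empty set as default on the null set of boundary points;
  kernels of finite range vanish on the default.
\<close>

definition cell_at :: "'a \<Rightarrow> 'a set" where
  "cell_at x = (if \<exists>s\<in>V. x \<in> interior s then THE s. s \<in> V \<and> x \<in> interior s else {})"

lemma cell_at_eq:
  assumes "s \<in> V" "x \<in> interior s"
  shows "cell_at x = s"
proof -
  have "(THE s. s \<in> V \<and> x \<in> interior s) = s"
  proof (rule the_equality)
    fix u assume u: "u \<in> V \<and> x \<in> interior u"
    then have "x \<in> interior s \<inter> u" using assms interior_subset by blast
    then show "u = s" using tiles_disjoint[of s u] assms u by blast
  qed (use assms in blast)
  then show ?thesis unfolding cell_at_def using assms by auto
qed

lemma empty_not_tile: "{} \<notin> V"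
  using tile_nonempty by blast

lemma cell_at_interior:
  assumes "cell_at x \<in> V"
  shows "x \<in> interior (cell_at x)"
proof -
  have "\<exists>s\<in>V. x \<in> interior s"
  proof (rule ccontr)
    assume "\<not> (\<exists>s\<in>V. x \<in> interior s)"
    then have "cell_at x = {}" unfolding cell_at_def by (rule if_not_P)
    then show False using assms empty_not_tile by simp
  qed
  then obtain s where s: "s \<in> V" "x \<in> interior s" by blast
  then show ?thesis using cell_at_eq[OF s] by simp
qed

lemma cell_at_mem: "cell_at x \<in> V \<Longrightarrow> x \<in> cell_at x"
  using cell_at_interior interior_subset by blast

lemma interior_iff_cell_at: "s \<in> V \<Longrightarrow> x \<in> interior s \<longleftrightarrow> cell_at x = s"
  using cell_at_eq cell_at_interior by blast

lemma cell_at_nontile: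
  assumes "cell_at x \<notin> V"
  shows "cell_at x = {}"
proof -
  have "\<not> (\<exists>s\<in>V. x \<in> interior s)"
  proof
    assume "\<exists>s\<in>V. x \<in> interior s"
    then obtain s where s: "s \<in> V" "x \<in> interior s" by blast
    then show False using cell_at_eq[OF s] assms by simp
  qed
  then show ?thesis unfolding cell_at_def by (rule if_not_P)
qed

text \<open>
  The tile at a point is visible in the pattern of radius 0.
\<close>

lemma cell_at_shift:
  assumes sp: "same_pattern T 0 x (x + w)"
  shows "cell_at (x + w) = shift w (cell_at x)"
proof -
  have main: "cell_at (x + w) = shift w (cell_at x)" if V: "cell_at x \<in> V" and sp: "same_pattern T 0 x (x + w)" for x w
  proof -
    have i: "x \<in> interior (cell_at x)" using cell_at_interior[OF V] .
    have "cell_at x \<inter> cball x 0 \<noteq> {}" using cell_at_mem[OF V] by simp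
    then have V': "shift w (cell_at x) \<in> V" using tile_shift[OF sp _ V] by blast
    have "interior (shift w (cell_at x)) = shift w (interior (cell_at x))"
      unfolding shift_def by (rule interior_translation)
    then have "x + w \<in> interior (shift w (cell_at x))" using i by simp
    then show ?thesis using cell_at_eq[OF V'] by blast
  qed
  show ?thesis
  proof (cases "cell_at x \<in> V")
    case True
    then show ?thesis using main sp by blast
  next
    case False
    show ?thesis
    proof (cases "cell_at (x + w) \<in> V")
      case True
      have "cell_at x = shift (- w) (cell_at (x + w))"
        using main[OF True same_pattern_back[OF sp]] by simp
      then show ?thesis by simp
    next
      case f: False
      have "shift w {} = {}" by (simp add: shift_def)
      then show ?thesis using cell_at_nontile[OF False] cell_at_nontile[OF f] by simp
    qed
  qed
qed

lemma AE_cell_at: "AE x in lebesgue. cell_at x \<in> V"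
proof -
  have V: "V = (\<Union>n::nat. near (real n) 0)"
  proof (intro equalityI subsetI)
    fix s assume s: "s \<in> V"
    then obtain x where x: "x \<in> s" using tile_nonempty by blast
    obtain n :: nat where "norm x \<le> real n" using real_arch_simple by blast
    then have "s \<in> near (real n) 0" using s x by (auto simp: near_def)
    then show "s \<in> (\<Union>n::nat. near (real n) 0)" by blast
  qed (auto simp: near_def)
  have "countable V" by (subst V, rule countable_UN) (auto intro: countable_finite)
  then have neg: "negligible (\<Union>s\<in>V. frontier s)"
    using tile_convex negligible_convex_frontier by (intro negligible_countable_Union) auto
  have "AE x in lebesgue. x \<notin> (\<Union>s\<in>V. frontier s)"
    by (rule AE_not_in) (use neg in \<open>simp add: negligible_iff_null_sets\<close>)
  then show ?thesis
  proof eventually_elim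
    case (elim x)
    obtain s where s: "s \<in> V" "x \<in> s" using tiles_cover by blast
    then have "x \<in> interior s" using elim closure_subset[of s] unfolding frontier_def by blast
    then show ?case using cell_at_eq s(1) by simp
  qed
qed

text \<open>
  Within every pair of tiles the mass is spread proportionally to the two given densities.
\<close>

definition density :: "('a \<Rightarrow> real) \<Rightarrow> ('a \<Rightarrow> real) \<Rightarrow> ('a set \<Rightarrow> 'a set \<Rightarrow> real) \<Rightarrow> 'a \<times> 'a \<Rightarrow> real" where
  "density f1 f2 \<phi> = (\<lambda>(x, y). \<phi> (cell_at x) (cell_at y) / (mass f1 (cell_at x) * mass f2 (cell_at y)) * (f1 x * f2 y))"

lemma density_range:
  assumes "ranged r \<phi>" "dist x y > r"
  shows "density f1 f2 \<phi> (x, y) = 0"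
proof -
  have "\<phi> (cell_at x) (cell_at y) = 0"
  proof (rule ccontr)
    assume nz: "\<phi> (cell_at x) (cell_at y) \<noteq> 0"
    then have "cell_at x \<in> V" "cell_at y \<in> V" using rangedD[OF assms(1)] by blast+
    then have "dist x y \<le> r" using rangedD(3)[OF assms(1) nz] cell_at_mem by blast
    then show False using assms(2) by simp
  qed
  then show ?thesis by (simp add: density_def)
qed

text \<open>
  On a compact set the density is a finite sum of continuous functions cut off by indicators of products
  of interiors of tiles.
\<close>

lemma density_integrable:
  assumes rg: "ranged r \<phi>" and f: "continuous_on UNIV f1" "continuous_on UNIV f2" and S: "compact S"
  shows "integrable lebesgue (\<lambda>z. indicator S z *\<^sub>R density f1 f2 \<phi> z)"
proof -
  obtain \<rho> where \<rho>: "\<And>z. z \<in> S \<Longrightarrow> norm z \<le> \<rho>" using compact_imp_bounded[OF S] by (auto simp: bounded_iff)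
  define N where "N = near \<rho> 0"
  have N: "finite N" by (simp add: N_def)
  have NV: "N \<subseteq> V" by (auto simp: N_def near_def)
  let ?c = "\<lambda>s u. \<phi> s u / (mass f1 s * mass f2 u)"
  let ?F = "\<lambda>z. indicator S z *\<^sub>R (f1 (fst z) * f2 (snd z))"
  have "continuous_on S (\<lambda>z. f1 (fst z) * f2 (snd z))"
    by (intro continuous_on_mult continuous_on_compose2[OF f(1)] continuous_on_compose2[OF f(2)]
        continuous_on_fst continuous_on_snd continuous_on_id) auto
  then have iF: "integrable lborel ?F" by (rule borel_integrable_compact[OF S])
  have "integrable lborel (\<lambda>z. indicator (interior s \<times> interior u) z *\<^sub>R ?F z)" for s u :: "'a set"
    by (rule integrable_mult_indicator[OF _ iF]) (simp add: open_Times borel_open)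
  then have i: "integrable lebesgue (\<lambda>z. indicator (interior s \<times> interior u) z *\<^sub>R ?F z)" for s u :: "'a set"
    by (subst integrable_completion) (auto intro: borel_measurable_integrable)
  have eq: "indicator S z *\<^sub>R density f1 f2 \<phi> z =
      (\<Sum>s\<in>N. \<Sum>u\<in>N. ?c s u * (indicator (interior s \<times> interior u) z *\<^sub>R ?F z))" for z
  proof (cases "z \<in> S")
    case True
    obtain x y where z: "z = (x, y)" by fastforce
    have nx: "norm x \<le> \<rho>" "norm y \<le> \<rho>"
      using \<rho>[OF True] norm_fst_le[of x y] norm_snd_le[of y x] unfolding z by linarith+
    have mem: "cell_at p \<in> N" if "cell_at p \<in> V" "norm p \<le> \<rho>" for p
      using that cell_at_mem[OF that(1)] by (auto simp: N_def near_def)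
    have ind: "indicator (interior s \<times> interior u) z = (if s = cell_at x then 1 else 0) * (if u = cell_at y then 1 else (0::real))"
      if "s \<in> N" "u \<in> N" for s u
      using interior_iff_cell_at NV that by (auto simp: z indicator_def)
    have "(\<Sum>s\<in>N. \<Sum>u\<in>N. ?c s u * (indicator (interior s \<times> interior u) z *\<^sub>R ?F z)) =
        (\<Sum>s\<in>N. if s = cell_at x then (\<Sum>u\<in>N. if u = cell_at y then ?c s u * ?F z else 0) else 0)"
    proof (rule sum.cong[OF refl])
      fix s assume s: "s \<in> N"
      have t: "?c s u * (indicator (interior s \<times> interior u) z *\<^sub>R ?F z) =
          (if s = cell_at x then if u = cell_at y then ?c s u * ?F z else 0 else 0)" if "u \<in> N" for u
        unfolding ind[OF s that] by simp
      have t': "(\<Sum>u\<in>N. ?c s u * (indicator (interior s \<times> interior u) z *\<^sub>R ?F z)) =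
          (\<Sum>u\<in>N. if s = cell_at x then if u = cell_at y then ?c s u * ?F z else 0 else 0)"
        by (rule sum.cong[OF refl]) (rule t)
      show "(\<Sum>u\<in>N. ?c s u * (indicator (interior s \<times> interior u) z *\<^sub>R ?F z)) =
          (if s = cell_at x then (\<Sum>u\<in>N. if u = cell_at y then ?c s u * ?F z else 0) else 0)"
        unfolding t' by (cases "s = cell_at x") simp_all
    qed
    also have "\<dots> = (if cell_at x \<in> N \<and> cell_at y \<in> N then ?c (cell_at x) (cell_at y) * ?F z else 0)"
      using N by simp
    also have "\<dots> = indicator S z *\<^sub>R density f1 f2 \<phi> z"
    proof (cases "\<phi> (cell_at x) (cell_at y) = 0")
      case True
      then show ?thesis by (simp add: density_def z)
    next
      case False
      then have "cell_at x \<in> V" "cell_at y \<in> V" using rangedD[OF rg] by blast+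
      then show ?thesis using mem nx by (simp add: density_def z)
    qed
    finally show ?thesis by simp
  next
    case False
    then show ?thesis by simp
  qed
  show ?thesis unfolding eq by (intro Bochner_Integration.integrable_sum integrable_mult_right i)
qed

lemma density_marginal:
  assumes c: "coupling r (mass f1) (mass f2) \<phi>" and f2: "continuous_on UNIV f2"
    and m: "\<And>s. s \<in> V \<Longrightarrow> mass f1 s > 0" "\<And>s. s \<in> V \<Longrightarrow> mass f2 s > 0"
    and x: "cell_at x \<in> V"
  shows "has_bochner_integral lebesgue (\<lambda>y. density f1 f2 \<phi> (x, y)) (f1 x)"
proof -
  let ?s = "cell_at x"
  have rg: "ranged r \<phi>" using c by (simp add: coupling_def)
  define N where "N = near r x"
  have N: "finite N" by (simp add: N_def)
  have NV: "N \<subseteq> V" by (auto simp: N_def near_def)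
  have sN: "{u. \<phi> ?s u \<noteq> 0} \<subseteq> N"
    using ranged_support(1)[OF rg cell_at_mem[OF x]] by (simp add: N_def)
  let ?c = "\<lambda>u. \<phi> ?s u / (mass f1 ?s * mass f2 u) * f1 x"
  have hb: "has_bochner_integral lebesgue (\<lambda>y. indicator (interior u) y *\<^sub>R f2 y) (mass f2 u)" if u: "u \<in> V" for u
  proof -
    have i: "integrable lebesgue (\<lambda>y. indicator u y *\<^sub>R f2 y)" by (rule integrable_on_tile[OF f2 u])
    have "AE y in lebesgue. y \<notin> (\<Union>u\<in>{u}. frontier u)" by (rule AE_not_frontier) (use u in auto)
    then have ae: "AE y in lebesgue. indicator u y *\<^sub>R f2 y = indicator (interior u) y *\<^sub>R f2 y"
      by eventually_elim (use closure_subset[of u] interior_subset[of u] in \<open>auto simp: indicator_def frontier_def\<close>)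
    have "f2 \<in> borel_measurable lborel" using f2 by (simp add: borel_measurable_continuous_onI)
    then have "(\<lambda>y. indicator (interior u) y *\<^sub>R f2 y) \<in> borel_measurable lborel" by measurable
    then have m: "(\<lambda>y. indicator (interior u) y *\<^sub>R f2 y) \<in> borel_measurable lebesgue" by (rule measurable_completion)
    have "integrable lebesgue (\<lambda>y. indicator (interior u) y *\<^sub>R f2 y)"
      using integrable_cong_AE[OF borel_measurable_integrable[OF i] m ae] i by blast
    moreover have "(LINT y|lebesgue. indicator (interior u) y *\<^sub>R f2 y) = mass f2 u"
      unfolding mass_tile[OF u] set_lebesgue_integral_def
      by (rule integral_cong_AE[OF borel_measurable_integrable[OF i] m ae, symmetric])
    ultimately show ?thesis by (simp add: has_bochner_integral_iff)
  qed
  have "has_bochner_integral lebesgue (\<lambda>y. \<Sum>u\<in>N. ?c u * (indicator (interior u) y *\<^sub>R f2 y)) (\<Sum>u\<in>N. ?c u * mass f2 u)"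
    using hb NV by (intro has_bochner_integral_sum has_bochner_integral_mult_right) auto
  moreover have "(\<Sum>u\<in>N. ?c u * (indicator (interior u) y *\<^sub>R f2 y)) = density f1 f2 \<phi> (x, y)" for y
  proof -
    have "(\<Sum>u\<in>N. ?c u * (indicator (interior u) y *\<^sub>R f2 y)) = (\<Sum>u\<in>N. if u = cell_at y then ?c u * f2 y else 0)"
      using interior_iff_cell_at NV by (intro sum.cong refl) (auto simp: indicator_def)
    also have "\<dots> = (if cell_at y \<in> N then ?c (cell_at y) * f2 y else 0)" using N by simp
    also have "\<dots> = density f1 f2 \<phi> (x, y)" using sN by (auto simp: density_def)
    finally show ?thesis .
  qed
  moreover have "(\<Sum>u\<in>N. ?c u * mass f2 u) = f1 x"
  proof -
    have "(\<Sum>u\<in>N. ?c u * mass f2 u) = (\<Sum>u\<in>N. \<phi> ?s u) * (f1 x / mass f1 ?s)"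
      unfolding sum_distrib_right
    proof (rule sum.cong[OF refl])
      fix u assume "u \<in> N"
      then have "mass f2 u > 0" using m(2) NV by blast
      then show "?c u * mass f2 u = \<phi> ?s u * (f1 x / mass f1 ?s)" by (simp add: field_simps)
    qed
    also have "(\<Sum>u\<in>N. \<phi> ?s u) = mass f1 ?s" using sum_support[OF N sN] c x by (simp add: coupling_def)
    finally show ?thesis using m(1)[OF x] by simp
  qed
  ultimately show ?thesis by simp
qed

text \<open>
  Exchanging source and target turns statements about the first marginal into statements about the second.
\<close>

lemma coupling_swap:
  assumes "coupling r a b \<phi>"
  shows "coupling r b a (\<lambda>u s. \<phi> s u)"
proof -
  have rg: "ranged r \<phi>" using assms by (simp add: coupling_def)
  have "ranged r (\<lambda>u s. \<phi> s u)"
    unfolding ranged_def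
  proof (intro allI impI)
    fix u s assume nz: "\<phi> s u \<noteq> 0"
    then have "dist y x \<le> r" if "y \<in> u" "x \<in> s" for x y
      using rangedD(3)[OF rg nz that(2,1)] by (simp add: dist_commute)
    then show "u \<in> V \<and> s \<in> V \<and> (\<forall>y\<in>u. \<forall>x\<in>s. dist y x \<le> r)" using rangedD(1,2)[OF rg nz] by blast
  qed
  then show ?thesis using assms by (simp add: coupling_def)
qed

lemma bounded_transport_density:
  assumes c: "coupling r (mass f1) (mass f2) \<phi>" and f: "continuous_on UNIV f1" "continuous_on UNIV f2"
    and p: "\<And>x. f1 x > 0" "\<And>x. f2 x > 0"
    and m: "\<And>s. s \<in> V \<Longrightarrow> mass f1 s > 0" "\<And>s. s \<in> V \<Longrightarrow> mass f2 s > 0"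
  shows "bounded_transport f1 f2 (density f1 f2 \<phi>)"
proof -
  have rg: "ranged r \<phi>" and nn: "\<And>s u. 0 \<le> \<phi> s u" using c by (auto simp: coupling_def)
  have "0 \<le> density f1 f2 \<phi> z" for z
  proof (cases z)
    case (Pair x y)
    show ?thesis
    proof (cases "\<phi> (cell_at x) (cell_at y) = 0")
      case False
      then have "cell_at x \<in> V" "cell_at y \<in> V" using rangedD[OF rg] by blast+
      then show ?thesis using m nn p by (simp add: density_def Pair less_imp_le)
    qed (simp add: density_def Pair)
  qed
  moreover have "set_integrable lebesgue K (density f1 f2 \<phi>)" if "compact K" for K
    unfolding set_integrable_def by (rule density_integrable[OF rg f that])
  moreover have "AE x in lebesgue. has_bochner_integral lebesgue (\<lambda>y. density f1 f2 \<phi> (x, y)) (f1 x)"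
    using AE_cell_at by eventually_elim (rule density_marginal[OF c f(2) m])
  moreover have "AE y in lebesgue. has_bochner_integral lebesgue (\<lambda>x. density f1 f2 \<phi> (x, y)) (f2 y)"
    using AE_cell_at
  proof eventually_elim
    case (elim y)
    have "(\<lambda>x. density f1 f2 \<phi> (x, y)) = (\<lambda>x. density f2 f1 (\<lambda>u s. \<phi> s u) (y, x))"
      by (simp add: density_def mult.commute)
    then show ?case using density_marginal[OF coupling_swap[OF c] f(1) m(2,1) elim] by simp
  qed
  moreover have "\<exists>r. \<forall>x y. dist x y > r \<longrightarrow> density f1 f2 \<phi> (x, y) = 0"
    using density_range[OF rg] by blast
  ultimately show ?thesis unfolding bounded_transport_def by blast
qed

text \<open>
  If \<open>v\<close> exceeds the range, then both values are 0; otherwise the target \<open>x + v\<close> is visible from \<open>x\<close>.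
\<close>

lemma density_shift:
  assumes rg: "ranged r \<phi>" and pe: "PE_kernel \<phi>" and f: "strongly_PE T f1" "strongly_PE T f2"
  shows "strongly_PE2 T (density f1 f2 \<phi>)"
proof -
  obtain Rp where Rp: "Rp > 0" "\<And>s u x w. x \<in> s \<Longrightarrow> same_pattern T Rp x (x + w) \<Longrightarrow> \<phi> (shift w s) (shift w u) = \<phi> s u"
    using pe unfolding PE_kernel_def by blast
  obtain R1 where R1: "R1 > 0" "\<And>x y. same_pattern T R1 x y \<Longrightarrow> f1 x = f1 y"
    using f(1) unfolding strongly_PE_def by blast
  obtain R2 where R2: "R2 > 0" "\<And>x y. same_pattern T R2 x y \<Longrightarrow> f2 x = f2 y"
    using f(2) unfolding strongly_PE_def by blast
  obtain M1 where M1: "M1 > 0" "\<And>c x w. x \<in> c \<Longrightarrow> same_pattern T M1 x (x + w) \<Longrightarrow> mass f1 (shift w c) = mass f1 c"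
    using PE_cells_mass[OF f(1)] unfolding PE_cells_def by blast
  obtain M2 where M2: "M2 > 0" "\<And>c x w. x \<in> c \<Longrightarrow> same_pattern T M2 x (x + w) \<Longrightarrow> mass f2 (shift w c) = mass f2 c"
    using PE_cells_mass[OF f(2)] unfolding PE_cells_def by blast
  define R where "R = Rp + R1 + R2 + M1 + M2 + \<bar>r\<bar>"
  have main: "density f1 f2 \<phi> (x + w, x + w + v) = density f1 f2 \<phi> (x, x + v)"
    if sp: "same_pattern T R x (x + w)" for x w v
  proof (cases "norm v > r")
    case True
    then show ?thesis using density_range[OF rg, of _ "_ + v"] by (simp add: dist_norm)
  next
    case False
    let ?y = "x + v"
    have spx: "same_pattern T R' x (x + w)" if "R' \<le> R" for R' using same_pattern_mono[OF sp that] .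
    have spy: "same_pattern T R' ?y (?y + w)" if "R' + \<bar>r\<bar> \<le> R" for R'
      using False that by (intro same_pattern_shift[OF sp]) (simp add: dist_norm)
    have le: "0 \<le> R" "Rp \<le> R" "R1 \<le> R" "M1 \<le> R" "0 + \<bar>r\<bar> \<le> R" "R2 + \<bar>r\<bar> \<le> R" "M2 + \<bar>r\<bar> \<le> R"
      using Rp(1) R1(1) R2(1) M1(1) M2(1) by (auto simp: R_def)
    have cx: "cell_at (x + w) = shift w (cell_at x)" by (rule cell_at_shift[OF spx[OF le(1)]])
    have cy: "cell_at (?y + w) = shift w (cell_at ?y)" by (rule cell_at_shift[OF spy[OF le(5)]])
    have yw: "x + w + v = ?y + w" by (simp add: algebra_simps)
    have fx: "f1 (x + w) = f1 x" using R1(2)[OF spx[OF le(3)]] by simp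
    have fy: "f2 (?y + w) = f2 ?y" using R2(2)[OF spy[OF le(6)]] by simp
    show ?thesis
    proof (cases "cell_at x \<in> V \<and> cell_at ?y \<in> V")
      case True
      then have mx: "x \<in> cell_at x" and my: "?y \<in> cell_at ?y" using cell_at_mem by blast+
      show ?thesis
        unfolding density_def yw
        by (simp add: cx cy fx fy Rp(2)[OF mx spx[OF le(2)]] M1(2)[OF mx spx[OF le(4)]] M2(2)[OF my spy[OF le(7)]])
    next
      case False
      have z: "\<phi> (cell_at p) (cell_at q) = 0" if "cell_at p = {} \<or> cell_at q = {}" for p q
        using rangedD(1,2)[OF rg, of "cell_at p" "cell_at q"] empty_not_tile that by metis
      have e: "shift w {} = {}" by (simp add: shift_def)
      have "cell_at x = {} \<or> cell_at ?y = {}" using False cell_at_nontile by blast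
      moreover from this have "cell_at (x + w) = {} \<or> cell_at (?y + w) = {}" using cx cy e by metis
      ultimately show ?thesis unfolding density_def yw using z by simp
    qed
  qed
  have "density f1 f2 \<phi> (x, x + v) = density f1 f2 \<phi> (x', x' + v)" if "same_pattern T R x x'" for x x' v
    using main[of x "x' - x" v] that by simp
  moreover have "R > 0" using Rp(1) R1(1) R2(1) M1(1) M2(1) by (simp add: R_def)
  ultimately show ?thesis unfolding strongly_PE2_def by blast
qed

lemma density_close:
  assumes rg: "ranged r \<phi>" "ranged r \<psi>" and e: "\<And>s u. \<bar>\<phi> s u - \<psi> s u\<bar> \<le> e"
    and m: "m > 0" "\<And>s. s \<in> V \<Longrightarrow> m \<le> mass f1 s" "\<And>s. s \<in> V \<Longrightarrow> m \<le> mass f2 s"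
    and L: "\<And>x. \<bar>f1 x\<bar> \<le> L" "\<And>x. \<bar>f2 x\<bar> \<le> L"
  shows "\<bar>density f1 f2 \<phi> z - density f1 f2 \<psi> z\<bar> \<le> e * (L * L / (m * m))"
proof -
  obtain x y where z: "z = (x, y)" by fastforce
  have e0: "e \<ge> 0" using e[of "{}" "{}"] by linarith
  have L0: "L \<ge> 0" using L(1)[of 0] by linarith
  show ?thesis
  proof (cases "cell_at x \<in> V \<and> cell_at y \<in> V")
    case True
    then have mm: "m \<le> mass f1 (cell_at x)" "m \<le> mass f2 (cell_at y)" using m by auto
    then have mmm: "m * m \<le> mass f1 (cell_at x) * mass f2 (cell_at y)" using m(1) by (intro mult_mono) auto
    have "\<bar>density f1 f2 \<phi> z - density f1 f2 \<psi> z\<bar> =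
      \<bar>\<phi> (cell_at x) (cell_at y) - \<psi> (cell_at x) (cell_at y)\<bar> * (\<bar>f1 x\<bar> * \<bar>f2 y\<bar> / (mass f1 (cell_at x) * mass f2 (cell_at y)))"
    proof -
      have "density f1 f2 \<phi> z - density f1 f2 \<psi> z =
        (\<phi> (cell_at x) (cell_at y) - \<psi> (cell_at x) (cell_at y)) * (f1 x * f2 y / (mass f1 (cell_at x) * mass f2 (cell_at y)))"
        by (simp add: density_def z diff_divide_distrib algebra_simps)
      moreover have "mass f1 (cell_at x) > 0" "mass f2 (cell_at y) > 0" using mm m(1) by auto
      ultimately show ?thesis by (simp add: abs_mult)
    qed
    also have "\<dots> \<le> e * (L * L / (m * m))"
    proof (rule mult_mono[OF e _ e0])
      have "\<bar>f1 x\<bar> * \<bar>f2 y\<bar> \<le> L * L" using L L0 by (intro mult_mono) auto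
      then show "\<bar>f1 x\<bar> * \<bar>f2 y\<bar> / (mass f1 (cell_at x) * mass f2 (cell_at y)) \<le> L * L / (m * m)"
        using m(1) L0 by (intro frac_le mmm) auto
      show "0 \<le> \<bar>f1 x\<bar> * \<bar>f2 y\<bar> / (mass f1 (cell_at x) * mass f2 (cell_at y))"
        using mm m(1) by simp
    qed
    finally show ?thesis .
  next
    case False
    then have "\<phi> (cell_at x) (cell_at y) = 0" "\<psi> (cell_at x) (cell_at y) = 0"
      using rangedD(1,2)[OF rg(1)] rangedD(1,2)[OF rg(2)] by blast+
    then show ?thesis using e0 L0 m(1) by (simp add: density_def z)
  qed
qed

text \<open>
  The approximating kernels have strongly equivariant densities that converge uniformly, and the
  volume of the products over which they are integrated does not depend on their position.
\<close>

theorem weakly_PE_transport_density: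
  assumes c: "coupling r (mass f1) (mass f2) \<phi>" and w: "weakly_PE_kernel r \<phi>"
    and f: "strongly_PE T f1" "strongly_PE T f2" and p: "\<And>x. f1 x > 0" "\<And>x. f2 x > 0"
    and m: "m > 0" "\<And>s. s \<in> V \<Longrightarrow> m \<le> mass f1 s" "\<And>s. s \<in> V \<Longrightarrow> m \<le> mass f2 s"
    and L: "\<And>x. \<bar>f1 x\<bar> \<le> L" "\<And>x. \<bar>f2 x\<bar> \<le> L"
  shows "weakly_PE_transport T f1 f2 (density f1 f2 \<phi>)"
proof -
  have co: "continuous_on UNIV f1" "continuous_on UNIV f2" using f by (auto simp: strongly_PE_def)
  have mp: "mass f1 s > 0" "mass f2 s > 0" if "s \<in> V" for s using m that by force+
  have bt: "bounded_transport f1 f2 (density f1 f2 \<phi>)" by (rule bounded_transport_density[OF c co p mp])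
  have rg: "ranged r \<phi>" using c by (simp add: coupling_def)
  have "\<forall>j. \<exists>\<psi>. PE_kernel \<psi> \<and> ranged r \<psi> \<and> (\<forall>s u. \<bar>\<phi> s u - \<psi> s u\<bar> \<le> 1 / (real j + 1))"
    using w unfolding weakly_PE_kernel_def by (metis add.commute divide_pos_pos of_nat_0_less_iff of_nat_Suc zero_less_Suc zero_less_one)
  then obtain \<psi> where ps: "\<And>j. PE_kernel (\<psi> j)" "\<And>j. ranged r (\<psi> j)" "\<And>j s u. \<bar>\<phi> s u - \<psi> j s u\<bar> \<le> 1 / (real j + 1)"
    by metis
  have "weakly_PE2 T (\<lambda>(x, y). LINT z:((+) x ` A) \<times> ((+) y ` B)|lebesgue. density f1 f2 \<phi> z)"
    if A: "compact A" and B: "compact B" for A B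
  proof -
    let ?S = "\<lambda>x y. ((+) x ` A) \<times> ((+) y ` B)"
    have S: "?S x y = shift (x, y) (A \<times> B)" for x y by (auto simp: shift_def image_iff)
    have cS: "compact (?S x y)" for x y using A B by (intro compact_Times compact_translation)
    define h where "h j = (\<lambda>(x, y). LINT z:?S x y|lebesgue. density f1 f2 (\<psi> j) z)" for j
    have "strongly_PE2 T (h j)" for j
    proof -
      obtain R where R: "R > 0" "\<And>x x' v. same_pattern T R x x' \<Longrightarrow> density f1 f2 (\<psi> j) (x, x + v) = density f1 f2 (\<psi> j) (x', x' + v)"
        using density_shift[OF ps(2,1) f] unfolding strongly_PE2_def by blast
      obtain q where q: "q > 0" "\<And>a. a \<in> A \<Longrightarrow> norm a \<le> q" using compact_imp_bounded[OF A] by (auto simp: bounded_pos)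
      have "h j (x, x + v) = h j (x', x' + v)" if sp: "same_pattern T (R + q) x x'" for x x' v
      proof -
        define w where "w = x' - x"
        have sp': "same_pattern T (R + q) x (x + w)" using sp by (simp add: w_def)
        have S': "?S x' (x' + v) = shift (w, w) (?S x (x + v))" unfolding S by (simp add: w_def)
        have m: "(\<lambda>z. indicator (shift (w, w) (?S x (x + v))) z *\<^sub>R density f1 f2 (\<psi> j) z) \<in> borel_measurable lebesgue"
          unfolding S'[symmetric] by (rule borel_measurable_integrable[OF density_integrable[OF ps(2) co cS]])
        have eq: "density f1 f2 (\<psi> j) ((w, w) + z) = density f1 f2 (\<psi> j) z" if z: "z \<in> ?S x (x + v)" for z
        proof -
          obtain a y where ay: "z = (x + a, y)" "a \<in> A" using z by auto
          have "same_pattern T R (x + a) (x + a + w)"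
            using q(2)[OF ay(2)] by (intro same_pattern_shift[OF sp']) (simp add: dist_norm)
          from R(2)[OF this, of "y - (x + a)"] show ?thesis by (simp add: ay(1) algebra_simps)
        qed
        have "h j (x', x' + v) = (LINT z:?S x (x + v)|lebesgue. density f1 f2 (\<psi> j) ((w, w) + z))"
          unfolding h_def prod.case S' by (rule set_integral_shift[OF m])
        also have "\<dots> = h j (x, x + v)"
          unfolding h_def prod.case set_lebesgue_integral_def
          by (intro Bochner_Integration.integral_cong refl) (use eq in \<open>auto simp: indicator_def simp del: plus_prod_def\<close>)
        finally show ?thesis by simp
      qed
      then show ?thesis unfolding strongly_PE2_def using R(1) q(1) by (intro exI[of _ "R + q"]) auto
    qed
    moreover have "uniform_limit UNIV h (\<lambda>(x, y). LINT z:?S x y|lebesgue. density f1 f2 \<phi> z) sequentially"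
    proof (rule uniform_limit_rate)
      define C where "C = L * L / (m * m) * measure lebesgue (A \<times> B)"
      show "C \<ge> 0" using L(1)[of 0] m(1) unfolding C_def by (intro mult_nonneg_nonneg divide_nonneg_nonneg) auto
      have bnd: "\<bar>h j (x, y) - (LINT z:?S x y|lebesgue. density f1 f2 \<phi> z)\<bar> \<le> C * (1 / (real j + 1))" for j x y
      proof -
        let ?D = "\<lambda>z. density f1 f2 (\<psi> j) z - density f1 f2 \<phi> z"
        let ?k = "1 / (real j + 1) * (L * L / (m * m))"
        have i: "integrable lebesgue (\<lambda>z. indicator (?S x y) z *\<^sub>R density f1 f2 (\<psi> j) z)"
          "integrable lebesgue (\<lambda>z. indicator (?S x y) z *\<^sub>R density f1 f2 \<phi> z)"
          by (rule density_integrable[OF ps(2) co cS]) (rule density_integrable[OF rg co cS])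
        have eq: "h j (x, y) - (LINT z:?S x y|lebesgue. density f1 f2 \<phi> z) =
            (LINT z|lebesgue. indicator (?S x y) z *\<^sub>R density f1 f2 (\<psi> j) z - indicator (?S x y) z *\<^sub>R density f1 f2 \<phi> z)"
          unfolding h_def prod.case set_lebesgue_integral_def using i by simp
        have "\<bar>h j (x, y) - (LINT z:?S x y|lebesgue. density f1 f2 \<phi> z)\<bar> \<le> (LINT z|lebesgue. \<bar>indicator (?S x y) z *\<^sub>R density f1 f2 (\<psi> j) z - indicator (?S x y) z *\<^sub>R density f1 f2 \<phi> z\<bar>)"
          unfolding eq by (rule integral_abs_bound)
        also have "\<dots> \<le> (LINT z|lebesgue. indicator (?S x y) z * ?k)"
        proof (rule integral_mono)
          show "integrable lebesgue (\<lambda>z. \<bar>indicator (?S x y) z *\<^sub>R density f1 f2 (\<psi> j) z - indicator (?S x y) z *\<^sub>R density f1 f2 \<phi> z\<bar>)"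
            using i by simp
          show "integrable lebesgue (\<lambda>z. indicator (?S x y) z * ?k)"
            using lmeasurable_compact[OF cS[of x y]] by (intro integrable_mult_left) (auto simp: fmeasurable_def)
          fix z
          show "\<bar>indicator (?S x y) z *\<^sub>R density f1 f2 (\<psi> j) z - indicator (?S x y) z *\<^sub>R density f1 f2 \<phi> z\<bar> \<le> indicator (?S x y) z * ?k"
            using density_close[OF rg ps(2)[of j] ps(3) m L, of z] by (simp add: indicator_def abs_minus_commute)
        qed
        also have "\<dots> = measure lebesgue (?S x y) * ?k" by simp
        also have "measure lebesgue (?S x y) = measure lebesgue (A \<times> B)" unfolding S by (rule measure_shift)
        finally show ?thesis by (simp add: C_def algebra_simps)
      qed
      show "\<bar>h j z - (case z of (x, y) \<Rightarrow> LINT z:?S x y|lebesgue. density f1 f2 \<phi> z)\<bar> \<le> C * (1 / (real j + 1))" for j z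
        using bnd[of j "fst z" "snd z"] by (simp add: split_beta)
    qed
    ultimately show ?thesis unfolding weakly_PE2_def by blast
  qed
  then show ?thesis unfolding weakly_PE_transport_def using bt by blast
qed

end

section \<open>Classes of mass distributions\<close>

locale flc_masses = flc_tiling T \<nu> for T :: "('a::euclidean_space, 'l) tile set" and \<nu> :: "'a set \<Rightarrow> 'a" +
  fixes f1 f2 :: "'a \<Rightarrow> real"
  assumes PE: "strongly_PE T f1" "strongly_PE T f2"
    and positive: "f1 x > 0" "f2 x > 0"
begin

abbreviation m1 :: "'a set \<Rightarrow> real" where "m1 \<equiv> mass f1"
abbreviation m2 :: "'a set \<Rightarrow> real" where "m2 \<equiv> mass f2"

lemma continuous: "continuous_on UNIV f1" "continuous_on UNIV f2"
  using PE by (auto simp: strongly_PE_def)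

text \<open>
  A positive pattern equivariant function is bounded away from 0, hence so are the masses of tiles.
\<close>

lemma mass_constants:
  obtains m A L where "m > 0" "A \<ge> 0" "\<And>s. s \<in> V \<Longrightarrow> m \<le> m1 s" "\<And>s. s \<in> V \<Longrightarrow> m \<le> m2 s"
    "\<And>s. s \<in> V \<Longrightarrow> \<bar>m1 s\<bar> \<le> A" "\<And>x. \<bar>f1 x\<bar> \<le> L" "\<And>x. \<bar>f2 x\<bar> \<le> L"
proof -
  obtain l1 L1 where 1: "l1 > 0" "\<And>x. l1 \<le> f1 x" "\<And>x. f1 x \<le> L1"
    using strongly_PE_bounds[OF PE(1) positive(1)] by blast
  obtain l2 L2 where 2: "l2 > 0" "\<And>x. l2 \<le> f2 x" "\<And>x. f2 x \<le> L2"
    using strongly_PE_bounds[OF PE(2) positive(2)] by blast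
  obtain c1 A where c1: "c1 > 0" "\<And>s. s \<in> V \<Longrightarrow> c1 \<le> m1 s" "A \<ge> 0" "\<And>s. s \<in> V \<Longrightarrow> \<bar>m1 s\<bar> \<le> A"
    using mass_bounds[OF continuous(1) 1(2,3,1)] by blast
  obtain c2 where c2: "c2 > 0" "\<And>s. s \<in> V \<Longrightarrow> c2 \<le> m2 s"
    using mass_bounds(1)[OF continuous(2) 2(2,3,1)] by blast
  show ?thesis
  proof (rule that[of "min c1 c2" A "max L1 L2"])
    show "\<bar>f1 x\<bar> \<le> max L1 L2" "\<bar>f2 x\<bar> \<le> max L1 L2" for x
      using 1(3)[of x] 2(3)[of x] positive[of x] by auto
  qed (use c1 c2 in \<open>auto simp: min_le_iff_disj\<close>)
qed

lemma mass_positive: "s \<in> V \<Longrightarrow> m1 s > 0" "s \<in> V \<Longrightarrow> m2 s > 0"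
proof -
  obtain m where "m > 0" "\<And>s. s \<in> V \<Longrightarrow> m \<le> m1 s" "\<And>s. s \<in> V \<Longrightarrow> m \<le> m2 s" using mass_constants by metis
  then show "s \<in> V \<Longrightarrow> m1 s > 0" "s \<in> V \<Longrightarrow> m2 s > 0" by force+
qed

lemma mass_PE_cochain: "strongly_PE_cochain T (DIM('a)) m1" "strongly_PE_cochain T (DIM('a)) m2"
  using PE_cells_mass[OF PE(1)] PE_cells_mass[OF PE(2)]
  by (auto simp: strongly_PE_cochain_iff cochain_def cells_top mass_nontile)

text \<open>
  A flow whose divergence is the difference of the masses; it turns the first mass distribution into the
  second.
\<close>

definition balances :: "('a set \<Rightarrow> real) \<Rightarrow> bool" where
  "balances \<beta> \<longleftrightarrow> (\<forall>s\<in>V. coboundary T \<nu> \<beta> s = m1 s - m2 s)"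

lemma transport_coupling:
  assumes "bounded_transport f1 f2 b"
  obtains r where "r \<ge> 0" "\<And>x y. dist x y > r \<Longrightarrow> b (x, y) = 0" "coupling (r + 2 * D) m1 m2 (coupling_of r b)"
proof -
  obtain r where r: "\<And>x y. dist x y > r \<Longrightarrow> b (x, y) = 0" using assms unfolding bounded_transport_def by blast
  have r': "b (x, y) = 0" if "dist x y > max r 0" for x y using r[of x y] that by simp
  have "coupling (max r 0 + 2 * D) m1 m2 (coupling_of (max r 0) b)"
    by (rule coupling_of_transport[OF assms r' _ less_imp_le[OF positive(1)] less_imp_le[OF positive(2)] continuous]) auto
  then show ?thesis using that[of "max r 0"] r' by simp
qed

lemma flow_of_balances: "coupling r m1 m2 \<phi> \<Longrightarrow> r \<ge> 0 \<Longrightarrow> balances (flow_of r \<phi>)"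
  unfolding balances_def using coboundary_flow_of by blast

text \<open>
  No entry of a coupling exceeds its row sum.
\<close>

lemma flow_of_bounded:
  assumes c: "coupling r m1 m2 \<phi>" and r: "r \<ge> 0"
  shows "\<exists>M\<ge>0. \<forall>d. \<bar>flow_of r \<phi> d\<bar> \<le> M"
proof -
  obtain A where A: "A \<ge> 0" "\<And>s. s \<in> V \<Longrightarrow> \<bar>m1 s\<bar> \<le> A" using mass_constants by metis
  have rg: "ranged r \<phi>" and nn: "\<And>s u. 0 \<le> \<phi> s u" using c by (auto simp: coupling_def)
  have "\<bar>\<phi> s u - 0\<bar> \<le> A" for s u
  proof (cases "\<phi> s u = 0")
    case False
    then have s: "s \<in> V" using rangedD[OF rg] by blast
    obtain x where x: "x \<in> s" using tile_nonempty[OF s] by blast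
    have "finite {u. \<phi> s u \<noteq> 0}" by (rule finite_subset[OF ranged_support(1)[OF rg x] finite_near])
    then have "\<phi> s u \<le> (\<Sum>u | \<phi> s u \<noteq> 0. \<phi> s u)" using False nn by (intro member_le_sum) auto
    also have "\<dots> = m1 s" using c s by (simp add: coupling_def)
    finally show ?thesis using A(2)[OF s] nn[of s u] by simp
  qed (use A in simp)
  moreover have "ranged r (\<lambda>_ _. 0)" by (simp add: ranged_def)
  ultimately have "\<bar>flow_of r \<phi> d - flow_of r (\<lambda>_ _. 0) d\<bar> \<le> (real (Q (reach r + 2 * D + r)))\<^sup>2 * (A * load r)" for d
    by (intro flow_of_close[OF rg _ r])
  moreover have "flow_of r (\<lambda>_ _. 0) d = 0" for d by (simp add: flow_of_def)
  ultimately have "\<bar>flow_of r \<phi> d\<bar> \<le> (real (Q (reach r + 2 * D + r)))\<^sup>2 * (A * load r)" for d by simp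
  moreover have "(real (Q (reach r + 2 * D + r)))\<^sup>2 * (A * load r) \<ge> 0" using A(1) by (simp add: load_def)
  ultimately show ?thesis by blast
qed

lemma flow_coupling:
  assumes b: "balances \<beta>" and M: "\<And>d. \<bar>\<beta> d\<bar> \<le> M"
  obtains N where "coupling (D * (real N + 1)) m1 m2 (advect N m1 m2 \<beta> N)"
proof -
  obtain m where m: "m > 0" "\<And>s. s \<in> V \<Longrightarrow> m \<le> m1 s" "\<And>s. s \<in> V \<Longrightarrow> m \<le> m2 s" using mass_constants by metis
  obtain N :: nat where N: "K * (M / m) < N" using reals_Archimedean2 by blast
  have M0: "M \<ge> 0" using M[of "{}"] by linarith
  have "coupling (D * (real N + 1)) m1 m2 (advect N m1 m2 \<beta> N)"
  proof (rule advect_coupling[OF m M M0])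
    have "0 \<le> K * (M / m)" using M0 m(1) by simp
    then show "N > 0" using N by (metis of_nat_0_less_iff order_le_less_trans)
    show "K * (M / m) \<le> N" using N by simp
    show "coboundary T \<nu> \<beta> s = m1 s - m2 s" if "s \<in> V" for s using b that by (simp add: balances_def)
  qed
  then show ?thesis by (rule that)
qed

lemma ranged_advect': "ranged (D * (real N + 1)) (advect N a b \<beta> N)"
  using ranged_advect[of N N a b \<beta>] by simp

text \<open>
  Passing to tiles, to flows, and back: boundedness is all that the advection of a flow needs.
\<close>

theorem bounded_transport_iff_flow:
  "(\<exists>b. bounded_transport f1 f2 b) \<longleftrightarrow> (\<exists>\<beta> M. balances \<beta> \<and> (\<forall>d. \<bar>\<beta> d\<bar> \<le> M))"
proof
  assume "\<exists>b. bounded_transport f1 f2 b"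
  then obtain b r where "r \<ge> 0" and c: "coupling (r + 2 * D) m1 m2 (coupling_of r b)" using transport_coupling by metis
  then have "r + 2 * D \<ge> 0" using D_pos by simp
  then show "\<exists>\<beta> M. balances \<beta> \<and> (\<forall>d. \<bar>\<beta> d\<bar> \<le> M)"
    using flow_of_balances[OF c] flow_of_bounded[OF c] by blast
next
  assume "\<exists>\<beta> M. balances \<beta> \<and> (\<forall>d. \<bar>\<beta> d\<bar> \<le> M)"
  then obtain N \<beta> where "coupling (D * (real N + 1)) m1 m2 (advect N m1 m2 \<beta> N)" using flow_coupling by metis
  from bounded_transport_density[OF this continuous positive mass_positive]
  show "\<exists>b. bounded_transport f1 f2 b" by blast
qed

text \<open>
  All the constructions are made from local data, so they preserve strong equivariance.
\<close>

theorem strongly_PE_transport_iff_flow: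
  "(\<exists>b. strongly_PE_transport T f1 f2 b) \<longleftrightarrow> (\<exists>\<beta>. strongly_PE_cochain T (DIM('a) - 1) \<beta> \<and> balances \<beta>)"
proof
  assume "\<exists>b. strongly_PE_transport T f1 f2 b"
  then obtain b where b: "bounded_transport f1 f2 b" "strongly_PE2 T b" unfolding strongly_PE_transport_def by blast
  obtain r where r: "r \<ge> 0" and c: "coupling (r + 2 * D) m1 m2 (coupling_of r b)" using transport_coupling[OF b(1)] by metis
  have r': "r + 2 * D \<ge> 0" using r D_pos by simp
  have "PE_cells (flow_of (r + 2 * D) (coupling_of r b))"
    by (rule PE_cells_flow_of[OF ranged_coupling_of r' PE_kernel_coupling_of[OF b]])
  then have "strongly_PE_cochain T (DIM('a) - 1) (flow_of (r + 2 * D) (coupling_of r b))"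
    using cochain_flow_of by (simp add: strongly_PE_cochain_iff)
  then show "\<exists>\<beta>. strongly_PE_cochain T (DIM('a) - 1) \<beta> \<and> balances \<beta>"
    using flow_of_balances[OF c r'] by blast
next
  assume "\<exists>\<beta>. strongly_PE_cochain T (DIM('a) - 1) \<beta> \<and> balances \<beta>"
  then obtain \<beta> where b: "strongly_PE_cochain T (DIM('a) - 1) \<beta>" "balances \<beta>" by blast
  obtain M where "\<And>d. \<bar>\<beta> d\<bar> \<le> M" using strongly_PE_cochain_bounded[OF b(1)] by blast
  then obtain N where c: "coupling (D * (real N + 1)) m1 m2 (advect N m1 m2 \<beta> N)" using flow_coupling[OF b(2)] by metis
  have "PE_cells \<beta>" using b(1) by (simp add: strongly_PE_cochain_iff)
  then have "PE_kernel (advect N m1 m2 \<beta> N)" by (rule PE_kernel_advect[OF PE_cells_mass[OF PE(1)] PE_cells_mass[OF PE(2)]])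
  then have "strongly_PE2 T (density f1 f2 (advect N m1 m2 \<beta> N))" by (rule density_shift[OF ranged_advect' _ PE])
  then show "\<exists>b. strongly_PE_transport T f1 f2 b"
    using bounded_transport_density[OF c continuous positive mass_positive]
    unfolding strongly_PE_transport_def by blast
qed

lemma weakly_PE_cochain_add:
  assumes "weakly_PE_cochain T k \<beta>" "strongly_PE_cochain T k \<gamma>"
  shows "weakly_PE_cochain T k (\<lambda>d. \<beta> d + y * \<gamma> d)"
proof -
  obtain h where h: "\<And>j. strongly_PE_cochain T k (h j)" "uniform_limit (cells T k) h \<beta> sequentially"
    using assms(1) unfolding weakly_PE_cochain_def by blast
  have "strongly_PE_cochain T k (\<lambda>d. h j d + y * \<gamma> d)" for j
    using h(1)[of j] assms(2) PE_cells_add[of "h j" \<gamma> 1 y] by (simp add: strongly_PE_cochain_iff cochain_def)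
  moreover have "uniform_limit (cells T k) (\<lambda>j d. h j d + y * \<gamma> d) (\<lambda>d. \<beta> d + y * \<gamma> d) sequentially"
    by (intro uniform_limit_add h(2) uniform_limit_const)
  moreover have "cochain T k (\<lambda>d. \<beta> d + y * \<gamma> d)"
    using assms by (simp add: weakly_PE_cochain_def strongly_PE_cochain_def cochain_def)
  ultimately show ?thesis unfolding weakly_PE_cochain_def by (intro conjI exI[of _ "\<lambda>j d. h j d + y * \<gamma> d"]) auto
qed

lemma weakly_PE_cochain_bounded:
  assumes "weakly_PE_cochain T (DIM('a) - 1) \<beta>"
  shows "\<exists>M\<ge>0. \<forall>d. \<bar>\<beta> d\<bar> \<le> M"
proof -
  obtain h where h: "\<And>j. strongly_PE_cochain T (DIM('a) - 1) (h j)" "uniform_limit E h \<beta> sequentially"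
    and co: "cochain T (DIM('a) - 1) \<beta>"
    using assms unfolding weakly_PE_cochain_def E_def by blast
  obtain j where j: "\<And>d. d \<in> E \<Longrightarrow> \<bar>h j d - \<beta> d\<bar> \<le> 1" using uniform_limit_le[OF h(2), of 1] by auto
  obtain M where M: "M \<ge> 0" "\<And>d. \<bar>h j d\<bar> \<le> M" using strongly_PE_cochain_bounded[OF h(1)[of j]] by blast
  have "\<bar>\<beta> d\<bar> \<le> M + 1" for d
  proof (cases "d \<in> E")
    case True
    then show ?thesis using j[OF True] M(2)[of d] by linarith
  next
    case False
    then show ?thesis using co M(1) by (simp add: cochain_def E_def)
  qed
  then show ?thesis using M(1) by (intro exI[of _ "M + 1"]) auto
qed

text \<open>
  The same constructions applied to approximations, which need not balance the masses themselves; only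
  their equivariance and uniform closeness matter.
\<close>

theorem weakly_PE_transport_iff_flow:
  "(\<exists>b. weakly_PE_transport T f1 f2 b) \<longleftrightarrow> (\<exists>\<beta>. weakly_PE_cochain T (DIM('a) - 1) \<beta> \<and> balances \<beta>)"
proof
  assume "\<exists>b. weakly_PE_transport T f1 f2 b"
  then obtain b where b: "weakly_PE_transport T f1 f2 b" by blast
  then have bt: "bounded_transport f1 f2 b" by (simp add: weakly_PE_transport_def)
  obtain r where r: "r \<ge> 0" and rng: "\<And>x y. dist x y > r \<Longrightarrow> b (x, y) = 0"
    and c: "coupling (r + 2 * D) m1 m2 (coupling_of r b)" using transport_coupling[OF bt] by metis
  define q where "q = r + 2 * D"
  have q: "q \<ge> 0" using r D_pos by (simp add: q_def)
  let ?\<phi> = "coupling_of r b"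
  have rg: "ranged q ?\<phi>" unfolding q_def by (rule ranged_coupling_of)
  have "weakly_PE_kernel q ?\<phi>" unfolding q_def by (rule weakly_PE_coupling_of[OF b]) (rule rng)
  then have "\<exists>\<psi>. PE_kernel \<psi> \<and> ranged q \<psi> \<and> (\<forall>s u. \<bar>?\<phi> s u - \<psi> s u\<bar> \<le> 1 / (real j + 1))" for j :: nat
    unfolding weakly_PE_kernel_def by (simp add: add_pos_nonneg add.commute)
  then obtain \<psi> where ps: "\<And>j. PE_kernel (\<psi> j)" "\<And>j. ranged q (\<psi> j)" "\<And>j s u. \<bar>?\<phi> s u - \<psi> j s u\<bar> \<le> 1 / (real j + 1)"
    by metis
  define C where "C = (real (Q (reach q + 2 * D + q)))\<^sup>2 * load q"
  have C: "C \<ge> 0" by (simp add: C_def load_def)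
  have "\<bar>flow_of q (\<psi> j) d - flow_of q ?\<phi> d\<bar> \<le> C * (1 / (real j + 1))" for j d
    using flow_of_close[OF ps(2)[of j] rg q, of "1 / (real j + 1)" d] ps(3)[of _ _ j]
    by (simp add: C_def abs_minus_commute)
  then have "uniform_limit (cells T (DIM('a) - 1)) (\<lambda>j. flow_of q (\<psi> j)) (flow_of q ?\<phi>) sequentially"
    using C by (rule uniform_limit_rate)
  moreover have "strongly_PE_cochain T (DIM('a) - 1) (flow_of q (\<psi> j))" for j
    using PE_cells_flow_of[OF ps(2) q ps(1)] cochain_flow_of by (simp add: strongly_PE_cochain_iff)
  ultimately have "weakly_PE_cochain T (DIM('a) - 1) (flow_of q ?\<phi>)"
    unfolding weakly_PE_cochain_def by (intro conjI cochain_flow_of exI[of _ "\<lambda>j. flow_of q (\<psi> j)"] allI)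
  then show "\<exists>\<beta>. weakly_PE_cochain T (DIM('a) - 1) \<beta> \<and> balances \<beta>"
    using flow_of_balances[OF c[folded q_def] q] by blast
next
  assume "\<exists>\<beta>. weakly_PE_cochain T (DIM('a) - 1) \<beta> \<and> balances \<beta>"
  then obtain \<beta> where b: "weakly_PE_cochain T (DIM('a) - 1) \<beta>" "balances \<beta>" by blast
  obtain M where M: "M \<ge> 0" "\<And>d. \<bar>\<beta> d\<bar> \<le> M" using weakly_PE_cochain_bounded[OF b(1)] by blast
  obtain N where c: "coupling (D * (real N + 1)) m1 m2 (advect N m1 m2 \<beta> N)" using flow_coupling[OF b(2) M(2)] by metis
  obtain m A L where k: "m > 0" "A \<ge> 0" "\<And>s. s \<in> V \<Longrightarrow> m \<le> m1 s" "\<And>s. s \<in> V \<Longrightarrow> m \<le> m2 s"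
    "\<And>s. s \<in> V \<Longrightarrow> \<bar>m1 s\<bar> \<le> A" "\<And>x. \<bar>f1 x\<bar> \<le> L" "\<And>x. \<bar>f2 x\<bar> \<le> L"
    using mass_constants by metis
  obtain h where h: "\<And>j. strongly_PE_cochain T (DIM('a) - 1) (h j)" "uniform_limit E h \<beta> sequentially"
    using b(1) unfolding weakly_PE_cochain_def E_def by blast
  have "M + 1 \<ge> 0" using M by simp
  then have "\<exists>B\<ge>0. \<exists>C\<ge>0. \<forall>\<beta> \<beta>' e. (\<forall>d\<in>E. \<bar>\<beta> d\<bar> \<le> M + 1) \<and> (\<forall>d\<in>E. \<bar>\<beta>' d\<bar> \<le> M + 1) \<and> (\<forall>d\<in>E. \<bar>\<beta> d - \<beta>' d\<bar> \<le> e) \<and> e \<ge> 0 \<longrightarrow>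
    (\<forall>s u. \<bar>advect N m1 m2 \<beta> N s u\<bar> \<le> B) \<and> (\<forall>s u. \<bar>advect N m1 m2 \<beta> N s u - advect N m1 m2 \<beta>' N s u\<bar> \<le> C * e)"
    by (intro advect_lipschitz[where A = A, OF k(1)] k order_refl)
  then obtain B C where C: "C \<ge> 0" and lip: "\<forall>\<beta> \<beta>' e. (\<forall>d\<in>E. \<bar>\<beta> d\<bar> \<le> M + 1) \<and> (\<forall>d\<in>E. \<bar>\<beta>' d\<bar> \<le> M + 1) \<and> (\<forall>d\<in>E. \<bar>\<beta> d - \<beta>' d\<bar> \<le> e) \<and> e \<ge> 0 \<longrightarrow>
    (\<forall>s u. \<bar>advect N m1 m2 \<beta> N s u\<bar> \<le> B) \<and> (\<forall>s u. \<bar>advect N m1 m2 \<beta> N s u - advect N m1 m2 \<beta>' N s u\<bar> \<le> C * e)"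
    by (elim exE conjE) (rule that)
  have "weakly_PE_kernel (D * (real N + 1)) (advect N m1 m2 \<beta> N)"
    unfolding weakly_PE_kernel_def
  proof (intro allI impI)
    fix e :: real assume e: "e > 0"
    define e' where "e' = min 1 (e / (C + 1))"
    have e': "e' > 0" "e' \<le> 1" using e C by (auto simp: e'_def)
    obtain j where j: "\<And>d. d \<in> E \<Longrightarrow> \<bar>h j d - \<beta> d\<bar> \<le> e'" using uniform_limit_le[OF h(2) e'(1)] by blast
    have b1: "\<forall>d\<in>E. \<bar>h j d\<bar> \<le> M + 1"
    proof
      fix d assume "d \<in> E"
      then show "\<bar>h j d\<bar> \<le> M + 1" using j[of d] e'(2) M(2)[of d] by linarith
    qed
    have b2: "\<forall>d\<in>E. \<bar>\<beta> d\<bar> \<le> M + 1"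
    proof
      fix d show "\<bar>\<beta> d\<bar> \<le> M + 1" using M(2)[of d] by linarith
    qed
    have b3: "\<forall>d\<in>E. \<bar>\<beta> d - h j d\<bar> \<le> e'" using j by (simp add: abs_minus_commute)
    have "\<forall>s u. \<bar>advect N m1 m2 \<beta> N s u - advect N m1 m2 (h j) N s u\<bar> \<le> C * e'"
      using lip[THEN spec[where x = \<beta>], THEN spec[where x = "h j"], THEN spec[where x = e']]
      by (rule mp[THEN conjunct2]) (intro conjI b1 b2 b3 less_imp_le[OF e'(1)])
    moreover have "C * e' \<le> e"
    proof -
      have "C * e' \<le> C * (e / (C + 1))" using C by (intro mult_left_mono) (auto simp: e'_def)
      also have "\<dots> \<le> e" using C e by (simp add: field_simps)
      finally show ?thesis .
    qed
    ultimately have "\<forall>s u. \<bar>advect N m1 m2 \<beta> N s u - advect N m1 m2 (h j) N s u\<bar> \<le> e"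
      using order_trans by blast
    moreover have "PE_cells (h j)" using h(1)[of j] by (simp add: strongly_PE_cochain_iff)
    then have "PE_kernel (advect N m1 m2 (h j) N)" by (rule PE_kernel_advect[OF PE_cells_mass[OF PE(1)] PE_cells_mass[OF PE(2)]])
    ultimately show "\<exists>\<psi>. PE_kernel \<psi> \<and> ranged (D * (real N + 1)) \<psi> \<and> (\<forall>s u. \<bar>advect N m1 m2 \<beta> N s u - \<psi> s u\<bar> \<le> e)"
      using ranged_advect' by blast
  qed
  from weakly_PE_transport_density[OF c this PE positive k(1,3,4,6,7)]
  show "\<exists>b. weakly_PE_transport T f1 f2 b" by blast
qed

abbreviation G :: "('a set \<Rightarrow> real) monoid" where "G \<equiv> PE_cochain_group T (DIM('a))"
abbreviation B :: "('a set \<Rightarrow> real) set" where "B \<equiv> PE_coboundaries T \<nu>"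

lemma strongly_PE_cochain_comb:
  "strongly_PE_cochain T k \<alpha> \<Longrightarrow> strongly_PE_cochain T k \<beta> \<Longrightarrow> strongly_PE_cochain T k (\<lambda>c. x * \<alpha> c + y * \<beta> c)"
  using PE_cells_add[of \<alpha> \<beta> x y] by (simp add: strongly_PE_cochain_iff cochain_def)

lemma strongly_PE_cochain_zero: "strongly_PE_cochain T k (\<lambda>_. 0)"
  unfolding strongly_PE_cochain_iff cochain_def PE_cells_def by (auto intro: exI[of _ 1])

lemma G_simps:
  "carrier G = {\<alpha>. strongly_PE_cochain T (DIM('a)) \<alpha>}" "\<alpha> \<otimes>\<^bsub>G\<^esub> \<beta> = (\<lambda>c. \<alpha> c + \<beta> c)" "\<one>\<^bsub>G\<^esub> = (\<lambda>_. 0)"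
  by (simp_all add: PE_cochain_group_def)

text \<open>
  Cochains are added pointwise; the larger of two radii serves for a sum.
\<close>

lemma group_G: "comm_group G"
proof (rule comm_groupI)
  fix \<alpha> assume "\<alpha> \<in> carrier G"
  then have "(\<lambda>c. - \<alpha> c) \<in> carrier G"
    using strongly_PE_cochain_comb[of "DIM('a)" \<alpha> \<alpha> "- 1" 0] by (simp add: G_simps)
  then show "\<exists>\<beta>\<in>carrier G. \<beta> \<otimes>\<^bsub>G\<^esub> \<alpha> = \<one>\<^bsub>G\<^esub>"
    by (intro bexI[of _ "\<lambda>c. - \<alpha> c"]) (simp_all add: G_simps)
next
  fix \<alpha> \<beta> assume "\<alpha> \<in> carrier G" "\<beta> \<in> carrier G"
  then show "\<alpha> \<otimes>\<^bsub>G\<^esub> \<beta> \<in> carrier G"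
    using strongly_PE_cochain_comb[of "DIM('a)" \<alpha> \<beta> 1 1] by (simp add: G_simps)
qed (simp_all add: G_simps strongly_PE_cochain_zero algebra_simps)

lemma inv_G:
  assumes "\<alpha> \<in> carrier G"
  shows "inv\<^bsub>G\<^esub> \<alpha> = (\<lambda>c. - \<alpha> c)"
proof -
  interpret comm_group G by (rule group_G)
  have "(\<lambda>c. - \<alpha> c) \<in> carrier G"
    using assms strongly_PE_cochain_comb[of "DIM('a)" \<alpha> \<alpha> "- 1" 0] by (simp add: G_simps)
  then show ?thesis using assms by (intro inv_equality) (simp_all add: G_simps)
qed

lemma B_iff: "\<alpha> \<in> B \<longleftrightarrow> (\<exists>\<beta>. strongly_PE_cochain T (DIM('a) - 1) \<beta> \<and> \<alpha> = coboundary T \<nu> \<beta>)"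
  by (auto simp: PE_coboundaries_def PE_cochain_group_def)

lemma coboundary_comb:
  "coboundary T \<nu> (\<lambda>d. x * \<beta> d + y * \<gamma> d) = (\<lambda>c. x * coboundary T \<nu> \<beta> c + y * coboundary T \<nu> \<gamma> c)"
  by (rule ext) (rule coboundary_linear)

lemma coboundary_in_G: "strongly_PE_cochain T (DIM('a) - 1) \<beta> \<Longrightarrow> coboundary T \<nu> \<beta> \<in> carrier G"
  using PE_cells_coboundary[of \<beta>]
  by (simp add: G_simps strongly_PE_cochain_iff cochain_def cells_top coboundary_nontile)

lemma normal_B: "B \<lhd> G"
proof -
  interpret comm_group G by (rule group_G)
  have "subgroup B G"
  proof (rule subgroupI)
    show "B \<subseteq> carrier G" using coboundary_in_G by (auto simp: B_iff)
    have "(\<lambda>c. 0) \<in> B" unfolding B_iff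
      by (rule exI[of _ "\<lambda>_. 0"]) (auto simp: strongly_PE_cochain_zero coboundary_def fun_eq_iff)
    then show "B \<noteq> {}" by blast
    fix \<alpha> assume a: "\<alpha> \<in> B"
    then obtain \<beta> where \<beta>: "strongly_PE_cochain T (DIM('a) - 1) \<beta>" "\<alpha> = coboundary T \<nu> \<beta>" by (auto simp: B_iff)
    then have "inv\<^bsub>G\<^esub> \<alpha> = coboundary T \<nu> (\<lambda>d. - 1 * \<beta> d + 0 * \<beta> d)"
      unfolding coboundary_comb using inv_G coboundary_in_G by simp
    then show "inv\<^bsub>G\<^esub> \<alpha> \<in> B"
      unfolding B_iff using strongly_PE_cochain_comb[OF \<beta>(1) \<beta>(1), of "- 1" 0] by blast
    fix \<alpha>' assume "\<alpha>' \<in> B"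
    then obtain \<gamma> where \<gamma>: "strongly_PE_cochain T (DIM('a) - 1) \<gamma>" "\<alpha>' = coboundary T \<nu> \<gamma>" by (auto simp: B_iff)
    have "\<alpha> \<otimes>\<^bsub>G\<^esub> \<alpha>' = coboundary T \<nu> (\<lambda>d. 1 * \<beta> d + 1 * \<gamma> d)"
      unfolding coboundary_comb \<beta> \<gamma> by (simp add: G_simps)
    then show "\<alpha> \<otimes>\<^bsub>G\<^esub> \<alpha>' \<in> B"
      unfolding B_iff using strongly_PE_cochain_comb[OF \<beta>(1) \<gamma>(1), of 1 1] by blast
  qed
  then show ?thesis by (rule subgroup_imp_normal)
qed

lemma mass_in_G: "m1 \<in> carrier G" "m2 \<in> carrier G"
  using mass_PE_cochain by (simp_all add: G_simps)

lemma coset_iff: "\<alpha> \<in> B #>\<^bsub>G\<^esub> \<mu> \<longleftrightarrow>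
    (\<exists>\<beta>. strongly_PE_cochain T (DIM('a) - 1) \<beta> \<and> \<alpha> = (\<lambda>c. coboundary T \<nu> \<beta> c + \<mu> c))"
proof -
  have "\<alpha> \<in> B #>\<^bsub>G\<^esub> \<mu> \<longleftrightarrow> (\<exists>h. h \<in> B \<and> \<alpha> = (\<lambda>c. h c + \<mu> c))"
    unfolding r_coset_def G_simps by blast
  then show ?thesis unfolding B_iff by auto
qed

lemma class_diff_eq:
  "class_diff T \<nu> (mass_class T \<nu> f1) (mass_class T \<nu> f2) = B #>\<^bsub>G\<^esub> (\<lambda>c. m1 c - m2 c)"
proof -
  interpret normal B G by (rule normal_B)
  have in_Mod: "B #>\<^bsub>G\<^esub> m2 \<in> carrier (G Mod B)"
    using mass_in_G(2) by (auto simp: FactGroup_def RCOSETS_def)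
  have "inv\<^bsub>G Mod B\<^esub> (B #>\<^bsub>G\<^esub> m2) = B #>\<^bsub>G\<^esub> (inv\<^bsub>G\<^esub> m2)"
    using inv_FactGroup[OF in_Mod] rcos_inv[OF mass_in_G(2)] by simp
  then have "class_diff T \<nu> (mass_class T \<nu> f1) (mass_class T \<nu> f2) = (B #>\<^bsub>G\<^esub> m1) <#>\<^bsub>G\<^esub> (B #>\<^bsub>G\<^esub> (inv\<^bsub>G\<^esub> m2))"
    by (simp add: class_diff_def mass_class_def top_cohomology_def mass_def FactGroup_def)
  also have "\<dots> = B #>\<^bsub>G\<^esub> (m1 \<otimes>\<^bsub>G\<^esub> inv\<^bsub>G\<^esub> m2)"
    using mass_in_G by (intro rcos_sum) auto
  also have "m1 \<otimes>\<^bsub>G\<^esub> inv\<^bsub>G\<^esub> m2 = (\<lambda>c. m1 c - m2 c)"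
    unfolding inv_G[OF mass_in_G(2)] by (simp add: G_simps)
  finally show ?thesis .
qed

lemma mass_class_eq_iff:
  "mass_class T \<nu> f1 = mass_class T \<nu> f2 \<longleftrightarrow> m1 \<in> B #>\<^bsub>G\<^esub> m2"
proof -
  interpret normal B G by (rule normal_B)
  have "mass_class T \<nu> f1 = B #>\<^bsub>G\<^esub> m1" "mass_class T \<nu> f2 = B #>\<^bsub>G\<^esub> m2"
    by (simp_all add: mass_class_def mass_def)
  then show ?thesis
    using rcos_self[OF mass_in_G(1) is_subgroup] repr_independence[of m1 B m2, OF _ mass_in_G(2) is_subgroup] by metis
qed

lemma balances_iff: "balances \<beta> \<longleftrightarrow> coboundary T \<nu> \<beta> = (\<lambda>c. m1 c - m2 c)"
proof
  assume b: "balances \<beta>"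
  show "coboundary T \<nu> \<beta> = (\<lambda>c. m1 c - m2 c)"
  proof
    fix c show "coboundary T \<nu> \<beta> c = m1 c - m2 c"
      using b by (cases "c \<in> V") (auto simp: balances_def coboundary_nontile mass_nontile)
  qed
qed (simp add: balances_def)

text \<open>
  Equality of the classes means that the masses differ by the coboundary of a strongly equivariant cochain,
  which is a balancing flow.
\<close>

theorem strongly_PE_part:
  "(\<exists>b. strongly_PE_transport T f1 f2 b) \<longleftrightarrow> mass_class T \<nu> f1 = mass_class T \<nu> f2"
  unfolding strongly_PE_transport_iff_flow mass_class_eq_iff coset_iff balances_iff
  by (auto simp: fun_eq_iff algebra_simps)

text \<open>
  Representatives of the difference class differ by coboundaries of strongly equivariant cochains, which
  are also weakly equivariant, so the choice of the representative does not matter.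
\<close>

theorem weakly_PE_part:
  "(\<exists>b. weakly_PE_transport T f1 f2 b) \<longleftrightarrow>
     asymptotically_negligible_class T \<nu> (class_diff T \<nu> (mass_class T \<nu> f1) (mass_class T \<nu> f2))"
  unfolding weakly_PE_transport_iff_flow class_diff_eq asymptotically_negligible_class_def
proof
  assume "\<exists>\<beta>. weakly_PE_cochain T (DIM('a) - 1) \<beta> \<and> balances \<beta>"
  then obtain \<beta> where b: "weakly_PE_cochain T (DIM('a) - 1) \<beta>" "balances \<beta>" by blast
  have "strongly_PE_cochain T (DIM('a)) (\<lambda>c. m1 c - m2 c)"
    using strongly_PE_cochain_comb[OF mass_PE_cochain, of 1 "- 1"] by simp
  then have "weakly_exact T \<nu> (\<lambda>c. m1 c - m2 c)"
    using b unfolding weakly_exact_def balances_iff by metis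
  moreover have "(\<lambda>c. m1 c - m2 c) \<in> B #>\<^bsub>G\<^esub> (\<lambda>c. m1 c - m2 c)"
    unfolding coset_iff by (rule exI[of _ "\<lambda>_. 0"]) (auto simp: strongly_PE_cochain_zero coboundary_def fun_eq_iff)
  ultimately show "\<exists>\<alpha>\<in>B #>\<^bsub>G\<^esub> (\<lambda>c. m1 c - m2 c). weakly_exact T \<nu> \<alpha>" by blast
next
  assume "\<exists>\<alpha>\<in>B #>\<^bsub>G\<^esub> (\<lambda>c. m1 c - m2 c). weakly_exact T \<nu> \<alpha>"
  then obtain \<alpha> where a: "\<alpha> \<in> B #>\<^bsub>G\<^esub> (\<lambda>c. m1 c - m2 c)" "weakly_exact T \<nu> \<alpha>" by blast
  obtain \<gamma> where g: "strongly_PE_cochain T (DIM('a) - 1) \<gamma>" "\<alpha> = (\<lambda>c. coboundary T \<nu> \<gamma> c + (m1 c - m2 c))"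
    using a(1) unfolding coset_iff by blast
  obtain \<beta> where b: "weakly_PE_cochain T (DIM('a) - 1) \<beta>" "\<alpha> = coboundary T \<nu> \<beta>"
    using a(2) unfolding weakly_exact_def by blast
  have "coboundary T \<nu> (\<lambda>d. 1 * \<beta> d + (- 1) * \<gamma> d) = (\<lambda>c. m1 c - m2 c)"
    unfolding coboundary_comb using g(2) b(2) by (auto simp: fun_eq_iff algebra_simps)
  then have "balances (\<lambda>d. \<beta> d + (- 1) * \<gamma> d)" by (simp add: balances_iff)
  then show "\<exists>\<beta>. weakly_PE_cochain T (DIM('a) - 1) \<beta> \<and> balances \<beta>"
    using weakly_PE_cochain_add[OF b(1) g(1), of "- 1"] by blast
qed

text \<open>
  A nonempty bounded set other than the whole space has a nonempty frontier.
\<close>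

lemma bdry_nonempty:
  assumes "finite P" "P \<subseteq> V" "P \<noteq> {}"
  shows "bdry P \<noteq> {}"
proof
  assume "bdry P = {}"
  then have "frontier (\<Union>P) = {}" using frontier_patch[OF assms(1,2)] by simp
  then have "\<Union>P = {} \<or> \<Union>P = UNIV" by (simp add: frontier_eq_empty)
  moreover have "\<Union>P \<noteq> {}" using assms tile_nonempty by blast
  moreover have "bounded (\<Union>P)" using assms(1,2) tile_bounded by (intro bounded_Union) auto
  ultimately show False using not_bounded_UNIV by metis
qed

lemma sum_coboundary_le:
  assumes P: "finite P" "P \<subseteq> V" and M: "\<And>d. \<bar>\<beta> d\<bar> \<le> M"
  shows "\<bar>\<Sum>s\<in>P. coboundary T \<nu> \<beta> s\<bar> \<le> M * real (card (bdry P))"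
proof -
  have "\<bar>\<Sum>s\<in>P. coboundary T \<nu> \<beta> s\<bar> \<le> (\<Sum>d\<in>bdry P. \<bar>if pos d \<in> P then \<beta> d else - \<beta> d\<bar>)"
    unfolding sum_coboundary[OF P] by (rule sum_abs)
  also have "\<dots> \<le> (\<Sum>d\<in>bdry P. M)" using M by (intro sum_mono) auto
  finally show ?thesis by (simp add: mult.commute)
qed

text \<open>
  Boundary area may be replaced by the number of boundary facets.  A nonempty patch has at least one of
  them, so the additive constant can be absorbed.
\<close>

lemma well_balanced_iff:
  "well_balanced T \<alpha> \<longleftrightarrow> strongly_PE_cochain T (DIM('a)) \<alpha> \<and>
     (\<exists>c\<ge>0. \<forall>P. finite P \<and> P \<subseteq> V \<longrightarrow> \<bar>\<Sum>s\<in>P. \<alpha> s\<bar> \<le> c * real (card (bdry P)))"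
proof -
  obtain a A where aA: "a > 0" "A > 0"
    and ar: "\<And>P. finite P \<Longrightarrow> P \<subseteq> V \<Longrightarrow> a * real (card (bdry P)) \<le> polyhedral_area (frontier (\<Union>P)) \<and>
     polyhedral_area (frontier (\<Union>P)) \<le> A * real (card (bdry P))"
    using boundary_area_bounds by blast
  have sum_patch: "(\<Sum>t\<in>P. \<alpha> (fst t)) = (\<Sum>s\<in>fst ` P. \<alpha> s)" if "P \<subseteq> T" for P
    by (subst sum.reindex[OF inj_on_subset[OF fst_inj_on that]]) simp
  have "(\<exists>c1 c2. \<forall>P. patch T P \<longrightarrow> \<bar>\<Sum>t\<in>P. \<alpha> (fst t)\<bar> \<le> c1 + c2 * patch_boundary_area P) \<longleftrightarrow>
     (\<exists>c\<ge>0. \<forall>P. finite P \<and> P \<subseteq> V \<longrightarrow> \<bar>\<Sum>s\<in>P. \<alpha> s\<bar> \<le> c * real (card (bdry P)))"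
  proof
    assume "\<exists>c1 c2. \<forall>P. patch T P \<longrightarrow> \<bar>\<Sum>t\<in>P. \<alpha> (fst t)\<bar> \<le> c1 + c2 * patch_boundary_area P"
    then obtain c1 c2 where c: "\<And>P. patch T P \<Longrightarrow> \<bar>\<Sum>t\<in>P. \<alpha> (fst t)\<bar> \<le> c1 + c2 * patch_boundary_area P" by blast
    have "\<bar>\<Sum>s\<in>P. \<alpha> s\<bar> \<le> (\<bar>c1\<bar> + \<bar>c2\<bar> * A) * real (card (bdry P))" if P: "finite P" "P \<subseteq> V" for P
    proof (cases "P = {}")
      case False
      obtain P' where P': "P' \<subseteq> T" "finite P'" "P = fst ` P'"
        using P finite_subset_image[of P fst T] unfolding V_def by metis
      have pa: "patch_boundary_area P' = polyhedral_area (frontier (\<Union>P))"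
        unfolding patch_boundary_area_def P'(3) ..
      have "card (bdry P) \<noteq> 0" using bdry_nonempty[OF P False] finite_bdry[OF P] by simp
      then have one: "1 \<le> real (card (bdry P))" by simp
      have "\<bar>\<Sum>s\<in>P. \<alpha> s\<bar> \<le> c1 + c2 * polyhedral_area (frontier (\<Union>P))"
        using c[of P'] P' sum_patch[OF P'(1)] pa by (simp add: patch_def)
      also have "\<dots> \<le> \<bar>c1\<bar> * real (card (bdry P)) + \<bar>c2\<bar> * (A * real (card (bdry P)))"
      proof (rule add_mono)
        have "\<bar>c1\<bar> * 1 \<le> \<bar>c1\<bar> * real (card (bdry P))" using one by (intro mult_left_mono) auto
        then show "c1 \<le> \<bar>c1\<bar> * real (card (bdry P))" by linarith
        have p0: "0 \<le> polyhedral_area (frontier (\<Union>P))"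
        proof -
          have "0 \<le> a * real (card (bdry P))" using aA(1) by simp
          then show ?thesis using ar[OF P] by linarith
        qed
        have "c2 * polyhedral_area (frontier (\<Union>P)) \<le> \<bar>c2\<bar> * polyhedral_area (frontier (\<Union>P))"
          using p0 by (intro mult_right_mono) auto
        also have "\<dots> \<le> \<bar>c2\<bar> * (A * real (card (bdry P)))" using ar[OF P] by (intro mult_left_mono) auto
        finally show "c2 * polyhedral_area (frontier (\<Union>P)) \<le> \<bar>c2\<bar> * (A * real (card (bdry P)))" .
      qed
      finally show ?thesis by (simp add: algebra_simps)
    qed (use aA in simp)
    moreover have "\<bar>c1\<bar> + \<bar>c2\<bar> * A \<ge> 0" using aA by simp
    ultimately show "\<exists>c\<ge>0. \<forall>P. finite P \<and> P \<subseteq> V \<longrightarrow> \<bar>\<Sum>s\<in>P. \<alpha> s\<bar> \<le> c * real (card (bdry P))" by blast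
  next
    assume "\<exists>c\<ge>0. \<forall>P. finite P \<and> P \<subseteq> V \<longrightarrow> \<bar>\<Sum>s\<in>P. \<alpha> s\<bar> \<le> c * real (card (bdry P))"
    then obtain c where c: "c \<ge> 0" "\<And>P. finite P \<Longrightarrow> P \<subseteq> V \<Longrightarrow> \<bar>\<Sum>s\<in>P. \<alpha> s\<bar> \<le> c * real (card (bdry P))" by blast
    have "\<bar>\<Sum>t\<in>P. \<alpha> (fst t)\<bar> \<le> 0 + c / a * patch_boundary_area P" if "patch T P" for P
    proof -
      have P: "finite P" "P \<subseteq> T" using that by (auto simp: patch_def)
      then have P': "finite (fst ` P)" "fst ` P \<subseteq> V" by (auto simp: V_def)
      have "\<bar>\<Sum>t\<in>P. \<alpha> (fst t)\<bar> \<le> c * real (card (bdry (fst ` P)))"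
        unfolding sum_patch[OF P(2)] by (rule c(2)[OF P'])
      also have "\<dots> = c / a * (a * real (card (bdry (fst ` P))))" using aA by simp
      also have "\<dots> \<le> c / a * patch_boundary_area P"
        unfolding patch_boundary_area_def using ar[OF P'] c(1) aA(1) by (intro mult_left_mono) auto
      finally show ?thesis by simp
    qed
    then show "\<exists>c1 c2. \<forall>P. patch T P \<longrightarrow> \<bar>\<Sum>t\<in>P. \<alpha> (fst t)\<bar> \<le> c1 + c2 * patch_boundary_area P" by blast
  qed
  then show ?thesis unfolding well_balanced_def by simp
qed

text \<open>
  A bounded balancing flow gives the estimate by Stokes' theorem.  Conversely, the estimate holds for the difference
  of the masses itself, since coboundaries of bounded cochains satisfy it, and then max-flow min-cut gives
  a bounded balancing flow.
\<close>

theorem bounded_part: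
  "(\<exists>b. bounded_transport f1 f2 b) \<longleftrightarrow>
     well_balanced_class T (class_diff T \<nu> (mass_class T \<nu> f1) (mass_class T \<nu> f2))"
  unfolding bounded_transport_iff_flow class_diff_eq well_balanced_class_def
proof
  assume "\<exists>\<beta> M. balances \<beta> \<and> (\<forall>d. \<bar>\<beta> d\<bar> \<le> M)"
  then obtain \<beta> M where b: "balances \<beta>" "\<And>d. \<bar>\<beta> d\<bar> \<le> M" by blast
  have "M \<ge> 0" using b(2)[of "{}"] by linarith
  moreover have "\<bar>\<Sum>s\<in>P. m1 s - m2 s\<bar> \<le> M * real (card (bdry P))" if "finite P" "P \<subseteq> V" for P
    using sum_coboundary_le[where \<beta> = \<beta> and M = M, OF that b(2)] b(1)[unfolded balances_iff] by simp
  moreover have "strongly_PE_cochain T (DIM('a)) (\<lambda>c. m1 c - m2 c)"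
    using strongly_PE_cochain_comb[OF mass_PE_cochain, of 1 "- 1"] by simp
  ultimately have "well_balanced T (\<lambda>c. m1 c - m2 c)" unfolding well_balanced_iff by blast
  moreover have "(\<lambda>c. m1 c - m2 c) \<in> B #>\<^bsub>G\<^esub> (\<lambda>c. m1 c - m2 c)"
    unfolding coset_iff by (rule exI[of _ "\<lambda>_. 0"]) (auto simp: strongly_PE_cochain_zero coboundary_def fun_eq_iff)
  ultimately show "\<exists>\<alpha>\<in>B #>\<^bsub>G\<^esub> (\<lambda>c. m1 c - m2 c). well_balanced T \<alpha>" by blast
next
  assume "\<exists>\<alpha>\<in>B #>\<^bsub>G\<^esub> (\<lambda>c. m1 c - m2 c). well_balanced T \<alpha>"
  then obtain \<alpha> where a: "\<alpha> \<in> B #>\<^bsub>G\<^esub> (\<lambda>c. m1 c - m2 c)" "well_balanced T \<alpha>" by blast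
  obtain \<gamma> where g: "strongly_PE_cochain T (DIM('a) - 1) \<gamma>" "\<alpha> = (\<lambda>c. coboundary T \<nu> \<gamma> c + (m1 c - m2 c))"
    using a(1) unfolding coset_iff by blast
  obtain c where c: "c \<ge> 0" "\<And>P. finite P \<Longrightarrow> P \<subseteq> V \<Longrightarrow> \<bar>\<Sum>s\<in>P. \<alpha> s\<bar> \<le> c * real (card (bdry P))"
    using a(2) unfolding well_balanced_iff by blast
  obtain M where M: "M \<ge> 0" "\<And>d. \<bar>\<gamma> d\<bar> \<le> M" using strongly_PE_cochain_bounded[OF g(1)] by blast
  have "\<bar>\<Sum>s\<in>P. m1 s - m2 s\<bar> \<le> (c + M) * real (card (bdry P))" if P: "finite P" "P \<subseteq> V" for P
  proof -
    have "(\<Sum>s\<in>P. m1 s - m2 s) = (\<Sum>s\<in>P. \<alpha> s) - (\<Sum>s\<in>P. coboundary T \<nu> \<gamma> s)"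
      unfolding g(2) by (simp add: sum_subtractf[symmetric])
    then show ?thesis using c(2)[OF P] sum_coboundary_le[where \<beta> = \<gamma> and M = M, OF P M(2)] by (simp add: distrib_right)
  qed
  moreover have "c + M \<ge> 0" using c M by simp
  ultimately obtain \<beta> where "\<forall>d. \<bar>\<beta> d\<bar> \<le> c + M" "\<forall>s\<in>V. coboundary T \<nu> \<beta> s = m1 s - m2 s"
    using max_flow_min_cut[of "c + M" "\<lambda>s. m1 s - m2 s"] by blast
  then show "\<exists>\<beta> M. balances \<beta> \<and> (\<forall>d. \<bar>\<beta> d\<bar> \<le> M)" unfolding balances_def by blast
qed

end

theorem theorem1p3:
  fixes T :: "(real ^ 'n, 'l) tile set"
    and \<nu> :: "(real ^ 'n) set \<Rightarrow> real ^ 'n"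
    and f1 f2 :: "real ^ 'n \<Rightarrow> real"
  assumes "tiling T"
    and "polytopal T"
    and "full_face_to_full_face T"
    and "finite_local_complexity T"
    and "aperiodic T"
    and "repetitive T"
    and "facet_orientation T \<nu>"
    and "strongly_PE T f1" and "\<And>x. f1 x > 0"
    and "strongly_PE T f2" and "\<And>x. f2 x > 0"
  shows "((\<exists>b. bounded_transport f1 f2 b) \<longleftrightarrow>
           well_balanced_class T (class_diff T \<nu> (mass_class T \<nu> f1) (mass_class T \<nu> f2))) \<and>
         ((\<exists>b. weakly_PE_transport T f1 f2 b) \<longleftrightarrow>
           asymptotically_negligible_class T \<nu>
             (class_diff T \<nu> (mass_class T \<nu> f1) (mass_class T \<nu> f2))) \<and>
         ((\<exists>b. strongly_PE_transport T f1 f2 b) \<longleftrightarrow> mass_class T \<nu> f1 = mass_class T \<nu> f2)"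
proof -
  interpret flc_masses T \<nu> f1 f2
    using assms by unfold_locales auto
  show ?thesis using bounded_part weakly_PE_part strongly_PE_part by blast
qed

end
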